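(* Let $d\ge 1$ and $n\ge 1$ be integers, $t=d+n$, and let ${\mathbb X}\subseteq{\mathbb P}^2$ be a set of $\binom{d+1}{2}$ distinct points in generic position. Let $I_t$ be the degree-$t$ component of the homogeneous ideal $I_{\mathbb X}\subseteq R=\mathfrak{k}[w_1,w_2,w_3]$, and let $\overline{\Lambda_t}\subseteq{\mathbb P}^p$, $p=\binom{n+2}{2}(d+1)-1$, be the embedding of the blowup ${\mathbb P}^2({\mathbb X})$ of ${\mathbb P}^2$ at ${\mathbb X}$ given by the linear system $I_t$, namely the closure of the image of the rational map ${\mathbb P}^2 - - \rightarrow {\mathbb P}^p$, $[w_1:w_2:w_3]\mapsto [z_iF_j]_{1\le i\le u,\,1\le j\le d+1}$. Then the subscheme $\overline{\Lambda_t}$ of ${\mathbb P}^p$ is defined by $\binom{n+1}{2}d$ linear forms together with the $2\times 2$ minors of a box-shaped matrix of linear forms.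
   Context: $\mathfrak{k}$ is algebraically closed of characteristic $0$. "Generic position" means the Hilbert function of ${\mathbb X}$ is maximal: $\dim_{\mathfrak{k}}(R/I_{\mathbb X})_s=\min\{\binom{s+2}{2},|{\mathbb X}|\}$ for all $s$; then $I_{\mathbb X}=\bigoplus_{s\ge d}I_s$ is generated by $I_d$, and its minimal generators $F_1,\dots,F_{d+1}$ are the signed maximal minors $F_j=(-1)^{j+1}\det({\bf L}\setminus j\text{-th column})$ of a $d\times(d+1)$ matrix ${\bf L}$ of linear forms. Here $u=\binom{n+2}{2}$ and $z_1=w_1^n,z_2=w_1^{n-1}w_2,\dots,z_u=w_3^n$ are the degree-$n$ monomials in lexicographic order ($w_1>w_2>w_3$); the homogeneous coordinates of ${\mathbb P}^p$ are $x_{ij}$ ($1\le i\le u$, $1\le j\le d+1$). A box-shaped matrix of size $r_1\times\cdots\times r_m$ is an array $(a_{i_1\ldots i_m})$ indexed by $\{(i_1,\dots,i_m):1\le i_k\le r_k\}$; its $2\times2$ minors are the elements $a_{i_1\ldots i_l\ldots i_m}a_{j_1\ldots j_l\ldots j_m}-a_{i_1\ldots i_{l-1}j_li_{l+1}\ldots i_m}a_{j_1\ldots j_{l-1}i_lj_{l+1}\ldots j_m}$ for any coordinate $l$ and any two index points. *)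

theory Defs
  imports Main "HOL-Library.Poly_Mapping" "HOL-Computational_Algebra.Polynomial"
begin

type_synonym ('v, 'k) mpoly = "('v \<Rightarrow>\<^sub>0 nat) \<Rightarrow>\<^sub>0 'k"

definition alg_closed :: "'k::field itself \<Rightarrow> bool" where
  "alg_closed _ \<longleftrightarrow> (\<forall>p :: 'k poly. degree p > 0 \<longrightarrow> (\<exists>x. poly p x = 0))"

definition Var :: "'v \<Rightarrow> ('v, 'k::{zero,one}) mpoly" where
  "Var v = Poly_Mapping.single (Poly_Mapping.single v 1) 1"

definition Const :: "'k::zero \<Rightarrow> ('v, 'k) mpoly" where
  "Const c = Poly_Mapping.single 0 c"

definition smul :: "'k::comm_ring_1 \<Rightarrow> ('v, 'k) mpoly \<Rightarrow> ('v, 'k) mpoly" where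
  "smul c p = Const c * p"

definition mon_eval :: "('v \<Rightarrow> 'k::comm_ring_1) \<Rightarrow> ('v \<Rightarrow>\<^sub>0 nat) \<Rightarrow> 'k" where
  "mon_eval a m = (\<Prod>v\<in>Poly_Mapping.keys m. a v ^ Poly_Mapping.lookup m v)"

definition peval :: "('v \<Rightarrow> 'k::comm_ring_1) \<Rightarrow> ('v, 'k) mpoly \<Rightarrow> 'k" where
  "peval a p = (\<Sum>m\<in>Poly_Mapping.keys p. Poly_Mapping.lookup p m * mon_eval a m)"

definition mdeg :: "('v \<Rightarrow>\<^sub>0 nat) \<Rightarrow> nat" where
  "mdeg m = (\<Sum>v\<in>Poly_Mapping.keys m. Poly_Mapping.lookup m v)"

text \<open>homogeneous of degree s (the zero polynomial is homogeneous of every degree)\<close>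
definition homog :: "nat \<Rightarrow> ('v, 'k::zero) mpoly \<Rightarrow> bool" where
  "homog s p \<longleftrightarrow> (\<forall>m\<in>Poly_Mapping.keys p. mdeg m = s)"

definition polys_in :: "'v set \<Rightarrow> ('v, 'k::zero) mpoly set" where
  "polys_in V = {p. \<forall>m\<in>Poly_Mapping.keys p. Poly_Mapping.keys m \<subseteq> V}"

definition ideal_gen :: "'v set \<Rightarrow> ('v, 'k::comm_ring_1) mpoly set \<Rightarrow> ('v, 'k) mpoly set" where
  "ideal_gen V S = {\<Sum>i<N. c i * g i | (N::nat) (c::nat \<Rightarrow> ('v, 'k) mpoly) (g::nat \<Rightarrow> ('v, 'k) mpoly). (\<forall>i<N. c i \<in> polys_in V \<and> g i \<in> S)}"

text \<open>saturation of J \<subseteq> k[V] (V finite) with respect to the irrelevant ideal (Var v, v \<in> V)\<close>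
definition saturation :: "'v set \<Rightarrow> ('v, 'k::comm_ring_1) mpoly set \<Rightarrow> ('v, 'k) mpoly set" where
  "saturation V J = {f \<in> polys_in V. \<exists>k. \<forall>v\<in>V. Var v ^ k * f \<in> J}"

section \<open>The plane: R = k[w1,w2,w3], variables 0,1,2\<close>

definition W :: "nat set" where "W = {0,1,2}"

text \<open>A set of representatives in k^3 - 0 of distinct points of P^2.\<close>
definition proj_points :: "(nat \<Rightarrow> 'k::field) set \<Rightarrow> bool" where
  "proj_points X \<longleftrightarrow> finite X \<and>
     (\<forall>P\<in>X. \<exists>i\<in>W. P i \<noteq> 0) \<and>
     (\<forall>P\<in>X. \<forall>Q\<in>X. P \<noteq> Q \<longrightarrow> \<not> (\<exists>c. \<forall>i\<in>W. Q i = c * P i))"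

definition I_comp :: "(nat \<Rightarrow> 'k::field) set \<Rightarrow> nat \<Rightarrow> (nat, 'k) mpoly set" where
  "I_comp X s = {f \<in> polys_in W. homog s f \<and> (\<forall>P\<in>X. peval P f = 0)}"

text \<open>generic position: dim (R/I_X)_s = min(binom(s+2,2), |X|), where
  dim (R/I_X)_s = dim R_s - dim I_s = binom(s+2,2) - dim I_s\<close>
definition generic_position :: "(nat \<Rightarrow> 'k::field) set \<Rightarrow> bool" where
  "generic_position X \<longleftrightarrow> (\<forall>s. ((s+2) choose 2) - vector_space.dim smul (I_comp X s)
        = min ((s+2) choose 2) (card X))"

text \<open>degree-n monomials of k[w1,w2,w3] in lexicographic order (w1 > w2 > w3);
  z n i for 1 \<le> i \<le> binom(n+2,2)\<close>
definition mono3 :: "nat \<Rightarrow> nat \<Rightarrow> nat \<Rightarrow> (nat, 'k::comm_ring_1) mpoly" where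
  "mono3 a b c = Var 0 ^ a * Var 1 ^ b * Var 2 ^ c"

definition lex_exps :: "nat \<Rightarrow> (nat \<times> nat \<times> nat) list" where
  "lex_exps n = concat (map (\<lambda>a. map (\<lambda>b. (a, b, n - a - b)) (rev [0..<n - a + 1])) (rev [0..<n+1]))"

definition z :: "nat \<Rightarrow> nat \<Rightarrow> (nat, 'k::comm_ring_1) mpoly" where
  "z n i = (case lex_exps n ! (i - 1) of (a, b, c) \<Rightarrow> mono3 a b c)"

section \<open>P^p: variables x_ij = (i,j), 1 \<le> i \<le> u, 1 \<le> j \<le> d+1\<close>

definition XV :: "nat \<Rightarrow> nat \<Rightarrow> (nat \<times> nat) set" where
  "XV u d = {1..u} \<times> {1..d+1}"

text \<open>homogeneous ideal of the closure of the image of [w] \<mapsto> [z_i F_j]: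
  all polynomials in the x_ij vanishing on the (affine cone of the) image\<close>
definition image_ideal :: "nat \<Rightarrow> nat \<Rightarrow> (nat \<Rightarrow> (nat, 'k::field) mpoly) \<Rightarrow> (nat \<times> nat, 'k) mpoly set" where
  "image_ideal n d F = {G \<in> polys_in (XV ((n+2) choose 2) d).
      \<forall>w :: nat \<Rightarrow> 'k. peval (\<lambda>(i, j). peval w (z n i * F j)) G = 0}"

text \<open>box-shaped matrix of size r_1 x ... x r_m (r = [r_1,...,r_m]), entries indexed by lists\<close>
definition box_index :: "nat list \<Rightarrow> nat list set" where
  "box_index r = {l. length l = length r \<and> (\<forall>k<length r. 1 \<le> l ! k \<and> l ! k \<le> r ! k)}"

definition box_minors :: "nat list \<Rightarrow> (nat list \<Rightarrow> 'a::comm_ring_1) \<Rightarrow> 'a set" where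
  "box_minors r A = {A a * A b - A (a[l := b ! l]) * A (b[l := a ! l]) | a b l.
       a \<in> box_index r \<and> b \<in> box_index r \<and> l < length r}"

end

theory Submission
  imports Defs
begin

text \<open>
  A linear form h that vanishes at no point of X is a nonzerodivisor modulo the ideal of X, and
  generic position says that modulo h the ideal becomes the d-th power of the irrelevant ideal of
  k[w1, w2]. Lifting the syzygies of the monomials of degree d gives a d x (d+1) matrix M
  of linear forms whose rows freely generate all syzygies of the F_j. Multiplying the rows by the
  monomials of degree n - 1 gives the linear forms; the box is the 3 x ... x 3 x (d+1) array
  whose entry at (i_1, ..., i_n, j) is the coordinate of w_{i_1} ... w_{i_n} F_j, so that its minors
  cut out the Segre-Veronese embedding of P^2 x P^d.

  For the saturation, fix a chart of the Segre-Veronese variety. For each point P of X choose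
  a form s of degree d - 1 that vanishes on X except at P, and let a, b be linear forms generating
  the ideal of P. Then a s and b s lie in the ideal of X and s F_j is a combination of
  them, so after multiplication by a power of s an element of the kernel becomes a binary form that
  vanishes at (a, b), hence a multiple of the syzygy between a s and b s. The forms s are a
  basis of the forms of degree d - 1, so a power of every w_i does the same.
\<close>

section \<open>Polynomials, evaluation and degree\<close>

text \<open>The obstacle is the passage from the symmetric algebra to the Rees algebra. The rows of
  M give only relations linear in the F_j, whereas a kernel element of degree k has degree k in
  them. Up to powers of the irrelevant ideal both kinds of relations agree because the points are
  reduced: the ideal of a point is generated by two coprime linear forms, and all relations between
  the powers of two coprime elements follow from a single linear one
  (\<open>syzygy_of_powers\<close>). The same fact, applied to w1 and w2, gives the syzygies modulo
  h.

  No localization and no quotient ring is formed. Inverses on a chart become powers of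
  \<open>x0\<close>, congruence modulo I is written \<open>x - y \<in> I\<close>, and a chart is a
  ring map into the ambient polynomial ring. Ideals live in the ring over all variables of the type,
  so that arbitrary cofactors are allowed; \<open>retract\<close> leads back to k[V] at the
  end.\<close>

definition rhom :: "('a::comm_ring_1 \<Rightarrow> 'b::comm_ring_1) \<Rightarrow> bool" where
  "rhom f \<longleftrightarrow> f 1 = 1 \<and> (\<forall>x y. f (x + y) = f x + f y) \<and> (\<forall>x y. f (x * y) = f x * f y)"

lemma rhomD:
  assumes "rhom f"
  shows rhom_one: "f 1 = 1"
    and rhom_add: "f (x + y) = f x + f y"
    and rhom_mult: "f (x * y) = f x * f y"
  using assms by (simp_all add: rhom_def)

lemma rhom_zero: "rhom f \<Longrightarrow> f 0 = 0"
  by (metis add_cancel_left_right rhom_add)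

lemma rhom_minus: "rhom f \<Longrightarrow> f (x - y) = f x - f y"
  by (metis add_diff_cancel diff_add_cancel rhom_add)

lemma rhom_sum: "rhom f \<Longrightarrow> f (sum g I) = (\<Sum>i\<in>I. f (g i))"
  by (induction I rule: infinite_finite_induct) (simp_all add: rhom_zero rhom_add)

lemma rhom_prod: "rhom f \<Longrightarrow> f (prod g I) = (\<Prod>i\<in>I. f (g i))"
  by (induction I rule: infinite_finite_induct) (simp_all add: rhom_one rhom_mult)

lemma rhom_power: "rhom f \<Longrightarrow> f (x ^ k) = f x ^ k"
  by (induction k) (simp_all add: rhom_one rhom_mult)

lemma rhom_id: "rhom (\<lambda>x. x)"
  by (simp add: rhom_def)

lemma Const_0: "Const 0 = 0" and Const_1: "Const 1 = 1"
  by (simp_all add: Const_def)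

lemma Const_add: "Const (a + b) = Const a + Const b"
  by (simp add: Const_def single_add)

lemma Const_mult: "Const (a * b) = Const a * Const b"
  by (simp add: Const_def mult_single)

lemma rhom_Const: "rhom Const"
  by (simp add: rhom_def Const_1 Const_add Const_mult)

lemma smul_sum_right: "smul c (sum g I) = (\<Sum>i\<in>I. smul c (g i))"
  by (simp add: smul_def sum_distrib_left)

lemma vector_space_smul: "vector_space (smul :: 'k::field \<Rightarrow> ('v,'k) mpoly \<Rightarrow> ('v,'k) mpoly)"
  by unfold_locales (simp_all add: smul_def Const_add Const_mult Const_1 algebra_simps)

section \<open>Values and degrees of monomials\<close>

lemma mon_eval_superset:
  assumes "finite V" "Poly_Mapping.keys m \<subseteq> V"
  shows "mon_eval a m = (\<Prod>v\<in>V. a v ^ Poly_Mapping.lookup m v)"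
  unfolding mon_eval_def
  by (rule prod.mono_neutral_left[OF assms]) (simp add: in_keys_iff)

lemma mon_eval_0 [simp]: "mon_eval a 0 = 1"
  by (simp add: mon_eval_def)

lemma mon_eval_single [simp]: "mon_eval a (Poly_Mapping.single v k) = a v ^ k"
  by (simp add: mon_eval_def)

lemma mon_eval_add: "mon_eval a (m + m') = mon_eval a m * mon_eval a m'"
proof -
  let ?V = "Poly_Mapping.keys m \<union> Poly_Mapping.keys m'"
  have "mon_eval a (m + m') = (\<Prod>v\<in>?V. a v ^ Poly_Mapping.lookup (m + m') v)"
    by (rule mon_eval_superset) (simp_all add: keys_add)
  also have "\<dots> = (\<Prod>v\<in>?V. a v ^ Poly_Mapping.lookup m v) * (\<Prod>v\<in>?V. a v ^ Poly_Mapping.lookup m' v)"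
    by (simp add: lookup_add power_add prod.distrib)
  finally show ?thesis
    by (simp add: mon_eval_superset[of ?V])
qed

lemma rhom_mon_eval: "rhom f \<Longrightarrow> f (mon_eval a m) = mon_eval (\<lambda>v. f (a v)) m"
  by (simp add: mon_eval_def rhom_prod rhom_power)

lemma mon_eval_scale: "mon_eval (\<lambda>v. c * a v) m = c ^ mdeg m * mon_eval a m"
  by (simp add: mon_eval_def mdeg_def power_mult_distrib prod.distrib power_sum)

lemma mdeg_superset:
  assumes "finite V" "Poly_Mapping.keys m \<subseteq> V"
  shows "mdeg m = (\<Sum>v\<in>V. Poly_Mapping.lookup m v)"
  unfolding mdeg_def
  by (rule sum.mono_neutral_left[OF assms]) (simp add: in_keys_iff)

lemma mdeg_0 [simp]: "mdeg 0 = 0"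
  by (simp add: mdeg_def)

lemma mdeg_single [simp]: "mdeg (Poly_Mapping.single v k) = k"
  by (simp add: mdeg_def)

lemma mdeg_add: "mdeg (m + m') = mdeg m + mdeg m'"
proof -
  let ?V = "Poly_Mapping.keys m \<union> Poly_Mapping.keys m'"
  have "mdeg (m + m') = (\<Sum>v\<in>?V. Poly_Mapping.lookup (m + m') v)"
    by (rule mdeg_superset) (simp_all add: keys_add)
  also have "\<dots> = (\<Sum>v\<in>?V. Poly_Mapping.lookup m v) + (\<Sum>v\<in>?V. Poly_Mapping.lookup m' v)"
    by (simp add: lookup_add sum.distrib)
  finally show ?thesis
    by (simp add: mdeg_superset[of ?V])
qed

text \<open>The coefficient map \<open>e\<close> lets one construction serve twice: the identity
  gives \<open>peval\<close>, and \<open>Const\<close> gives substitution of polynomials for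
  variables.\<close>

definition ev :: "('k::comm_ring_1 \<Rightarrow> 'r::comm_ring_1) \<Rightarrow> ('v \<Rightarrow> 'r) \<Rightarrow> ('v, 'k) mpoly \<Rightarrow> 'r" where
  "ev e a p = (\<Sum>m\<in>Poly_Mapping.keys p. e (Poly_Mapping.lookup p m) * mon_eval a m)"

lemma peval_eq_ev: "peval a = ev (\<lambda>c. c) a"
  by (simp add: peval_def ev_def fun_eq_iff)

lemma ev_superset:
  assumes "rhom e" "finite K" "Poly_Mapping.keys p \<subseteq> K"
  shows "ev e a p = (\<Sum>m\<in>K. e (Poly_Mapping.lookup p m) * mon_eval a m)"
  unfolding ev_def
  by (rule sum.mono_neutral_left[OF assms(2,3)]) (simp add: in_keys_iff rhom_zero[OF assms(1)])

lemma ev_add: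
  assumes "rhom e" shows "ev e a (p + q) = ev e a p + ev e a q"
proof -
  let ?K = "Poly_Mapping.keys p \<union> Poly_Mapping.keys q"
  have "ev e a (p + q) = (\<Sum>m\<in>?K. e (Poly_Mapping.lookup (p + q) m) * mon_eval a m)"
    by (rule ev_superset[OF assms]) (simp_all add: keys_add)
  also have "\<dots> = (\<Sum>m\<in>?K. e (Poly_Mapping.lookup p m) * mon_eval a m)
      + (\<Sum>m\<in>?K. e (Poly_Mapping.lookup q m) * mon_eval a m)"
    by (simp add: lookup_add rhom_add[OF assms] algebra_simps sum.distrib)
  finally show ?thesis
    by (simp add: ev_superset[OF assms, of ?K])
qed

lemma ev_zero [simp]: "ev e a 0 = 0"
  by (simp add: ev_def)

lemma ev_single: "rhom e \<Longrightarrow> ev e a (Poly_Mapping.single m c) = e c * mon_eval a m"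
  by (simp add: ev_def rhom_zero)

lemma poly_mapping_sum_single:
  "p = (\<Sum>m\<in>Poly_Mapping.keys p. Poly_Mapping.single m (Poly_Mapping.lookup p m))"
  by (rule poly_mapping_eqI)
    (simp add: lookup_sum lookup_single when_def sum.delta in_keys_iff)

text \<open>The monomial case keeps \<open>m \<in> keys p\<close> for the polynomial
  \<open>p\<close> of the conclusion, so a hypothesis about the terms of \<open>p\<close>, such as
  homogeneity, remains usable there.\<close>

lemma single_induct [case_names zero single add]:
  fixes p :: "('v, 'k::comm_monoid_add) mpoly"
  assumes "P 0" "\<And>m c. m \<in> Poly_Mapping.keys p \<Longrightarrow> P (Poly_Mapping.single m c)" "\<And>p q. P p \<Longrightarrow> P q \<Longrightarrow> P (p + q)"
  shows "P p"
proof -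
  have "P (\<Sum>m\<in>I. Poly_Mapping.single m (Poly_Mapping.lookup p m))" if "I \<subseteq> Poly_Mapping.keys p" for I
    using finite_subset[OF that finite_keys] that
    by (induction I rule: finite_induct) (simp_all add: assms)
  then show ?thesis
    using poly_mapping_sum_single[of p] by (metis order_refl)
qed

lemma ev_mult:
  assumes "rhom e" shows "ev e a (p * q) = ev e a p * ev e a q"
proof (induction p rule: single_induct)
  case (single m c)
  show ?case
  proof (induction q rule: single_induct)
    case (single m' c')
    show ?case
      by (simp add: mult_single ev_single[OF assms] mon_eval_add rhom_mult[OF assms])
  qed (simp_all add: ev_add[OF assms] algebra_simps)
qed (simp_all add: ev_add[OF assms] algebra_simps)

lemma ev_Const [simp]: "rhom e \<Longrightarrow> ev e a (Const c) = e c"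
  by (simp add: Const_def ev_single)

lemma ev_Var [simp]: "rhom e \<Longrightarrow> ev e a (Var v) = a v"
  by (simp add: Var_def ev_single rhom_one)

lemma rhom_ev: "rhom e \<Longrightarrow> rhom (ev e a)"
  using ev_Const[of e a 1] by (simp add: rhom_def ev_add ev_mult Const_1)

lemma rhom_peval: "rhom (peval a)"
  by (simp add: peval_eq_ev rhom_ev rhom_id)

lemma rhom_comp_ev: "rhom f \<Longrightarrow> f (ev e a p) = ev (\<lambda>c. f (e c)) (\<lambda>v. f (a v)) p"
  by (simp add: ev_def rhom_sum rhom_mult rhom_mon_eval)

abbreviation subst :: "('v \<Rightarrow> ('u, 'k::comm_ring_1) mpoly) \<Rightarrow> ('v, 'k) mpoly \<Rightarrow> ('u, 'k) mpoly" where
  "subst \<equiv> ev Const"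

lemmas rhom_subst = rhom_ev[OF rhom_Const]

lemma peval_subst: "peval b (subst a p) = peval (\<lambda>v. peval b (a v)) p"
  by (simp add: rhom_comp_ev[OF rhom_peval]) (simp add: peval_eq_ev rhom_id)

lemma peval_Const [simp]: "peval a (Const c) = c"
  by (simp add: peval_eq_ev rhom_id)

lemma peval_Var [simp]: "peval a (Var v) = a v"
  by (simp add: peval_eq_ev rhom_id)

lemma subst_smul: "subst a (smul c p) = smul c (subst a p)"
  by (simp add: smul_def rhom_mult[OF rhom_subst] rhom_Const)

lemma mon_eval_Var: "mon_eval Var m = Poly_Mapping.single m (1::'k::comm_ring_1)"
proof -
  have pw: "Var v ^ k = Poly_Mapping.single (Poly_Mapping.single v k) (1::'k)" for v :: 'a and k
    by (induction k) (simp_all add: Var_def mult_single single_add[symmetric])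
  have "(\<Prod>v\<in>V. Poly_Mapping.single (Poly_Mapping.single v (f v)) (1::'k))
      = Poly_Mapping.single (\<Sum>v\<in>V. Poly_Mapping.single v (f v)) 1" for V :: "'a set" and f :: "'a \<Rightarrow> nat"
    by (induction V rule: infinite_finite_induct) (simp_all add: mult_single)
  then show ?thesis
    unfolding mon_eval_def pw by (simp add: poly_mapping_sum_single[symmetric])
qed

lemma single_eq_Const_mult: "Poly_Mapping.single m c = Const c * mon_eval Var m"
  by (simp add: mon_eval_Var Const_def mult_single)

lemma subst_Var [simp]: "subst Var p = p"
  by (simp add: ev_def single_eq_Const_mult[symmetric] poly_mapping_sum_single[symmetric])

lemma ev_cong:
  assumes "p \<in> polys_in V" "\<And>v. v \<in> V \<Longrightarrow> a v = b v"
  shows "ev e a p = ev e b p"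
  unfolding ev_def mon_eval_def using assms
  by (intro sum.cong arg_cong2[where f="(*)"] prod.cong refl) (auto simp: polys_in_def subset_iff)

lemma ev_scale_homog:
  assumes "homog k p" shows "ev e (\<lambda>v. c * a v) p = c ^ k * ev e a p"
  using assms unfolding ev_def homog_def mon_eval_scale sum_distrib_left
  by (intro sum.cong refl) (simp add: algebra_simps)

section \<open>Closure properties of \<open>polys_in\<close> and \<open>homog\<close>\<close>

lemma polys_in_0: "0 \<in> polys_in V"
  by (simp add: polys_in_def)

lemma polys_in_single: "Poly_Mapping.keys m \<subseteq> V \<Longrightarrow> Poly_Mapping.single m c \<in> polys_in V"
  by (simp add: polys_in_def)

lemma polys_in_Const: "Const c \<in> polys_in V"
  by (simp add: Const_def polys_in_single)

lemma polys_in_1: "1 \<in> polys_in V"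
  by (simp add: polys_in_def)

lemma polys_in_Var: "v \<in> V \<Longrightarrow> Var v \<in> polys_in V"
  by (simp add: Var_def polys_in_single)

lemma polys_in_add: "p \<in> polys_in V \<Longrightarrow> q \<in> polys_in V \<Longrightarrow> p + q \<in> polys_in V"
  using keys_add[of p q] by (fastforce simp: polys_in_def)

lemma polys_in_uminus: "p \<in> polys_in V \<Longrightarrow> - p \<in> polys_in (V :: 'v set)" for p :: "('v, 'k::comm_ring_1) mpoly"
  by (simp add: polys_in_def in_keys_iff)

lemma polys_in_minus:
  "p \<in> polys_in V \<Longrightarrow> q \<in> polys_in V \<Longrightarrow> p - q \<in> polys_in V" for p :: "('v, 'k::comm_ring_1) mpoly"
  using polys_in_add[OF _ polys_in_uminus, of p V q] by simp

lemma polys_in_mult: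
  assumes "p \<in> polys_in V" "q \<in> polys_in V" shows "p * q \<in> polys_in V"
proof -
  have "Poly_Mapping.keys m \<subseteq> V" if m: "m \<in> Poly_Mapping.keys (p * q)" for m
  proof -
    obtain a b where "m = a + b" "a \<in> Poly_Mapping.keys p" "b \<in> Poly_Mapping.keys q"
      using m keys_mult[of p q] by blast
    then show ?thesis
      using assms keys_add[of a b] by (fastforce simp: polys_in_def)
  qed
  then show ?thesis by (simp add: polys_in_def)
qed

lemma polys_in_sum: "(\<And>i. i \<in> I \<Longrightarrow> f i \<in> polys_in V) \<Longrightarrow> sum f I \<in> polys_in V"
  by (induction I rule: infinite_finite_induct) (simp_all add: polys_in_0 polys_in_add)

lemma polys_in_prod:
  "(\<And>i. i \<in> I \<Longrightarrow> f i \<in> polys_in V) \<Longrightarrow> prod f I \<in> polys_in V"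
  by (induction I rule: infinite_finite_induct) (simp_all add: polys_in_1 polys_in_mult)

lemma polys_in_power: "p \<in> polys_in V \<Longrightarrow> p ^ k \<in> polys_in V"
  by (induction k) (simp_all add: polys_in_1 polys_in_mult)

lemma polys_in_smul: "p \<in> polys_in V \<Longrightarrow> smul c p \<in> polys_in V"
  by (simp add: smul_def polys_in_mult polys_in_Const)

lemmas polys_in_intros = polys_in_0 polys_in_1 polys_in_Const polys_in_Var polys_in_add
  polys_in_minus polys_in_mult polys_in_sum polys_in_prod polys_in_power polys_in_smul

lemma polys_in_UNIV: "p \<in> polys_in UNIV"
  by (simp add: polys_in_def)

lemma polys_in_subst:
  assumes "p \<in> polys_in U" "\<And>v. v \<in> U \<Longrightarrow> a v \<in> polys_in V"
  shows "subst a p \<in> polys_in V"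
proof -
  have "v \<in> U" if "m \<in> Poly_Mapping.keys p" "v \<in> Poly_Mapping.keys m" for m v
    using assms(1) that by (auto simp: polys_in_def)
  then show ?thesis
    unfolding ev_def mon_eval_def using assms(2)
    by (intro polys_in_sum polys_in_mult polys_in_Const polys_in_prod polys_in_power) blast
qed

lemma homog_0: "homog k 0"
  by (simp add: homog_def)

lemma homog_Const: "homog 0 (Const c)"
  by (simp add: homog_def Const_def)

lemma homog_Var: "homog 1 (Var v)"
  by (simp add: homog_def Var_def)

lemma homog_add: "homog k p \<Longrightarrow> homog k q \<Longrightarrow> homog k (p + q)"
  using keys_add[of p q] by (auto simp: homog_def)

lemma homog_minus: "homog k p \<Longrightarrow> homog k q \<Longrightarrow> homog k (p - q)" for p :: "('v, 'k::comm_ring_1) mpoly"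
  using homog_add[of k p "- q"] by (simp add: homog_def in_keys_iff)

lemma homog_mult:
  assumes "homog k p" "homog l q" shows "homog (k + l) (p * q)"
proof -
  have "mdeg m = k + l" if m: "m \<in> Poly_Mapping.keys (p * q)" for m
  proof -
    obtain a b where "m = a + b" "a \<in> Poly_Mapping.keys p" "b \<in> Poly_Mapping.keys q"
      using m keys_mult[of p q] by blast
    then show ?thesis
      using assms by (simp add: homog_def mdeg_add)
  qed
  then show ?thesis by (simp add: homog_def)
qed

lemma homog_sum: "(\<And>i. i \<in> I \<Longrightarrow> homog k (f i)) \<Longrightarrow> homog k (sum f I)"
  by (induction I rule: infinite_finite_induct) (simp_all add: homog_0 homog_add)

lemma homog_1: "homog 0 1"
  by (simp add: homog_def)

lemma homog_power: "homog k p \<Longrightarrow> homog (j * k) (p ^ j)"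
  by (induction j) (simp_all add: homog_1 homog_mult)

lemma homog_smul: "homog k p \<Longrightarrow> homog k (smul c p)"
  using homog_mult[OF homog_Const] by (fastforce simp: smul_def)

lemma homog_prod:
  "(\<And>i. i \<in> I \<Longrightarrow> homog (k i) (f i)) \<Longrightarrow> homog (sum k I) (prod f I)"
  by (induction I rule: infinite_finite_induct) (simp_all add: homog_1 homog_mult)

lemma homog_subst:
  assumes "homog k p" "p \<in> polys_in V" "\<And>v. v \<in> V \<Longrightarrow> homog l (a v)"
  shows "homog (k * l) (subst a p)"
  unfolding ev_def mon_eval_def
proof (rule homog_sum)
  fix m assume m: "m \<in> Poly_Mapping.keys p"
  have "homog (\<Sum>v\<in>Poly_Mapping.keys m. Poly_Mapping.lookup m v * l)
      (\<Prod>v\<in>Poly_Mapping.keys m. a v ^ Poly_Mapping.lookup m v)"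
    using assms m by (intro homog_prod homog_power) (auto simp: polys_in_def)
  moreover have "(\<Sum>v\<in>Poly_Mapping.keys m. Poly_Mapping.lookup m v * l) = k * l"
    using assms m by (simp add: homog_def mdeg_def sum_distrib_right[symmetric])
  ultimately show "homog (k * l) (Const (Poly_Mapping.lookup p m)
      * (\<Prod>v\<in>Poly_Mapping.keys m. a v ^ Poly_Mapping.lookup m v))"
    using homog_mult[OF homog_Const] by fastforce
qed

text \<open>With \<open>j < D\<close> this is truncation, with \<open>j = k\<close> it is a
  homogeneous component. A degree bound is expressed as
  \<open>filt (\<lambda>j. j < D) p = p\<close>, which treats the zero polynomial like any other and
  supports induction on D.\<close>

definition filt :: "(nat \<Rightarrow> bool) \<Rightarrow> ('v, 'k::comm_monoid_add) mpoly \<Rightarrow> ('v, 'k) mpoly" where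
  "filt P p = (\<Sum>m\<in>Poly_Mapping.keys p. Poly_Mapping.single m (if P (mdeg m) then Poly_Mapping.lookup p m else 0))"

lemma lookup_filt:
  "Poly_Mapping.lookup (filt P p) m = (if P (mdeg m) then Poly_Mapping.lookup p m else 0)"
  by (simp add: filt_def lookup_sum lookup_single when_def in_keys_iff)

lemma keys_filt: "Poly_Mapping.keys (filt P p) = {m \<in> Poly_Mapping.keys p. P (mdeg m)}"
  by (auto simp: in_keys_iff lookup_filt split: if_splits)

lemma filt_add: "filt P (p + q) = filt P p + filt P q"
  by (rule poly_mapping_eqI) (simp add: lookup_filt lookup_add)

lemma filt_minus: "filt P (p - q) = filt P p - filt P q" for p :: "('v, 'k::comm_ring_1) mpoly"
  by (rule poly_mapping_eqI) (simp add: lookup_filt lookup_minus)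

lemma filt_0 [simp]: "filt P 0 = 0"
  by (simp add: filt_def)

lemma filt_sum: "filt P (sum f I) = (\<Sum>i\<in>I. filt P (f i))"
  by (induction I rule: infinite_finite_induct) (simp_all add: filt_add)

lemma filt_single: "filt P (Poly_Mapping.single m c) = (if P (mdeg m) then Poly_Mapping.single m c else 0)"
  by (rule poly_mapping_eqI) (auto simp: lookup_filt lookup_single when_def)

lemma filt_homog_mult:
  assumes "homog k h" shows "filt P (h * q) = h * filt (\<lambda>j. P (k + j)) q"
proof (induction h rule: single_induct)
  case (single m c)
  then have m: "mdeg m = k" using assms by (simp add: homog_def)
  show ?case
  proof (induction q rule: single_induct)
    case (single m' c')
    show ?case by (simp add: mult_single filt_single mdeg_add m)
  qed (simp_all add: filt_add algebra_simps)
qed (simp_all add: filt_add algebra_simps)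

lemma filt_homog: "homog k p \<Longrightarrow> filt P p = (if P k then p else 0)"
  by (rule poly_mapping_eqI) (auto simp: lookup_filt homog_def in_keys_iff)

lemma filt_cong: "(\<And>m. m \<in> Poly_Mapping.keys p \<Longrightarrow> P (mdeg m)) \<Longrightarrow> filt P p = p"
  by (rule poly_mapping_eqI) (auto simp: lookup_filt in_keys_iff)

lemma homog_filt_eq: "homog k (filt (\<lambda>j. j = k) p)"
  by (simp add: homog_def keys_filt)

lemma polys_in_filt: "p \<in> polys_in V \<Longrightarrow> filt P p \<in> polys_in V"
  by (simp add: polys_in_def keys_filt)

lemma filt_False: "filt (\<lambda>j. False) p = 0"
  by (simp add: filt_def)

text \<open>The bound is stated for every \<open>E \<ge> D\<close> so that bounds of finitely many
  polynomials can be merged into one.\<close>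

lemma filt_less_exists: "\<exists>D. \<forall>E\<ge>D. filt (\<lambda>j. j < E) p = p"
proof -
  have "filt (\<lambda>j. j < E) p = p" if "Suc (\<Sum>m\<in>Poly_Mapping.keys p. mdeg m) \<le> E" for E
    using that member_le_sum[of _ "Poly_Mapping.keys p" mdeg] by (intro filt_cong) fastforce
  then show ?thesis by blast
qed

lemma sum_filt_eq:
  assumes "filt (\<lambda>j. j < D) p = p" shows "p = (\<Sum>k<D. filt (\<lambda>j. j = k) p)"
proof (rule poly_mapping_eqI)
  fix m
  show "Poly_Mapping.lookup p m = Poly_Mapping.lookup (\<Sum>k<D. filt (\<lambda>j. j = k) p) m"
    using arg_cong[OF assms, of "\<lambda>q. Poly_Mapping.lookup q m"]
    by (auto simp: lookup_sum lookup_filt split: if_splits)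
qed

section \<open>Ideals and linear algebra\<close>

text \<open>Ideals of the whole ring of the type. Membership of a difference plays the role of
  equality in the quotient, whence the \<open>ideal_cong\<close> calculus below.\<close>

definition is_ideal :: "'a::comm_ring_1 set \<Rightarrow> bool" where
  "is_ideal I \<longleftrightarrow> 0 \<in> I \<and> (\<forall>x\<in>I. \<forall>y\<in>I. x + y \<in> I) \<and> (\<forall>c. \<forall>x\<in>I. c * x \<in> I)"

lemma is_idealD:
  assumes "is_ideal I"
  shows ideal_0: "0 \<in> I"
    and ideal_add: "x \<in> I \<Longrightarrow> y \<in> I \<Longrightarrow> x + y \<in> I"
    and ideal_mult: "x \<in> I \<Longrightarrow> c * x \<in> I"
  using assms by (simp_all add: is_ideal_def)

lemma ideal_mult_right: "is_ideal I \<Longrightarrow> x \<in> I \<Longrightarrow> x * c \<in> I"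
  using ideal_mult[of I x c] by (simp add: mult.commute)

lemma ideal_sum: "is_ideal I \<Longrightarrow> (\<And>i. i \<in> A \<Longrightarrow> f i \<in> I) \<Longrightarrow> sum f A \<in> I"
  by (induction A rule: infinite_finite_induct) (simp_all add: ideal_0 ideal_add)

lemma ideal_cong_mem: "is_ideal I \<Longrightarrow> x - y \<in> I \<Longrightarrow> y \<in> I \<Longrightarrow> x \<in> I"
  using ideal_add[of I "x - y" y] by simp

lemma ideal_cong_refl: "is_ideal I \<Longrightarrow> x - x \<in> I"
  by (simp add: ideal_0)

lemma ideal_cong_sym: "is_ideal I \<Longrightarrow> x - y \<in> I \<Longrightarrow> y - x \<in> I"
  using ideal_mult[of I "x - y" "-1"] by simp

lemma ideal_cong_trans: "is_ideal I \<Longrightarrow> x - y \<in> I \<Longrightarrow> y - w \<in> I \<Longrightarrow> x - w \<in> I"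
  using ideal_add[of I "x - y" "y - w"] by simp

lemma ideal_cong_mult:
  assumes "is_ideal I" "x - y \<in> I" "x' - y' \<in> I" shows "x * x' - y * y' \<in> I"
proof -
  have "x * x' - y * y' = x' * (x - y) + y * (x' - y')" by (simp add: algebra_simps)
  then show ?thesis using assms by (simp add: ideal_add ideal_mult)
qed

lemma ideal_cong_mult_right: "is_ideal I \<Longrightarrow> x - y \<in> I \<Longrightarrow> x * c - y * c \<in> I"
  by (rule ideal_cong_mult) (simp_all add: ideal_0)

lemma ideal_cong_mult_left: "is_ideal I \<Longrightarrow> x - y \<in> I \<Longrightarrow> c * x - c * y \<in> I"
  by (rule ideal_cong_mult) (simp_all add: ideal_0)

lemma ideal_cong_power: "is_ideal I \<Longrightarrow> x - y \<in> I \<Longrightarrow> x ^ k - y ^ k \<in> I"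
  by (induction k) (simp_all add: ideal_0 ideal_cong_mult)

lemma ideal_cong_prod:
  "is_ideal I \<Longrightarrow> (\<And>i. i \<in> A \<Longrightarrow> f i - g i \<in> I) \<Longrightarrow> prod f A - prod g A \<in> I"
  by (induction A rule: infinite_finite_induct) (simp_all add: ideal_0 ideal_cong_mult)

lemma ideal_cong_sum:
  "is_ideal I \<Longrightarrow> (\<And>i. i \<in> A \<Longrightarrow> f i - g i \<in> I) \<Longrightarrow> sum f A - sum g A \<in> I"
  using ideal_sum[of I A "\<lambda>i. f i - g i"] by (simp add: sum_subtractf)

text \<open>Polynomials respect congruences. This is used modulo a linear form, modulo the ideal of
  a point, and modulo the ideal of the blowup.\<close>

lemma ideal_cong_ev:
  assumes "is_ideal I" "p \<in> polys_in V" "\<And>v. v \<in> V \<Longrightarrow> a v - b v \<in> I"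
  shows "ev e a p - ev e b p \<in> I"
proof -
  have "v \<in> V" if "m \<in> Poly_Mapping.keys p" "v \<in> Poly_Mapping.keys m" for m v
    using assms(2) that by (auto simp: polys_in_def)
  then show ?thesis
    unfolding ev_def mon_eval_def using assms(3)
    by (intro ideal_cong_sum ideal_cong_mult ideal_cong_refl ideal_cong_prod ideal_cong_power assms(1)) blast
qed

lemma is_ideal_principal: "is_ideal {x. h dvd x}"
  by (simp add: is_ideal_def)

lemma is_ideal_pair: "is_ideal {g * x + h * y | x y. True}"
  unfolding is_ideal_def
proof (intro conjI allI ballI)
  show "0 \<in> {g * x + h * y | x y. True}" by (auto intro!: exI[of _ 0])
next
  fix u v assume "u \<in> {g * x + h * y | x y. True}" "v \<in> {g * x + h * y | x y. True}"
  then obtain x y x' y' where "u = g * x + h * y" "v = g * x' + h * y'" by blast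
  then have "u + v = g * (x + x') + h * (y + y')" by (simp add: algebra_simps)
  then show "u + v \<in> {g * x + h * y | x y. True}" by blast
next
  fix c u assume "u \<in> {g * x + h * y | x y. True}"
  then obtain x y where "u = g * x + h * y" by blast
  then have "c * u = g * (c * x) + h * (c * y)" by (simp add: algebra_simps)
  then show "c * u \<in> {g * x + h * y | x y. True}" by blast
qed

lemma is_ideal_colon: "is_ideal I \<Longrightarrow> is_ideal {s. s * g \<in> I}"
  by (auto simp: is_ideal_def distrib_right mult.assoc)

lemma ideal_power_add:
  assumes I: "is_ideal I" and x: "x ^ k \<in> I" and y: "y ^ l \<in> I"
  shows "(x + y) ^ (k + l) \<in> I"
  unfolding binomial_ring
proof (rule ideal_sum[OF I])
  fix i assume "i \<in> {..k + l}"
  have "x ^ i * y ^ (k + l - i) \<in> I"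
  proof (cases "k \<le> i")
    case True
    then have "x ^ i = x ^ (i - k) * x ^ k" by (simp add: power_add[symmetric])
    then show ?thesis using I x by (simp add: ideal_mult ideal_mult_right)
  next
    case False
    then have "y ^ (k + l - i) = y ^ (k - i) * y ^ l" by (simp add: power_add[symmetric])
    then show ?thesis using I y by (simp add: ideal_mult)
  qed
  then show "of_nat (k + l choose i) * x ^ i * y ^ (k + l - i) \<in> I"
    using ideal_mult[OF I] by (simp add: mult.assoc)
qed

text \<open>The radical is closed under finite sums. In the saturation argument the ideal is a colon
  ideal and the summands are multiples of the separating forms.\<close>

lemma ideal_power_sum:
  assumes I: "is_ideal I" and "finite A" "\<And>i. i \<in> A \<Longrightarrow> f i ^ k \<in> I"
  shows "\<exists>K. sum f A ^ K \<in> I"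
  using assms(2,3)
proof (induction A rule: finite_induct)
  case empty
  have "sum f {} ^ 1 \<in> I" using ideal_0[OF I] by simp
  then show ?case by blast
next
  case (insert a A)
  then obtain K where "sum f A ^ K \<in> I" by auto
  then have "(f a + sum f A) ^ (k + K) \<in> I" using ideal_power_add[OF I] insert.prems by blast
  then show ?case using insert.hyps by auto
qed

lemma ideal_gen_eq: "(f \<in> ideal_gen V S) \<longleftrightarrow> (\<exists>N c g. f = (\<Sum>i<N::nat. c i * g i) \<and> (\<forall>i<N. c i \<in> polys_in V \<and> g i \<in> S))"
  by (auto simp: ideal_gen_def)

lemma is_ideal_ideal_gen_UNIV: "is_ideal (ideal_gen UNIV S)"
  unfolding is_ideal_def
proof (intro conjI allI ballI)
  show "0 \<in> ideal_gen UNIV S" unfolding ideal_gen_eq by (rule exI[of _ 0]) simp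
next
  fix x y assume "x \<in> ideal_gen UNIV S" "y \<in> ideal_gen UNIV S"
  then obtain N c g N' c' g' where *: "x = (\<Sum>i<N::nat. c i * g i)" "\<forall>i<N. g i \<in> S"
    "y = (\<Sum>i<N'::nat. c' i * g' i)" "\<forall>i<N'. g' i \<in> S"
    unfolding ideal_gen_eq by blast
  define c'' where "c'' i = (if i < N then c i else c' (i - N))" for i
  define g'' where "g'' i = (if i < N then g i else g' (i - N))" for i
  have split: "(\<Sum>i<N + N'. h i) = (\<Sum>i<N. h i) + (\<Sum>i<N'. h (N + i))" for h :: "nat \<Rightarrow> ('a,'b) mpoly"
    by (induction N') (simp_all add: add.assoc)
  have "x + y = (\<Sum>i<N + N'. c'' i * g'' i)"
    unfolding split by (simp add: * c''_def g''_def)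
  moreover have "\<forall>i<N + N'. g'' i \<in> S" using * by (auto simp: g''_def)
  ultimately show "x + y \<in> ideal_gen UNIV S" unfolding ideal_gen_eq using polys_in_UNIV by blast
next
  fix k x assume "x \<in> ideal_gen UNIV S"
  then obtain N c g where *: "x = (\<Sum>i<N::nat. c i * g i)" "\<forall>i<N. g i \<in> S"
    unfolding ideal_gen_eq by blast
  have "k * x = (\<Sum>i<N. (k * c i) * g i)" by (simp add: * sum_distrib_left mult.assoc)
  then show "k * x \<in> ideal_gen UNIV S" unfolding ideal_gen_eq
    using * by (intro exI[of _ N] exI[of _ "\<lambda>i. k * c i"] exI[of _ g]) (simp add: polys_in_UNIV)
qed

lemma ideal_gen_incl: "s \<in> S \<Longrightarrow> s \<in> ideal_gen V S"
  unfolding ideal_gen_eq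
  by (rule exI[of _ 1], rule exI[of _ "\<lambda>_. 1"], rule exI[of _ "\<lambda>_. s"]) (simp add: polys_in_1)

lemma ideal_gen_least:
  assumes "is_ideal I" "S \<subseteq> I" shows "ideal_gen V S \<subseteq> I"
proof
  fix f assume "f \<in> ideal_gen V S"
  then obtain N c g where f: "f = (\<Sum>i<N::nat. c i * g i)" and g: "\<forall>i<N. g i \<in> S"
    unfolding ideal_gen_eq by blast
  show "f \<in> I"
    unfolding f by (intro ideal_sum ideal_mult assms(1)) (use g assms(2) in auto)
qed

text \<open>Setting the variables outside V to zero is a ring map onto k[V] that fixes k[V].\<close>

definition retract :: "'v set \<Rightarrow> ('v, 'k::comm_ring_1) mpoly \<Rightarrow> ('v, 'k) mpoly" where
  "retract V = subst (\<lambda>v. if v \<in> V then Var v else 0)"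

lemma rhom_retract: "rhom (retract V)"
  by (simp add: retract_def rhom_subst)

lemma retract_id:
  assumes "p \<in> polys_in V" shows "retract V p = p"
proof -
  have "retract V p = subst Var p" unfolding retract_def by (rule ev_cong[OF assms]) simp
  then show ?thesis by simp
qed

lemma retract_in: "retract V p \<in> polys_in V"
  unfolding retract_def
  by (rule polys_in_subst[OF polys_in_UNIV]) (simp add: polys_in_0 polys_in_Var)

text \<open>Applying \<open>retract\<close> to a representation of f fixes f and the generators and
  moves the cofactors into k[V].\<close>

lemma ideal_gen_UNIV_Int_polys_in:
  assumes "f \<in> ideal_gen UNIV S" "f \<in> polys_in V" "S \<subseteq> polys_in V"
  shows "f \<in> ideal_gen V S"
proof -
  obtain N c g where *: "f = (\<Sum>i<N::nat. c i * g i)" "\<forall>i<N. g i \<in> S"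
    using assms(1) unfolding ideal_gen_eq by blast
  have "f = retract V f" using retract_id[OF assms(2)] by simp
  also have "\<dots> = (\<Sum>i<N. retract V (c i) * g i)"
    unfolding *(1) rhom_sum[OF rhom_retract] rhom_mult[OF rhom_retract]
    using *(2) assms(3) by (intro sum.cong refl) (simp add: retract_id subset_iff)
  finally show ?thesis
    unfolding ideal_gen_eq using *(2)
    by (intro exI[of _ N] exI[of _ "\<lambda>i. retract V (c i)"] exI[of _ g]) (simp add: retract_in)
qed

text \<open>The obvious relations \<open>b * (a ^ (d - l) * b ^ l) = a * (a ^ (d - Suc l) * b ^ Suc
  l)\<close> generate all syzygies, with \<open>q (Suc l)\<close> as the multiplier of the l-th one;
  the zeros of \<open>q\<close> at both ends account for the missing neighbours. The
  \<open>coprime\<close> premise says that b is a nonzerodivisor modulo a.\<close>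

lemma syzygy_of_powers:
  fixes a b :: "'a::idom"
  assumes "a \<noteq> 0" and coprime: "\<And>x. a dvd b * x \<Longrightarrow> a dvd x"
    and "(\<Sum>l\<le>d. t l * a ^ (d - l) * b ^ l) = 0"
  shows "\<exists>q. q 0 = 0 \<and> q (Suc d) = 0 \<and> (\<forall>l\<le>d. t l = b * q (Suc l) - a * q l)"
  using assms(3)
proof (induction d arbitrary: t)
  case 0
  then have "t 0 = 0" by simp
  then show ?case by (intro exI[of _ "\<lambda>_. 0"]) simp
next
  case (Suc d)
  have shift: "(\<Sum>l\<le>d. t l * a ^ (Suc d - l) * b ^ l) = a * (\<Sum>l\<le>d. t l * a ^ (d - l) * b ^ l)" for t
    unfolding sum_distrib_left by (intro sum.cong refl) (simp add: Suc_diff_le)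
  have pow: "a dvd b ^ k * x \<Longrightarrow> a dvd x" for k x
    by (induction k) (auto simp: mult.assoc dest: coprime)
  define s where "s = (\<Sum>l\<le>d. t l * a ^ (d - l) * b ^ l)"
  have eq: "a * s + t (Suc d) * b ^ Suc d = 0"
    using Suc.prems by (simp add: shift s_def)
  then have "b ^ Suc d * t (Suc d) = a * (- s)"
    by (simp only: add_eq_0_iff mult.commute[of "b ^ Suc d"] mult_minus_right)
  then have "a dvd b ^ Suc d * t (Suc d)" by (rule dvdI)
  then have "a dvd t (Suc d)" by (rule pow)
  then obtain y where y: "t (Suc d) = a * y" by blast
  define x where "x = - y"
  have x: "t (Suc d) = - (a * x)" by (simp add: x_def y)
  \<comment> \<open>All terms but the last are divisible by a, hence so is the last coefficient.
    Since \<open>t (Suc d) = - (a * x)\<close>, the last term can be absorbed into the one before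
    it; x then becomes the new value of q at \<open>Suc d\<close>, where the induction hypothesis
    had zero.\<close>
  define t' where "t' = t(d := t d - b * x)"
  have "(\<Sum>l\<le>d. t' l * a ^ (d - l) * b ^ l)
      = (\<Sum>l\<le>d. t l * a ^ (d - l) * b ^ l - (if l = d then b ^ Suc d * x else 0))"
    by (intro sum.cong refl) (simp add: t'_def algebra_simps)
  also have "\<dots> = s - b ^ Suc d * x"
    by (simp add: sum_subtractf s_def)
  finally have "a * (\<Sum>l\<le>d. t' l * a ^ (d - l) * b ^ l) = a * s - a * (b ^ Suc d * x)"
    by (simp only: right_diff_distrib)
  also have "\<dots> = 0"
    using eq unfolding x by (simp add: mult.commute mult.left_commute)
  finally have "(\<Sum>l\<le>d. t' l * a ^ (d - l) * b ^ l) = 0" using \<open>a \<noteq> 0\<close> by simp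
  then obtain q where q: "q 0 = 0" "q (Suc d) = 0" "\<forall>l\<le>d. t' l = b * q (Suc l) - a * q l"
    using Suc.IH by blast
  show ?case
  proof (intro exI[of _ "q(Suc d := x, Suc (Suc d) := 0)"] conjI allI impI)
    fix l assume "l \<le> Suc d"
    then consider "l < d" | "l = d" | "l = Suc d" by linarith
    then show "t l = b * (q(Suc d := x, Suc (Suc d) := 0)) (Suc l) - a * (q(Suc d := x, Suc (Suc d) := 0)) l"
      using q(2) q(3)[rule_format, of l] by cases (auto simp: t'_def x algebra_simps)
  qed (simp_all add: q(1))
qed

section \<open>Divisibility by a linear form solved for one variable\<close>

lemma Var_minus_dvd_subst:
  "(Var v - t) dvd (p - subst (Var(v := t)) p)"
proof -
  have "subst Var p - subst (Var(v := t)) p \<in> {x. (Var v - t) dvd x}"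
    by (rule ideal_cong_ev[OF is_ideal_principal polys_in_UNIV]) simp
  then show ?thesis by simp
qed

lemma subst_eq_0_imp_dvd: "subst (Var(v := t)) p = 0 \<Longrightarrow> (Var v - t) dvd p"
  using Var_minus_dvd_subst[of v t p] by simp

lemma dvd_imp_subst_eq_0:
  assumes "subst (Var(v := t)) t = t" "(Var v - t) dvd p"
  shows "subst (Var(v := t)) p = 0"
  using assms by (auto elim!: dvdE simp: rhom_mult[OF rhom_subst] rhom_minus[OF rhom_subst] rhom_Const)

text \<open>If v does not occur in t, then \<open>Var v - t\<close> generates the kernel of the
  substitution v := t, which is prime because the target is a domain. This supplies all the
  coprimality that is needed, without gcds.\<close>

lemma Var_minus_dvd_cancel:
  fixes g :: "(nat, 'k::field) mpoly"
  assumes "subst (Var(v := t)) t = t" "subst (Var(v := t)) g \<noteq> 0" "(Var v - t) dvd g * x"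
  shows "(Var v - t) dvd x"
  using dvd_imp_subst_eq_0[OF assms(1,3)] assms(2)
  by (intro subst_eq_0_imp_dvd) (simp add: rhom_mult[OF rhom_subst])

lemma lookup_Var: "Poly_Mapping.lookup (Var v) m = (if m = Poly_Mapping.single v 1 then 1 else 0)"
  by (auto simp: Var_def lookup_single when_def)

section \<open>Linear algebra over the coefficient field\<close>

lemma independent_family_iff:
  fixes f :: "'i \<Rightarrow> ('v, 'k::field) mpoly"
  assumes fin: "finite S"
  shows "inj_on f S \<and> \<not> module.dependent smul (f ` S)
    \<longleftrightarrow> (\<forall>c. (\<Sum>s\<in>S. smul (c s) (f s)) = 0 \<longrightarrow> (\<forall>s\<in>S. c s = 0))" (is "?L \<longleftrightarrow> ?R")
proof -
  interpret vs: vector_space "smul :: 'k \<Rightarrow> ('v, 'k) mpoly \<Rightarrow> _"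
    by (rule vector_space_smul)
  show ?thesis
  proof
    assume L: ?L
    show ?R
    proof (intro allI impI ballI)
      fix c s assume c: "(\<Sum>s\<in>S. smul (c s) (f s)) = 0" and s: "s \<in> S"
      have "(\<Sum>v\<in>f ` S. smul (c (inv_into S f v)) v) = 0"
        using L c by (simp add: sum.reindex)
      then have "c (inv_into S f (f s)) = 0"
        using L fin s
        by (intro vs.independentD[of "f ` S" "f ` S" "\<lambda>v. c (inv_into S f v)" "f s"]) simp_all
      then show "c s = 0" using L s by simp
    qed
  next
    assume R: ?R
    have inj: "inj_on f S"
    proof (rule inj_onI, rule ccontr)
      fix x y assume *: "x \<in> S" "y \<in> S" "f x = f y" "x \<noteq> y"
      \<comment> \<open>A collision \<open>f x = f y\<close> is itself a nontrivial relation, with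
        coefficients 1 and -1.\<close>
      have "(\<Sum>s\<in>S. smul (if s = x then 1 else if s = y then -1 else 0) (f s))
          = (\<Sum>s\<in>S. (if s = x then f s else 0) - (if s = y then f s else 0))"
        using *(4) by (intro sum.cong) auto
      also have "\<dots> = 0" using * fin by (simp add: sum_subtractf)
      finally show False using R *(1) by fastforce
    qed
    have False if "u v \<noteq> 0" "v \<in> f ` S" "(\<Sum>v\<in>f ` S. smul (u v) v) = 0" for u v
      using R[rule_format, of "\<lambda>s. u (f s)"] that by (auto simp: sum.reindex[OF inj])
    then have "\<not> vs.dependent (f ` S)" using fin by (auto simp: vs.dependent_finite)
    with inj show ?L by blast
  qed
qed

text \<open>A square system with trivial kernel is solvable: otherwise adjoining the vector of b to
  the independent rows would give too many independent vectors. It turns the absence of forms of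
  degree d - 1 through X into interpolation, and injectivity modulo h into an inverse
  matrix.\<close>

lemma square_system_solvable:
  fixes M :: "'a \<Rightarrow> 'b \<Rightarrow> 'k::field"
  assumes fin: "finite S" "finite T" and card: "card S = card T"
    and inj: "\<And>c. (\<forall>t\<in>T. (\<Sum>s\<in>S. c s * M s t) = 0) \<Longrightarrow> \<forall>s\<in>S. c s = 0"
  shows "\<exists>c. \<forall>t\<in>T. (\<Sum>s\<in>S. c s * M s t) = b t"
proof -
  interpret vs: vector_space "smul :: 'k \<Rightarrow> ('b, 'k) mpoly \<Rightarrow> _"
    by (rule vector_space_smul)
  \<comment> \<open>vectors in k^T are represented as linear forms in variables indexed by T\<close>
  define vec where "vec f = (\<Sum>t\<in>T. smul (f t) (Var t))" for f :: "'b \<Rightarrow> 'k"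
  have single_inj: "Poly_Mapping.single x (Suc 0) = Poly_Mapping.single y (Suc 0) \<longleftrightarrow> x = y" for x y :: 'b
    by (metis lookup_single_eq lookup_single_not_eq nat.distinct(1))
  have coord: "Poly_Mapping.lookup (vec f) (Poly_Mapping.single t 1) = f t" if "t \<in> T" for f t
  proof -
    have "smul c (Var t') = Poly_Mapping.single (Poly_Mapping.single t' 1) c" for c :: 'k and t' :: 'b
      by (simp add: smul_def Const_def Var_def mult_single)
    then show ?thesis
      using that fin by (simp add: vec_def lookup_sum lookup_single when_def single_inj)
  qed
  have vec_sum: "(\<Sum>s\<in>S. smul (c s) (vec (M s))) = vec (\<lambda>t. \<Sum>s\<in>S. c s * M s t)" for c
    unfolding vec_def smul_sum_right vs.scale_scale vs.scale_sum_left by (rule sum.swap)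
  have zero: "\<forall>s\<in>S. c s = 0" if "(\<Sum>s\<in>S. smul (c s) (vec (M s))) = 0" for c
  proof (rule inj, rule ballI)
    fix t assume "t \<in> T"
    then show "(\<Sum>s\<in>S. c s * M s t) = 0"
      using coord[of t "\<lambda>t. \<Sum>s\<in>S. c s * M s t"] that by (simp add: vec_sum)
  qed
  let ?r = "\<lambda>s. vec (M s)"
  have "inj_on ?r S \<and> \<not> vs.dependent (?r ` S)"
    by (rule independent_family_iff[OF fin(1), THEN iffD2]) (use zero in blast)
  then have injr: "inj_on ?r S" and indep: "\<not> vs.dependent (?r ` S)" by simp_all
  have spanE: "vec f \<in> vs.span (Var ` T)" for f
    unfolding vec_def by (intro vs.span_sum vs.span_scale vs.span_base) blast
  have "vec b \<in> vs.span (?r ` S)"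
  proof (rule ccontr)
    assume n: "vec b \<notin> vs.span (?r ` S)"
    let ?B = "insert (vec b) (?r ` S)"
    have "\<not> vs.dependent ?B" using indep n by (simp add: vs.independent_insertI)
    moreover have "?B \<subseteq> vs.span (Var ` T)" using spanE by blast
    ultimately have "card ?B \<le> card (Var ` T :: ('b, 'k) mpoly set)"
      using vs.independent_span_bound[of "Var ` T"] fin by blast
    also have "\<dots> \<le> card T" using fin by (simp add: card_image_le)
    also have "card ?B = Suc (card S)"
      using n vs.span_base fin by (subst card_insert_disjoint) (auto simp: card_image[OF injr])
    finally show False using card by simp
  qed
  then obtain u where u: "(\<Sum>v\<in>?r ` S. smul (u v) v) = vec b"
    using vs.span_finite[of "?r ` S"] fin by force
  then have eq: "vec (\<lambda>t. \<Sum>s\<in>S. u (?r s) * M s t) = vec b"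
    unfolding vec_sum[symmetric] by (simp add: sum.reindex[OF injr])
  have "\<forall>t\<in>T. (\<Sum>s\<in>S. u (?r s) * M s t) = b t"
    using coord[of _ "\<lambda>t. \<Sum>s\<in>S. u (?r s) * M s t"] coord[of _ b] unfolding eq by simp
  then show ?thesis by (rule exI[of _ "\<lambda>s. u (?r s)"])
qed

text \<open>This makes the pointwise definition of \<open>image_ideal\<close> the kernel of a ring
  map. Characteristic zero provides enough values through \<open>poly_all_0_iff_0\<close>.\<close>

lemma mpoly_eq_0_if_peval_eq_0:
  fixes p :: "(nat, 'k::field_char_0) mpoly"
  assumes p: "p \<in> polys_in W" and zero: "\<And>w. peval w p = 0"
  shows "p = 0"
proof (rule ccontr)
  assume "p \<noteq> 0"
  define D where "D = Suc (\<Sum>m\<in>Poly_Mapping.keys p. mdeg m)"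
  have bound: "Poly_Mapping.lookup m v < D" if "m \<in> Poly_Mapping.keys p" for m v
  proof -
    have "Poly_Mapping.lookup m v \<le> mdeg m"
      unfolding mdeg_def using member_le_sum[of v "Poly_Mapping.keys m" "Poly_Mapping.lookup m"]
      by (cases "v \<in> Poly_Mapping.keys m") (auto simp: in_keys_iff)
    also have "\<dots> \<le> (\<Sum>m\<in>Poly_Mapping.keys p. mdeg m)"
      using member_le_sum[of m "Poly_Mapping.keys p" mdeg] that by simp
    finally show ?thesis by (simp add: D_def)
  qed
  \<comment> \<open>Kronecker substitution: read the exponent vector as a number in base D\<close>
  define code where "code m = Poly_Mapping.lookup m 0 + D * (Poly_Mapping.lookup m 1 + D * Poly_Mapping.lookup m 2)"
    for m :: "nat \<Rightarrow>\<^sub>0 nat"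
  have keysW: "Poly_Mapping.keys m \<subseteq> W" if "m \<in> Poly_Mapping.keys p" for m
    using p that by (simp add: polys_in_def)
  have inj: "inj_on code (Poly_Mapping.keys p)"
  proof (rule inj_onI)
    fix m m' assume *: "m \<in> Poly_Mapping.keys p" "m' \<in> Poly_Mapping.keys p" "code m = code m'"
    have digit: "x = x' \<and> y = y'" if "x + D * y = x' + D * y'" "x < D" "x' < D" for x y x' y'
    proof -
      have "x = (x + D * y) mod D" using that(2) by simp
      also have "\<dots> = x'" unfolding that(1) using that(3) by simp
      finally have "x = x'" .
      then show ?thesis using that by simp
    qed
    have 1: "Poly_Mapping.lookup m 0 = Poly_Mapping.lookup m' 0 \<and>
        Poly_Mapping.lookup m 1 + D * Poly_Mapping.lookup m 2 = Poly_Mapping.lookup m' 1 + D * Poly_Mapping.lookup m' 2"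
      using * bound unfolding code_def by (intro digit) auto
    then have 2: "Poly_Mapping.lookup m 1 = Poly_Mapping.lookup m' 1 \<and> Poly_Mapping.lookup m 2 = Poly_Mapping.lookup m' 2"
      using * bound by (intro digit) auto
    show "m = m'"
    proof (rule poly_mapping_eqI)
      fix k show "Poly_Mapping.lookup m k = Poly_Mapping.lookup m' k"
      proof (cases "k \<in> W")
        case True
        then show ?thesis using 1 2 by (auto simp: W_def)
      next
        case False
        then have "k \<notin> Poly_Mapping.keys m" "k \<notin> Poly_Mapping.keys m'"
          using keysW *(1,2) by blast+
        then show ?thesis by (simp add: in_keys_iff)
      qed
    qed
  qed
  define P where "P = (\<Sum>m\<in>Poly_Mapping.keys p. monom (Poly_Mapping.lookup p m) (code m))"
  have "poly P t = peval (\<lambda>v. t ^ (D ^ v)) p" for t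
    unfolding P_def poly_sum peval_def
  proof (rule sum.cong[OF refl])
    fix m assume "m \<in> Poly_Mapping.keys p"
    then have "mon_eval (\<lambda>v. t ^ (D ^ v)) m = (\<Prod>v\<in>W. (t ^ (D ^ v)) ^ Poly_Mapping.lookup m v)"
      by (intro mon_eval_superset keysW) (simp_all add: W_def)
    also have "\<dots> = t ^ code m"
      by (simp add: W_def code_def power2_eq_square algebra_simps flip: power_mult power_add)
    finally show "poly (monom (Poly_Mapping.lookup p m) (code m)) t
        = Poly_Mapping.lookup p m * mon_eval (\<lambda>v. t ^ (D ^ v)) m"
      by (simp add: poly_monom)
  qed
  then have "P = 0" using zero poly_all_0_iff_0 by metis
  obtain m where m: "m \<in> Poly_Mapping.keys p" using \<open>p \<noteq> 0\<close>
    by (metis poly_mapping_eqI lookup_zero in_keys_iff)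
  have "coeff P (code m) = (\<Sum>m'\<in>Poly_Mapping.keys p. if m' = m then Poly_Mapping.lookup p m' else 0)"
    unfolding P_def coeff_sum using inj m by (intro sum.cong) (auto dest: inj_onD)
  then show False using m \<open>P = 0\<close> by (simp add: in_keys_iff)
qed

section \<open>Hilbert-Burch matrices\<close>

text \<open>Substituting linear forms for the variables preserves degrees, so reduction modulo h
  does not spoil the degree bounds used for induction.\<close>

lemma filt_subst_linear:
  assumes "\<And>v. homog 1 (a v)"
  shows "filt P (subst a p) = subst a (filt P p)"
proof (induction p rule: single_induct)
  case (single m c)
  have "homog (mdeg m * 1) (subst a (Poly_Mapping.single m c))"
    by (rule homog_subst[OF _ polys_in_UNIV assms]) (simp add: homog_def)
  then show ?case by (simp add: filt_single filt_homog)
qed (simp_all add: filt_add rhom_add[OF rhom_subst])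

lemma filt_mult_Const: "filt P (p * Const c) = filt P p * Const c" for p :: "('v, 'k::comm_ring_1) mpoly"
  using filt_homog_mult[OF homog_Const, of P c p] by (simp add: mult.commute)

lemma Var_neq_0 [simp]: "Var v \<noteq> (0 :: ('v, 'k::field) mpoly)"
  using rhom_zero[OF rhom_peval, of "\<lambda>_. 1 :: 'k"] peval_Var[of "\<lambda>_. 1 :: 'k" v] by (metis zero_neq_one)

text \<open>\<open>F'\<close> is the basis of the degree-d forms that reduces modulo h to the
  monomials of degree d in w1 and w2; \<open>C\<close> and \<open>E\<close> are the mutually inverse
  base changes between F and \<open>F'\<close>. Each monomial relation holds for \<open>F'\<close>
  only up to a multiple of h, recorded by \<open>H\<close>. Row k of M is the corrected relation,
  written in the coordinates of F.\<close>

locale hilbert_burch =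
  fixes d :: nat and J :: "nat set" and a b :: "'k::field_char_0" and F :: "nat \<Rightarrow> (nat, 'k) mpoly"
    and C E H :: "nat \<Rightarrow> nat \<Rightarrow> 'k"
  fixes t h F' M
  defines "t \<equiv> Const a * Var 0 + Const b * Var 1 :: (nat, 'k) mpoly"
  defines "h \<equiv> Var 2 - t"
  defines "F' \<equiv> \<lambda>l. \<Sum>j\<in>J. Const (C l j) * F j"
  defines "M \<equiv> \<lambda>k j. Var 1 * Const (C k j) - Var 0 * Const (C (Suc k) j) - h * Const (H k j)"
  assumes finJ: "finite J"
    and F_eq: "j \<in> J \<Longrightarrow> F j = (\<Sum>l\<le>d. Const (E j l) * F' l)"
    and rho_F': "l \<le> d \<Longrightarrow> subst (Var(2 := t)) (F' l) = Var 0 ^ (d - l) * Var 1 ^ l"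
    and EC: "j \<in> J \<Longrightarrow> j' \<in> J \<Longrightarrow> (\<Sum>l\<le>d. E j l * C l j') = (if j = j' then 1 else 0)"
    and CE: "l \<le> d \<Longrightarrow> l' \<le> d \<Longrightarrow> (\<Sum>j\<in>J. C l j * E j l') = (if l = l' then 1 else 0)"
    and rel: "k < d \<Longrightarrow> Var 1 * F' k - Var 0 * F' (Suc k) = h * (\<Sum>j\<in>J. Const (H k j) * F j)"
begin

abbreviation rho :: "(nat, 'k) mpoly \<Rightarrow> (nat, 'k) mpoly" where "rho \<equiv> subst (Var(2 := t))"

lemmas rho_hom = rhom_mult[OF rhom_subst] rhom_add[OF rhom_subst] rhom_minus[OF rhom_subst]
  rhom_sum[OF rhom_subst] rhom_power[OF rhom_subst] ev_Const[OF rhom_Const] ev_Var[OF rhom_Const]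

lemma rho_t: "rho t = t"
  by (simp add: t_def rho_hom)

lemma rho_h: "rho h = 0"
  unfolding h_def rhom_minus[OF rhom_subst] rho_t by (simp add: rhom_Const)

lemma h_dvd: "rho p = 0 \<Longrightarrow> h dvd p"
  unfolding h_def by (rule subst_eq_0_imp_dvd)

lemma h_dvd_diff: "h dvd p - rho p"
  unfolding h_def by (rule Var_minus_dvd_subst)

lemma homog_t: "homog 1 t"
  unfolding t_def using homog_mult[OF homog_Const homog_Var, of a 0] homog_mult[OF homog_Const homog_Var, of b 1]
  by (intro homog_add) (simp_all del: One_nat_def)

lemma homog_h: "homog 1 h"
  unfolding h_def by (intro homog_minus homog_Var homog_t)

lemma h_neq_0: "h \<noteq> 0"
proof
  assume "h = 0"
  then have "peval (\<lambda>v. if v = 2 then 1 else 0 :: 'k) h = 0"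
    by (simp add: rhom_zero[OF rhom_peval])
  then show False
    by (simp add: h_def t_def rhom_minus[OF rhom_peval] rhom_add[OF rhom_peval] rhom_mult[OF rhom_peval])
qed

lemma filt_rho: "filt P (rho p) = rho (filt P p)"
  by (rule filt_subst_linear) (simp add: homog_Var homog_t del: One_nat_def)

lemma Var0_dvd_cancel: "Var 0 dvd Var 1 * x \<Longrightarrow> Var 0 dvd (x :: (nat, 'k) mpoly)"
  using Var_minus_dvd_cancel[of 0 0 "Var 1 :: (nat, 'k) mpoly" x] by (simp add: rhom_Const)

lemma filt_less_linear_mult:
  "homog 1 l \<Longrightarrow> filt (\<lambda>j. j < Suc D) (l * x) = l * filt (\<lambda>j. j < D) x"
  using filt_homog_mult[of 1 l "\<lambda>j. j < Suc D" x] by simp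

lemma M_syzygy:
  assumes "k < d" shows "(\<Sum>j\<in>J. M k j * F j) = 0"
proof -
  have "(\<Sum>j\<in>J. M k j * F j)
    = Var 1 * F' k - Var 0 * F' (Suc k) - h * (\<Sum>j\<in>J. Const (H k j) * F j)"
    unfolding F'_def M_def sum_distrib_left sum_subtractf[symmetric]
    by (intro sum.cong refl) (simp add: algebra_simps)
  then show ?thesis using rel[OF assms] by simp
qed

lemma Const_sum_mult:
  "(\<Sum>i\<in>I. Const (f i) * Const (g i)) = Const (\<Sum>i\<in>I. f i * g i :: 'k)"
  by (simp add: rhom_sum[OF rhom_Const] Const_mult)

text \<open>Modulo h a syzygy becomes one of the monomials of degree d, hence a combination of their
  basic relations. Subtracting the lifted combination of rows of M leaves h times another syzygy,
  since h is not a zero divisor. The degree bound D drops by one each time and makes the process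
  stop.\<close>

lemma syzygy_generated_aux:
  assumes "\<forall>j\<in>J. filt (\<lambda>i. i < D) (s j) = s j" and "(\<Sum>j\<in>J. s j * F j) = 0"
  shows "\<exists>q. \<forall>j\<in>J. s j = (\<Sum>k<d. q k * M k j)"
  using assms
proof (induction D arbitrary: s)
  case 0
  then have "\<forall>j\<in>J. s j = 0" by (simp add: filt_False)
  then show ?case by (intro exI[of _ "\<lambda>_. 0"]) simp
next
  case (Suc D)
  \<comment> \<open>These are the coordinates of the syzygy with respect to
    \<open>F'\<close>.\<close>
  define v where "v l = (\<Sum>j\<in>J. s j * Const (E j l))" for l
  have v_filt: "filt (\<lambda>i. i < Suc D) (v l) = v l" for l
    unfolding v_def filt_sum filt_mult_Const using Suc.prems(1) by simp
  have "(\<Sum>l\<le>d. v l * F' l) = (\<Sum>l\<le>d. \<Sum>j\<in>J. s j * (Const (E j l) * F' l))"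
    by (simp add: v_def sum_distrib_right mult.assoc)
  also have "\<dots> = (\<Sum>j\<in>J. s j * F j)"
    by (subst sum.swap) (simp add: F_eq flip: sum_distrib_left)
  finally have "(\<Sum>l\<le>d. v l * F' l) = 0" using Suc.prems(2) by simp
  then have "rho (\<Sum>l\<le>d. v l * F' l) = 0" by simp
  then have "(\<Sum>l\<le>d. rho (v l) * Var 0 ^ (d - l) * Var 1 ^ l) = 0"
    by (simp add: rho_hom(1,4) rho_F' mult.assoc)
  from syzygy_of_powers[OF Var_neq_0 Var0_dvd_cancel this]
  obtain q0 where q0: "q0 0 = 0" "q0 (Suc d) = 0" "\<And>l. l \<le> d \<Longrightarrow> rho (v l) = Var 1 * q0 (Suc l) - Var 0 * q0 l"
    by blast
  \<comment> \<open>The multipliers from \<open>syzygy_of_powers\<close> come without degree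
    control. As both sides are compared below degree \<open>Suc D\<close> and the relations are
    linear, truncating the multipliers below D loses nothing.\<close>
  define q1 where "q1 l = filt (\<lambda>i. i < D) (q0 l)" for l
  have q1: "rho (v l) = Var 1 * q1 (Suc l) - Var 0 * q1 l" if "l \<le> d" for l
  proof -
    have "rho (v l) = filt (\<lambda>i. i < Suc D) (rho (v l))" by (simp add: filt_rho v_filt)
    also have "\<dots> = Var 1 * q1 (Suc l) - Var 0 * q1 l"
      unfolding q0(3)[OF that] filt_minus q1_def
      by (simp only: filt_less_linear_mult[OF homog_Var])
    finally show ?thesis .
  qed
  have q1_0: "q1 0 = 0" "q1 (Suc d) = 0" by (simp_all add: q1_def q0)
  have "\<forall>l. \<exists>x. v l - rho (v l) = h * x" using h_dvd_diff unfolding dvd_def by blast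
  from choice[OF this] obtain u0 where u0: "\<And>l. v l - rho (v l) = h * u0 l" by blast
  define u where "u l = filt (\<lambda>i. i < D) (u0 l)" for l
  have u: "v l = rho (v l) + h * u l" for l
  proof -
    have "v l - rho (v l) = filt (\<lambda>i. i < Suc D) (v l - rho (v l))"
      by (simp add: filt_minus filt_rho v_filt)
    also have "\<dots> = h * u l" unfolding u0 u_def filt_less_linear_mult[OF homog_h] ..
    finally show ?thesis by (simp add: algebra_simps)
  qed
  define q where "q k = q1 (Suc k)" for k
  \<comment> \<open>The remainder has two sources: the part of \<open>v\<close> killed by reduction
    modulo h, and the correction \<open>H\<close> built into the rows of M.\<close>
  define s' where "s' j = (\<Sum>l\<le>d. u l * Const (C l j)) + (\<Sum>k<d. q k * Const (H k j))" for j
  have s_eq: "s j = (\<Sum>k<d. q k * M k j) + h * s' j" if j: "j \<in> J" for j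
  proof -
    have "(\<Sum>l\<le>d. v l * Const (C l j)) = (\<Sum>l\<le>d. \<Sum>i\<in>J. s i * (Const (E i l) * Const (C l j)))"
      by (simp add: v_def sum_distrib_right mult.assoc)
    also have "\<dots> = (\<Sum>i\<in>J. s i * (\<Sum>l\<le>d. Const (E i l) * Const (C l j)))"
      by (subst sum.swap) (simp flip: sum_distrib_left)
    also have "\<dots> = (\<Sum>i\<in>J. if i = j then s i else 0)"
      using j by (intro sum.cong refl) (simp add: Const_sum_mult EC Const_0 Const_1)
    also have "\<dots> = s j" using j finJ by simp
    finally have "s j = (\<Sum>l\<le>d. v l * Const (C l j))" by simp
    also have "\<dots> = (\<Sum>l\<le>d. rho (v l) * Const (C l j)) + h * (\<Sum>l\<le>d. u l * Const (C l j))"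
      by (subst u) (simp add: distrib_right sum.distrib sum_distrib_left mult.assoc)
    also have "(\<Sum>l\<le>d. rho (v l) * Const (C l j))
        = (\<Sum>l\<le>d. q1 (Suc l) * (Var 1 * Const (C l j))) - (\<Sum>l\<le>d. q1 l * (Var 0 * Const (C l j)))"
      by (simp add: q1 algebra_simps sum_subtractf)
    also have "(\<Sum>l\<le>d. q1 (Suc l) * (Var 1 * Const (C l j))) = (\<Sum>k<d. q k * (Var 1 * Const (C k j)))"
      by (simp add: lessThan_Suc_atMost[symmetric] q1_0 q_def)
    also have "(\<Sum>l\<le>d. q1 l * (Var 0 * Const (C l j))) = (\<Sum>k<d. q k * (Var 0 * Const (C (Suc k) j)))"
      unfolding lessThan_Suc_atMost[symmetric] sum.lessThan_Suc_shift by (simp add: q1_0 q_def)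
    also have "(\<Sum>k<d. q k * (Var 1 * Const (C k j))) - (\<Sum>k<d. q k * (Var 0 * Const (C (Suc k) j)))
        = (\<Sum>k<d. q k * M k j) + h * (\<Sum>k<d. q k * Const (H k j))"
      unfolding M_def sum_subtractf[symmetric] sum_distrib_left sum.distrib[symmetric]
      by (intro sum.cong refl) (simp add: algebra_simps)
    finally show ?thesis by (simp add: s'_def algebra_simps)
  qed
  have "0 = (\<Sum>j\<in>J. (\<Sum>k<d. q k * M k j) * F j) + h * (\<Sum>j\<in>J. s' j * F j)"
    using Suc.prems(2) by (simp add: s_eq distrib_right sum.distrib sum_distrib_left mult.assoc)
  also have "(\<Sum>j\<in>J. (\<Sum>k<d. q k * M k j) * F j) = (\<Sum>k<d. q k * (\<Sum>j\<in>J. M k j * F j))"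
    unfolding sum_distrib_left sum_distrib_right mult.assoc by (rule sum.swap)
  also have "\<dots> = 0" by (simp add: M_syzygy)
  finally have "(\<Sum>j\<in>J. s' j * F j) = 0" using h_neq_0 by simp
  moreover have "\<forall>j\<in>J. filt (\<lambda>i. i < D) (s' j) = s' j"
  proof -
    have "filt (\<lambda>i. i < D) (u l) = u l" "filt (\<lambda>i. i < D) (q k) = q k" for l k
      by (auto intro!: filt_cong simp: u_def q_def q1_def keys_filt)
    then show ?thesis by (simp add: s'_def filt_add filt_sum filt_mult_Const)
  qed
  ultimately obtain q' where q': "\<forall>j\<in>J. s' j = (\<Sum>k<d. q' k * M k j)"
    using Suc.IH by blast
  have "\<forall>j\<in>J. s j = (\<Sum>k<d. (q k + h * q' k) * M k j)"
    using s_eq q' by (simp add: distrib_right sum.distrib sum_distrib_left mult.assoc)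
  then show ?case by (rule exI[of _ "\<lambda>k. q k + h * q' k"])
qed

lemma common_filt_bound: "finite I \<Longrightarrow> \<exists>D. \<forall>i\<in>I. filt (\<lambda>j. j < D) (s i) = s i"
proof -
  assume I: "finite I"
  obtain D where D: "\<And>i E. D i \<le> E \<Longrightarrow> filt (\<lambda>j. j < E) (s i) = s i"
    using filt_less_exists[of "s _"] by metis
  then show ?thesis
    using member_le_sum[of _ I D] I by (intro exI[of _ "sum D I"]) auto
qed

lemma syzygy_generated:
  assumes "(\<Sum>j\<in>J. s j * F j) = 0"
  shows "\<exists>q. \<forall>j\<in>J. s j = (\<Sum>k<d. q k * M k j)"
proof -
  obtain D where "\<forall>j\<in>J. filt (\<lambda>i. i < D) (s j) = s j"
    using common_filt_bound[OF finJ, of s] by blast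
  then show ?thesis using assms by (rule syzygy_generated_aux)
qed

text \<open>After the base change E the matrix is bidiagonal modulo h, with w2 on the diagonal.
  Every coefficient is therefore divisible by h, the quotients satisfy the same relation, and the
  degree bound drops.\<close>

lemma M_independent_aux:
  assumes "\<forall>k<d. filt (\<lambda>i. i < D) (q k) = q k" and "\<forall>j\<in>J. (\<Sum>k<d. q k * M k j) = 0"
  shows "\<forall>k<d. q k = 0"
  using assms
proof (induction D arbitrary: q)
  case 0
  then show ?case by (simp add: filt_False)
next
  case (Suc D)
  have ME: "(\<Sum>j\<in>J. M k j * Const (E j l)) = (if l = k then Var 1 else 0) - (if l = Suc k then Var 0 else 0)
      - h * (\<Sum>j\<in>J. Const (H k j) * Const (E j l))" if "k < d" "l \<le> d" for k l
  proof -
    have "(\<Sum>j\<in>J. M k j * Const (E j l)) = Var 1 * (\<Sum>j\<in>J. Const (C k j) * Const (E j l))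
       - Var 0 * (\<Sum>j\<in>J. Const (C (Suc k) j) * Const (E j l))
       - h * (\<Sum>j\<in>J. Const (H k j) * Const (E j l))"
      unfolding M_def sum_distrib_left sum_subtractf[symmetric]
      by (intro sum.cong refl) (simp add: algebra_simps)
    then show ?thesis using that by (simp add: Const_sum_mult CE Const_0 Const_1)
  qed
  have main: "(\<Sum>k<d. rho (q k) * ((if l = k then Var 1 else 0) - (if l = Suc k then Var 0 else 0))) = 0"
    if l: "l \<le> d" for l
  proof -
    have "(\<Sum>k<d. q k * (\<Sum>j\<in>J. M k j * Const (E j l))) = (\<Sum>j\<in>J. (\<Sum>k<d. q k * M k j) * Const (E j l))"
      unfolding sum_distrib_left sum_distrib_right mult.assoc by (rule sum.swap)
    also have "\<dots> = 0" using Suc.prems(2) by simp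
    finally have "rho (\<Sum>k<d. q k * (\<Sum>j\<in>J. M k j * Const (E j l))) = 0" by simp
    moreover have "rho (\<Sum>k<d. q k * (\<Sum>j\<in>J. M k j * Const (E j l)))
      = (\<Sum>k<d. rho (q k) * ((if l = k then Var 1 else 0) - (if l = Suc k then Var 0 else 0)))"
      unfolding rho_hom(4)
    proof (intro sum.cong refl)
      fix k assume "k \<in> {..<d}"
      then have k: "k < d" by simp
      have "rho (\<Sum>j\<in>J. M k j * Const (E j l)) = (if l = k then Var 1 else 0) - (if l = Suc k then Var 0 else 0)"
        unfolding ME[OF k l] by (simp add: rho_hom rho_h)
      then show "rho (q k * (\<Sum>j\<in>J. M k j * Const (E j l)))
          = rho (q k) * ((if l = k then Var 1 else 0) - (if l = Suc k then Var 0 else 0))"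
        by (simp only: rho_hom(1))
    qed
    ultimately show ?thesis by simp
  qed
  have rho_q: "rho (q k) = 0" if "k < d" for k
    using that
  proof (induction k)
    case 0
    have "(\<Sum>k<d. rho (q k) * ((if 0 = k then Var 1 else 0) - (if 0 = Suc k then Var 0 else 0)))
      = (\<Sum>k<d. if 0 = k then rho (q k) * Var 1 else 0)"
      by (intro sum.cong refl) simp
    also have "\<dots> = rho (q 0) * Var 1" using 0 by simp
    finally have "(\<Sum>k<d. rho (q k) * ((if 0 = k then Var 1 else 0) - (if 0 = Suc k then Var 0 else 0)))
      = rho (q 0) * Var 1" .
    then have "rho (q 0) * Var 1 = 0" using main[OF le0] by (rule trans[OF sym])
    then show ?case unfolding mult_eq_0_iff by (simp only: Var_neq_0 simp_thms)
  next
    case (Suc k)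
    have "(\<Sum>i<d. rho (q i) * ((if Suc k = i then Var 1 else 0) - (if Suc k = Suc i then Var 0 else 0)))
      = (\<Sum>i<d. (if Suc k = i then rho (q i) * Var 1 else 0))"
      by (intro sum.cong refl) (auto simp: Suc.IH[OF Suc_lessD[OF Suc.prems]] simp del: fun_upd_apply)
    also have "\<dots> = rho (q (Suc k)) * Var 1" using Suc.prems by simp
    finally have "rho (q (Suc k)) * Var 1 = 0"
      using main[OF less_imp_le[OF Suc.prems]] by (rule trans[OF sym])
    then show ?case unfolding mult_eq_0_iff by (simp only: Var_neq_0 simp_thms)
  qed
  have "\<exists>r. q k = h * r \<and> filt (\<lambda>i. i < D) r = r" if k: "k < d" for k
  proof -
    obtain r where r: "q k = h * r" using h_dvd[OF rho_q[OF k]] by blast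
    have "q k = h * filt (\<lambda>i. i < D) r"
      using Suc.prems(1) k filt_less_linear_mult[OF homog_h, of D r] r by metis
    moreover have "filt (\<lambda>i. i < D) (filt (\<lambda>i. i < D) r) = filt (\<lambda>i. i < D) r"
      by (rule filt_cong) (simp add: keys_filt)
    ultimately show ?thesis by blast
  qed
  then obtain r where r: "\<And>k. k < d \<Longrightarrow> q k = h * r k" "\<And>k. k < d \<Longrightarrow> filt (\<lambda>i. i < D) (r k) = r k"
    by metis
  have "(\<Sum>k<d. r k * M k j) = 0" if "j \<in> J" for j
  proof -
    have "h * (\<Sum>k<d. r k * M k j) = (\<Sum>k<d. q k * M k j)"
      by (simp add: r(1) sum_distrib_left mult.assoc)
    then show ?thesis using Suc.prems(2) that h_neq_0 by simp
  qed
  then have "\<forall>k<d. r k = 0" using Suc.IH r(2) by blast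
  then show ?case using r(1) by simp
qed

lemma M_independent:
  assumes "\<forall>j\<in>J. (\<Sum>k<d. q k * M k j) = 0"
  shows "\<forall>k<d. q k = 0"
proof -
  obtain D where "\<forall>k\<in>{..<d}. filt (\<lambda>i. i < D) (q k) = q k"
    using common_filt_bound[of "{..<d}" q] by blast
  then have "\<forall>k<d. filt (\<lambda>i. i < D) (q k) = q k" by simp
  then show ?thesis using assms by (rule M_independent_aux)
qed

lemma M_in: "M k j \<in> polys_in W"
  unfolding M_def h_def t_def by (intro polys_in_intros) (simp_all add: W_def)

lemma M_homog: "homog 1 (M k j)"
  unfolding M_def using homog_mult[OF homog_Var homog_Const] homog_mult[OF homog_h homog_Const]
  by (intro homog_minus) (simp_all del: One_nat_def)

end

section \<open>Points in the plane\<close>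

definition exps :: "nat \<Rightarrow> (nat \<times> nat \<times> nat) set" where
  "exps s = {(a, b, c). a + b + c = s}"

definition emon :: "nat \<times> nat \<times> nat \<Rightarrow> nat \<Rightarrow>\<^sub>0 nat" where
  "emon = (\<lambda>(a, b, c). Poly_Mapping.single 0 a + Poly_Mapping.single 1 b + Poly_Mapping.single 2 c)"

abbreviation emono :: "nat \<times> nat \<times> nat \<Rightarrow> (nat, 'k::comm_ring_1) mpoly" where
  "emono \<equiv> \<lambda>(a, b, c). mono3 a b c"

lemma set_lex_exps: "set (lex_exps n) = exps n"
proof (intro equalityI subsetI)
  fix e assume "e \<in> set (lex_exps n)"
  then obtain a b where "a < n + 1" "b < n - a + 1" "e = (a, b, n - a - b)"
    unfolding lex_exps_def by (auto simp del: upt_Suc)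
  then show "e \<in> exps n" by (simp add: exps_def)
next
  fix e assume "e \<in> exps n"
  then obtain a b c where e: "e = (a, b, c)" "a + b + c = n" by (auto simp: exps_def)
  have "e \<in> (\<lambda>b. (a, b, n - a - b)) ` set (rev [0..<n - a + 1])"
    using e by (intro image_eqI[of _ _ b]) auto
  moreover have "a \<in> set (rev [0..<n + 1])" using e by auto
  ultimately have "e \<in> (\<Union>a\<in>set (rev [0..<n + 1]). (\<lambda>b. (a, b, n - a - b)) ` set (rev [0..<n - a + 1]))"
    by (rule UN_I[rotated])
  then show "e \<in> set (lex_exps n)" unfolding lex_exps_def by (simp only: set_concat set_map image_image)
qed

lemma distinct_lex_exps: "distinct (lex_exps n)"
proof -
  have *: "distinct (concat (map (\<lambda>a. map (\<lambda>b. (a, b, n - a - b)) (rev [0..<n - a + 1])) as))"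
    if "distinct as" for as
    using that by (induction as) (auto simp: distinct_map inj_on_def)
  show ?thesis unfolding lex_exps_def by (rule *) simp
qed

lemma length_lex_exps: "length (lex_exps n) = (n + 2) choose 2"
proof -
  have "length (lex_exps n) = (\<Sum>a\<leftarrow>rev [0..<n+1]. n - a + 1)"
    unfolding lex_exps_def length_concat by (simp add: comp_def)
  also have "\<dots> = (\<Sum>a<Suc n. n - a + 1)"
    by (simp add: interv_sum_list_conv_sum_set_nat atLeast0LessThan flip: rev_map)
  also have "\<dots> = (\<Sum>a<Suc n. Suc a)"
    by (subst sum.nat_diff_reindex[symmetric]) (auto intro!: sum.cong)
  also have "\<dots> = (n + 2) choose 2"
    by (induction n) (simp_all add: numeral_2_eq_2)
  finally show ?thesis .
qed

lemma finite_exps: "finite (exps s)"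
  by (metis set_lex_exps finite_set)

lemma card_exps: "card (exps s) = (s + 2) choose 2"
  by (metis set_lex_exps distinct_card distinct_lex_exps length_lex_exps)

lemma bij_lex_exps: "bij_betw (\<lambda>i. lex_exps n ! (i - 1)) {1..(n + 2) choose 2} (exps n)"
proof -
  have "bij_betw (\<lambda>i. i - 1) {1..(n + 2) choose 2} {..<length (lex_exps n)}"
    by (rule bij_betw_byWitness[where f' = Suc]) (auto simp: length_lex_exps)
  from bij_betw_trans[OF this bij_betw_nth[OF distinct_lex_exps refl refl]]
  show ?thesis by (simp add: comp_def set_lex_exps)
qed

lemma z_eq: "z n i = emono (lex_exps n ! (i - 1))"
  by (simp add: z_def)

lemma emono_eq_mon_eval: "emono e = mon_eval Var (emon e)"
  by (cases e) (simp add: mono3_def emon_def mon_eval_add)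

lemma emono_in: "emono e \<in> polys_in W"
  by (cases e) (auto simp: mono3_def W_def intro!: polys_in_intros)

lemma mdeg_emon: "e \<in> exps s \<Longrightarrow> mdeg (emon e) = s"
  by (auto simp: exps_def emon_def mdeg_add)

lemma emono_homog: "e \<in> exps s \<Longrightarrow> homog s (emono e)"
  by (simp add: emono_eq_mon_eval mon_eval_Var homog_def mdeg_emon)

lemma lookup_emon [simp]:
  "Poly_Mapping.lookup (emon (a, b, c)) 0 = a"
  "Poly_Mapping.lookup (emon (a, b, c)) (Suc 0) = b"
  "Poly_Mapping.lookup (emon (a, b, c)) 2 = c"
  by (simp_all add: emon_def lookup_add lookup_single)

lemma inj_emon: "inj emon"
proof (rule injI)
  fix e e' assume "emon e = emon e'"
  then show "e = e'" by (cases e; cases e') (metis lookup_emon)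
qed

lemma emon_surj:
  assumes "Poly_Mapping.keys m \<subseteq> W" "mdeg m = s"
  shows "m \<in> emon ` exps s"
proof -
  let ?e = "(Poly_Mapping.lookup m 0, Poly_Mapping.lookup m 1, Poly_Mapping.lookup m 2)"
  have "mdeg m = (\<Sum>v\<in>W. Poly_Mapping.lookup m v)"
    using assms(1) by (intro mdeg_superset) (simp_all add: W_def)
  then have "?e \<in> exps s" using assms(2) by (simp add: exps_def W_def)
  moreover have "m = emon ?e"
  proof (rule poly_mapping_eqI)
    fix k
    have "Poly_Mapping.lookup m k = 0" if "k \<notin> W"
      using that assms(1) by (auto simp: in_keys_iff)
    then show "Poly_Mapping.lookup m k = Poly_Mapping.lookup (emon ?e) k"
      by (cases "k \<in> W") (auto simp: W_def emon_def lookup_add lookup_single when_def)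
  qed
  ultimately show ?thesis by blast
qed

lemma homog_expand:
  assumes "p \<in> polys_in W" "homog s p"
  shows "p = (\<Sum>e\<in>exps s. smul (Poly_Mapping.lookup p (emon e)) (emono e))"
proof -
  have "p = (\<Sum>m\<in>Poly_Mapping.keys p. Poly_Mapping.single m (Poly_Mapping.lookup p m))"
    by (rule poly_mapping_sum_single)
  also have "\<dots> = (\<Sum>m\<in>emon ` exps s. Poly_Mapping.single m (Poly_Mapping.lookup p m))"
    using assms emon_surj finite_exps
    by (intro sum.mono_neutral_left) (auto simp: polys_in_def homog_def in_keys_iff)
  also have "\<dots> = (\<Sum>e\<in>exps s. Poly_Mapping.single (emon e) (Poly_Mapping.lookup p (emon e)))"
    using inj_emon by (subst sum.reindex) (auto simp: inj_on_def)
  also have "\<dots> = (\<Sum>e\<in>exps s. smul (Poly_Mapping.lookup p (emon e)) (emono e))"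
    by (simp add: emono_eq_mon_eval smul_def single_eq_Const_mult)
  finally show ?thesis .
qed

lemma emono_sum_eq_0:
  assumes "(\<Sum>e\<in>exps s. smul (c e) (emono e)) = 0" "e \<in> exps s"
  shows "c e = 0"
proof -
  have "Poly_Mapping.lookup (\<Sum>e\<in>exps s. smul (c e) (emono e)) (emon e) = (\<Sum>e'\<in>exps s. if e' = e then c e' else 0)"
    unfolding lookup_sum
  proof (rule sum.cong[OF refl])
    fix e'
    have "Poly_Mapping.lookup (smul (c e') (emono e')) (emon e) = (if emon e' = emon e then c e' else 0)"
      by (simp add: smul_def emono_eq_mon_eval single_eq_Const_mult[symmetric] lookup_single when_def)
    then show "Poly_Mapping.lookup (smul (c e') (emono e')) (emon e) = (if e' = e then c e' else 0)"
      by (simp add: inj_eq[OF inj_emon])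
  qed
  then show ?thesis using assms finite_exps by simp
qed

lemma emono_sum_in: "(\<Sum>e\<in>exps s. smul (c e) (emono e)) \<in> polys_in W"
  by (intro polys_in_sum polys_in_smul emono_in)

lemma emono_sum_homog: "homog s (\<Sum>e\<in>exps s. smul (c e) (emono e))"
  by (intro homog_sum homog_smul emono_homog)

lemma peval_emono_sum:
  "peval Q (\<Sum>e\<in>exps s. smul (c e) (emono e)) = (\<Sum>e\<in>exps s. c e * mon_eval Q (emon e))"
  unfolding rhom_sum[OF rhom_peval] smul_def rhom_mult[OF rhom_peval] emono_eq_mon_eval
  by (simp add: rhom_mon_eval[OF rhom_peval])

text \<open>The number of points equals the number of monomials of degree d - 1, so both arguments
  of the minimum agree. As this number is positive, truncated subtraction leaves no choice but
  dimension 0.\<close>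

lemma generic_position_imp_I_comp_eq_0:
  assumes gp: "generic_position X" and card: "card X = (d + 1) choose 2" and d: "d \<ge> 1"
    and f: "f \<in> I_comp X (d - 1)"
  shows "f = (0 :: (nat, 'k::field) mpoly)"
proof -
  interpret vs: vector_space "smul :: 'k \<Rightarrow> (nat, 'k) mpoly \<Rightarrow> _" by (rule vector_space_smul)
  have d': "d - 1 + 2 = d + 1" using d by simp
  have pos: "((d + 1) choose 2) > 0" using d by (simp add: zero_less_binomial)
  have "((d + 1) choose 2) - vs.dim (I_comp X (d - 1)) = (d + 1) choose 2"
    using gp[unfolded generic_position_def, rule_format, of "d - 1"] unfolding d' card by simp
  then have dim: "vs.dim (I_comp X (d - 1)) = 0" using pos by arith
  obtain B where B: "B \<subseteq> I_comp X (d - 1)" "vs.independent B" "I_comp X (d - 1) \<subseteq> vs.span B"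
      "card B = vs.dim (I_comp X (d - 1))"
    by (rule vs.basis_exists)
  \<comment> \<open>A basis of cardinality 0 could still be infinite; the span of the monomials
    rules this out.\<close>
  have "B \<subseteq> vs.span (emono ` exps (d - 1))"
  proof
    fix p assume "p \<in> B"
    then have "p \<in> polys_in W" "homog (d - 1) p" using B(1) by (auto simp: I_comp_def)
    from homog_expand[OF this] show "p \<in> vs.span (emono ` exps (d - 1))"
      by (metis (no_types, lifting) vs.span_sum vs.span_scale vs.span_base imageI)
  qed
  then have "finite B"
    using vs.independent_span_bound[OF _ B(2)] finite_exps by blast
  then have "B = {}" using B(4) dim by simp
  then show ?thesis using B(3) f by auto
qed

text \<open>In the family of lines w3 = x w1 + x^2 w2 each point excludes only the roots of a
  nonzero polynomial in x of degree at most two.\<close>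

lemma exists_avoiding_line:
  fixes X :: "(nat \<Rightarrow> 'k::field_char_0) set"
  assumes "proj_points X"
  shows "\<exists>a b. \<forall>P\<in>X. P 2 - a * P 0 - b * P 1 \<noteq> 0"
proof -
  define g where "g P = [:P 2, - P 0, - P 1:]" for P :: "nat \<Rightarrow> 'k"
  have "g P \<noteq> 0" if "P \<in> X" for P
    using assms that by (auto simp: proj_points_def g_def W_def)
  then have "finite (\<Union>P\<in>X. {x. poly (g P) x = 0})"
    using assms by (intro finite_UN_I poly_roots_finite) (auto simp: proj_points_def)
  then obtain x where "x \<notin> (\<Union>P\<in>X. {x. poly (g P) x = 0})"
    using ex_new_if_finite[OF infinite_UNIV_char_0] by blast
  then have "\<forall>P\<in>X. P 2 - x * P 0 - (x * x) * P 1 \<noteq> 0"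
    by (simp add: g_def algebra_simps)
  then show ?thesis by blast
qed

text \<open>Generic position enters as \<open>I_0\<close>. The F_j enter as an arbitrary basis of
  the forms of degree d through X.\<close>

locale plane_points =
  fixes d :: nat and X :: "(nat \<Rightarrow> 'k::field_char_0) set" and F :: "nat \<Rightarrow> (nat, 'k) mpoly" and J :: "nat set"
  assumes d_ge_1: "d \<ge> 1" and proj: "proj_points X" and cardX: "card X = (d + 1) choose 2"
    and I_0: "f \<in> I_comp X (d - 1) \<Longrightarrow> f = 0"
    and finJ: "finite J" and cardJ: "card J = d + 1"
    and F_in: "j \<in> J \<Longrightarrow> F j \<in> I_comp X d"
    and F_span: "f \<in> I_comp X d \<Longrightarrow> \<exists>c. f = (\<Sum>j\<in>J. Const (c j) * F j)"
    and F_indep: "(\<Sum>j\<in>J. Const (c j) * F j) = 0 \<Longrightarrow> j \<in> J \<Longrightarrow> c j = 0"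
begin

lemma finite_X: "finite X" using proj by (simp add: proj_points_def)

lemma I_comp_sum: "(\<Sum>j\<in>J. Const (c j) * F j) \<in> I_comp X d"
proof -
  have "homog d (Const (c j) * F j)" if "j \<in> J" for j
    using homog_mult[OF homog_Const, of d "F j" "c j"] F_in[OF that] by (simp add: I_comp_def)
  then show ?thesis
    using F_in unfolding I_comp_def
    by (auto simp: rhom_sum[OF rhom_peval] rhom_mult[OF rhom_peval] intro!: polys_in_intros homog_sum)
qed

text \<open>Reduction modulo h is injective on the degree-d forms through X, because a form in its
  kernel is h times a form of degree d - 1 through X. Its source and the binary forms of degree d
  both have dimension d + 1, so every monomial in w1 and w2 lifts.\<close>

lemma exists_hilbert_burch: "\<exists>a b C E H. hilbert_burch d J a b F C E H"
proof -
  obtain a b where ab: "\<And>P. P \<in> X \<Longrightarrow> P 2 - a * P 0 - b * P 1 \<noteq> 0"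
    using exists_avoiding_line[OF proj] by blast
  define t :: "(nat, 'k) mpoly" where "t = Const a * Var 0 + Const b * Var 1"
  define h where "h = Var 2 - t"
  define rho :: "(nat, 'k) mpoly \<Rightarrow> (nat, 'k) mpoly" where "rho = subst (Var(2 := t))"
  have rhom_rho: "rhom rho" unfolding rho_def by (rule rhom_subst)
  have rho_Const: "rho (Const c) = Const c" for c by (simp add: rho_def rhom_Const)
  have homog_cw: "homog 1 (Const c * Var v)" for c :: 'k and v :: nat
    using homog_mult[OF homog_Const homog_Var, of c v] by simp
  have homog_t: "homog 1 t" unfolding t_def by (intro homog_add homog_cw)
  have homog_h: "homog 1 h" unfolding h_def by (intro homog_minus homog_Var homog_t)
  have t_in: "t \<in> polys_in {0, 1}" unfolding t_def by (intro polys_in_intros) simp_all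
  have h_in: "h \<in> polys_in W" unfolding h_def t_def by (intro polys_in_intros) (simp_all add: W_def)
  have peval_h: "peval P h \<noteq> 0" if "P \<in> X" for P
    using ab[OF that]
    by (simp add: h_def t_def rhom_minus[OF rhom_peval] rhom_add[OF rhom_peval] rhom_mult[OF rhom_peval] algebra_simps)
  \<comment> \<open>As h vanishes at no point of X, the cofactor inherits the zeros.\<close>
  have div_h: "\<exists>Q \<in> I_comp X s. f = h * Q" if f: "f \<in> I_comp X (Suc s)" "rho f = 0" for f s
  proof -
    have f': "f \<in> polys_in W" "homog (Suc s) f" "\<And>P. P \<in> X \<Longrightarrow> peval P f = 0"
      using f(1) by (auto simp: I_comp_def)
    obtain Q0 where Q0: "f = h * Q0"
      using subst_eq_0_imp_dvd[of 2 t f] f(2) unfolding rho_def h_def by blast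
    \<comment> \<open>Divisibility holds in the ring of all variables; retraction and projection to
      degree s put the cofactor into the right graded piece.\<close>
    define Q where "Q = filt (\<lambda>i. i = s) (retract W Q0)"
    have "f = filt (\<lambda>i. i = Suc s) (retract W f)"
      using f' by (simp add: retract_id filt_homog)
    also have "retract W f = h * retract W Q0"
      unfolding Q0 rhom_mult[OF rhom_retract] retract_id[OF h_in] ..
    also have "filt (\<lambda>i. i = Suc s) (h * retract W Q0) = h * Q"
      unfolding filt_homog_mult[OF homog_h] Q_def by simp
    finally have eq: "f = h * Q" .
    have "peval P Q = 0" if "P \<in> X" for P
      using f'(3)[OF that] peval_h[OF that] unfolding eq rhom_mult[OF rhom_peval] by simp
    then have "Q \<in> I_comp X s"
      by (simp add: I_comp_def Q_def homog_filt_eq polys_in_filt retract_in)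
    then show ?thesis using eq by blast
  qed
  have rho_inj: "f = 0" if "f \<in> I_comp X d" "rho f = 0" for f
    using div_h[of f "d - 1"] I_0 that d_ge_1 by auto

  define E where "E j l = Poly_Mapping.lookup (rho (F j)) (emon (d - l, l, 0))" for j l
  have rho_F: "rho (F j) = (\<Sum>l\<le>d. Const (E j l) * (Var 0 ^ (d - l) * Var 1 ^ l))" if j: "j \<in> J" for j
  proof -
    have Fj: "F j \<in> polys_in W" "homog d (F j)" using F_in[OF j] by (auto simp: I_comp_def)
    have in01: "rho (F j) \<in> polys_in {0, 1}"
      unfolding rho_def using t_in
      by (rule_tac polys_in_subst[OF Fj(1)]) (auto simp: W_def intro!: polys_in_Var)
    have "homog (d * 1) (rho (F j))"
      unfolding rho_def using homog_t
      by (rule_tac homog_subst[OF Fj(2,1)]) (simp add: homog_Var del: One_nat_def)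
    then have hom: "homog d (rho (F j))" by simp
    have inW: "rho (F j) \<in> polys_in W" using in01 by (auto simp: polys_in_def W_def)
    let ?f = "\<lambda>e. smul (Poly_Mapping.lookup (rho (F j)) (emon e)) (emono e)"
    have "rho (F j) = (\<Sum>e\<in>exps d. ?f e)" by (rule homog_expand[OF inW hom])
    also have "\<dots> = (\<Sum>e\<in>(\<lambda>l. (d - l, l, 0)) ` {..d}. ?f e)"
    proof (rule sum.mono_neutral_right[OF finite_exps])
      show "(\<lambda>l. (d - l, l, 0)) ` {..d} \<subseteq> exps d" by (auto simp: exps_def)
      show "\<forall>e\<in>exps d - (\<lambda>l. (d - l, l, 0)) ` {..d}. ?f e = 0"
      proof
        fix e assume e: "e \<in> exps d - (\<lambda>l. (d - l, l, 0)) ` {..d}"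
        obtain x y w where exyw: "e = (x, y, w)" by (cases e)
        have "w \<noteq> 0" using e unfolding exyw exps_def by (auto simp: image_iff)
        then have "2 \<in> Poly_Mapping.keys (emon e)" by (simp add: exyw in_keys_iff)
        moreover have "Poly_Mapping.keys (emon e) \<subseteq> {0, 1}" if "emon e \<in> Poly_Mapping.keys (rho (F j))"
          using in01 that by (simp add: polys_in_def)
        moreover have "(2::nat) \<notin> {0, 1}" by simp
        ultimately have "emon e \<notin> Poly_Mapping.keys (rho (F j))" by blast
        then show "?f e = 0" by (simp add: in_keys_iff smul_def Const_0)
      qed
    qed
    also have "\<dots> = (\<Sum>l\<le>d. Const (E j l) * (Var 0 ^ (d - l) * Var 1 ^ l))"
      by (subst sum.reindex) (auto simp: inj_on_def E_def smul_def mono3_def intro!: sum.cong)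
    finally show ?thesis .
  qed
  have rho_comb: "rho (\<Sum>j\<in>J. Const (c j) * F j)
      = (\<Sum>l\<le>d. Const (\<Sum>j\<in>J. c j * E j l) * (Var 0 ^ (d - l) * Var 1 ^ l))" for c
  proof -
    have "rho (\<Sum>j\<in>J. Const (c j) * F j) = (\<Sum>j\<in>J. Const (c j) * (\<Sum>l\<le>d. Const (E j l) * (Var 0 ^ (d - l) * Var 1 ^ l)))"
      by (simp add: rhom_sum[OF rhom_rho] rhom_mult[OF rhom_rho] rho_Const rho_F)
    also have "\<dots> = (\<Sum>l\<le>d. \<Sum>j\<in>J. Const (c j) * (Const (E j l) * (Var 0 ^ (d - l) * Var 1 ^ l)))"
      unfolding sum_distrib_left by (rule sum.swap)
    also have "\<dots> = (\<Sum>l\<le>d. Const (\<Sum>j\<in>J. c j * E j l) * (Var 0 ^ (d - l) * Var 1 ^ l))"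
      by (simp add: rhom_sum[OF rhom_Const] Const_mult sum_distrib_right mult.assoc)
    finally show ?thesis .
  qed
  \<comment> \<open>The square matrix E has trivial kernel because a kernel vector would be a
    combination of the F_j that vanishes modulo h. Solving for unit vectors gives the rows of its
    inverse C.\<close>
  have "\<exists>c. \<forall>l'\<in>{..d}. (\<Sum>j\<in>J. c j * E j l') = (if l = l' then 1 else 0)" for l
  proof (rule square_system_solvable[OF finJ])
    show "card J = card {..d}" by (simp add: cardJ)
    fix c assume "\<forall>l\<in>{..d}. (\<Sum>j\<in>J. c j * E j l) = 0"
    then have "rho (\<Sum>j\<in>J. Const (c j) * F j) = 0" by (simp add: rho_comb Const_0)
    then show "\<forall>j\<in>J. c j = 0" using F_indep rho_inj[OF I_comp_sum] by blast
  qed simp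
  then obtain C where C: "\<And>l l'. l' \<le> d \<Longrightarrow> (\<Sum>j\<in>J. C l j * E j l') = (if l = l' then 1 else 0)"
    by (metis atMost_iff)
  define F' where "F' l = (\<Sum>j\<in>J. Const (C l j) * F j)" for l
  have rho_F': "rho (F' l) = Var 0 ^ (d - l) * Var 1 ^ l" if "l \<le> d" for l
  proof -
    have "rho (F' l) = (\<Sum>l'\<le>d. if l = l' then Var 0 ^ (d - l') * Var 1 ^ l' else 0)"
      unfolding F'_def rho_comb by (intro sum.cong refl) (simp add: C Const_0 Const_1)
    then show ?thesis using that by simp
  qed
  have F'_sum: "(\<Sum>l\<le>d. Const (c l) * F' l) = (\<Sum>j\<in>J. Const (\<Sum>l\<le>d. c l * C l j) * F j)" for c
    unfolding F'_def sum_distrib_left sum_distrib_right rhom_sum[OF rhom_Const] Const_mult mult.assoc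
    by (rule sum.swap)
  have diff: "F j - (\<Sum>l\<le>d. Const (E j l) * F' l)
      = (\<Sum>i\<in>J. Const ((if i = j then 1 else 0) - (\<Sum>l\<le>d. E j l * C l i)) * F i)" if j: "j \<in> J" for j
  proof -
    have "(\<Sum>i\<in>J. Const (if i = j then 1 else 0) * F i) = (\<Sum>i\<in>J. if i = j then F i else 0)"
      by (intro sum.cong refl) (simp add: Const_0 Const_1)
    then have "(\<Sum>i\<in>J. Const (if i = j then 1 else 0) * F i) = F j" using j finJ by simp
    then show ?thesis
      by (simp add: F'_sum rhom_minus[OF rhom_Const] left_diff_distrib sum_subtractf)
  qed
  have F_eq: "F j = (\<Sum>l\<le>d. Const (E j l) * F' l)" if j: "j \<in> J" for j
  proof -
    have "rho (F j - (\<Sum>l\<le>d. Const (E j l) * F' l)) = 0"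
      by (simp add: rhom_minus[OF rhom_rho] rhom_sum[OF rhom_rho] rhom_mult[OF rhom_rho] rho_Const rho_F[OF j] rho_F')
    then have "(\<Sum>i\<in>J. Const ((if i = j then 1 else 0) - (\<Sum>l\<le>d. E j l * C l i)) * F i) = 0"
      unfolding diff[OF j] by (rule rho_inj[OF I_comp_sum])
    then show ?thesis unfolding diff[OF j, symmetric] by (simp only: right_minus_eq)
  qed
  have EC: "(\<Sum>l\<le>d. E j l * C l i) = (if j = i then 1 else 0)" if "j \<in> J" "i \<in> J" for j i
    using F_indep[of "\<lambda>i. (if i = j then 1 else 0) - (\<Sum>l\<le>d. E j l * C l i)" i] diff[OF that(1)] F_eq[OF that(1)] that
    by (auto simp: algebra_simps)
  \<comment> \<open>The two products have the same reduction modulo h, so their difference is h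
    times a form of degree d through X, to be expanded in the F_j.\<close>
  have "\<exists>c. Var 1 * F' k - Var 0 * F' (Suc k) = h * (\<Sum>j\<in>J. Const (c j) * F j)" if k: "k < d" for k
  proof -
    have F'_in: "F' l \<in> I_comp X d" for l unfolding F'_def by (rule I_comp_sum)
    have "Var 1 * F' k - Var 0 * F' (Suc k) \<in> I_comp X (Suc d)"
      using F'_in[of k] F'_in[of "Suc k"] homog_mult[OF homog_Var, of d "F' k" 1] homog_mult[OF homog_Var, of d "F' (Suc k)" 0]
      by (auto simp: I_comp_def W_def rhom_minus[OF rhom_peval] rhom_mult[OF rhom_peval]
          intro!: polys_in_intros homog_minus)
    moreover have "rho (Var 1 * F' k - Var 0 * F' (Suc k)) = 0"
    proof -
      have "rho (Var 1) = Var 1" "rho (Var 0) = Var 0" by (simp_all add: rho_def rhom_Const)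
      moreover have "d - k = Suc (d - Suc k)" using k by simp
      ultimately show ?thesis
        using k by (simp add: rhom_minus[OF rhom_rho] rhom_mult[OF rhom_rho] rho_F')
    qed
    ultimately obtain Q where "Q \<in> I_comp X d" "Var 1 * F' k - Var 0 * F' (Suc k) = h * Q"
      using div_h by blast
    then show ?thesis using F_span by metis
  qed
  then obtain H where H: "\<And>k. k < d \<Longrightarrow> Var 1 * F' k - Var 0 * F' (Suc k) = h * (\<Sum>j\<in>J. Const (H k j) * F j)"
    by metis
  note defs = F'_def rho_def h_def t_def
  have CE: "(\<Sum>j\<in>J. C l j * E j l') = (if l = l' then 1 else 0)" if "l \<le> d" "l' \<le> d" for l l'
    using C that(2) .
  have "hilbert_burch d J a b F C E H"
    by unfold_locales (fact finJ F_eq[unfolded defs] rho_F'[unfolded defs] EC CE H[unfolded defs])+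
  then show ?thesis by blast
qed

text \<open>The matrix is handed on through its syzygy properties alone; no determinants are
  formed.\<close>

theorem hilbert_burch_matrix:
  obtains M :: "nat \<Rightarrow> nat \<Rightarrow> (nat, 'k) mpoly"
  where "\<And>k j. M k j \<in> polys_in W" "\<And>k j. homog 1 (M k j)"
    "\<And>k. k < d \<Longrightarrow> (\<Sum>j\<in>J. M k j * F j) = 0"
    "\<And>s. (\<Sum>j\<in>J. s j * F j) = 0 \<Longrightarrow> \<exists>q. \<forall>j\<in>J. s j = (\<Sum>k<d. q k * M k j)"
    "\<And>q. \<forall>j\<in>J. (\<Sum>k<d. q k * M k j) = 0 \<Longrightarrow> \<forall>k<d. q k = 0"
proof -
  obtain a b C E H where hb: "hilbert_burch d J a b F C E H" using exists_hilbert_burch by blast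
  interpret hb: hilbert_burch d J a b F C E H "Const a * Var 0 + Const b * Var 1"
    "Var 2 - (Const a * Var 0 + Const b * Var 1)" "\<lambda>l. \<Sum>j\<in>J. Const (C l j) * F j"
    "\<lambda>k j. Var 1 * Const (C k j) - Var 0 * Const (C (Suc k) j)
      - (Var 2 - (Const a * Var 0 + Const b * Var 1)) * Const (H k j)"
    by (fact hb) (rule reflexive)+
  show ?thesis
    by (rule that[OF hb.M_in hb.M_homog hb.M_syzygy hb.syzygy_generated hb.M_independent])
qed

text \<open>The matrix of values of the monomials of degree d - 1 at X is square, and
  \<open>I_0\<close> says that its kernel is trivial.\<close>

lemma exists_separators:
  "\<exists>\<sigma>. (\<forall>P\<in>X. \<sigma> P \<in> polys_in W \<and> homog (d - 1) (\<sigma> P) \<and> (\<forall>Q\<in>X. peval Q (\<sigma> P) = (if P = Q then 1 else 0)))"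
proof -
  have "\<exists>c. \<forall>Q\<in>X. (\<Sum>e\<in>exps (d - 1). c e * mon_eval Q (emon e)) = (if P = Q then 1 else 0)" for P
  proof (rule square_system_solvable[OF finite_exps finite_X])
    have "d - 1 + 2 = d + 1" using d_ge_1 by simp
    then show "card (exps (d - 1)) = card X" by (simp only: card_exps cardX)
    fix c assume c: "\<forall>Q\<in>X. (\<Sum>e\<in>exps (d - 1). c e * mon_eval Q (emon e)) = 0"
    let ?p = "\<Sum>e\<in>exps (d - 1). smul (c e) (emono e)"
    have "?p \<in> I_comp X (d - 1)"
      using c by (simp add: I_comp_def emono_sum_in emono_sum_homog peval_emono_sum)
    then show "\<forall>e\<in>exps (d - 1). c e = 0" using I_0 emono_sum_eq_0 by blast
  qed
  then obtain c where c: "\<And>P. \<forall>Q\<in>X. (\<Sum>e\<in>exps (d - 1). c P e * mon_eval Q (emon e)) = (if P = Q then 1 else 0)"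
    by metis
  show ?thesis
    by (rule exI[of _ "\<lambda>P. \<Sum>e\<in>exps (d - 1). smul (c P e) (emono e)"])
      (use c in \<open>simp add: emono_sum_in emono_sum_homog peval_emono_sum\<close>)
qed

end

section \<open>The Segre-Veronese box\<close>

text \<open>Inverse of the lexicographic enumeration, shifted because the coordinates x_ij count
  from 1 and lists from 0.\<close>

definition idx :: "nat \<Rightarrow> nat \<times> nat \<times> nat \<Rightarrow> nat" where
  "idx n = inv_into {1..(n + 2) choose 2} (\<lambda>i. lex_exps n ! (i - 1))"

lemma idx_in: "e \<in> exps n \<Longrightarrow> idx n e \<in> {1..(n + 2) choose 2}"
  unfolding idx_def using bij_lex_exps[of n] by (metis bij_betw_imp_surj_on inv_into_into)

lemma lex_exps_idx: "e \<in> exps n \<Longrightarrow> lex_exps n ! (idx n e - 1) = e"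
  unfolding idx_def using bij_lex_exps[of n] bij_betw_inv_into_right by fastforce

lemma idx_lex_exps: "i \<in> {1..(n + 2) choose 2} \<Longrightarrow> idx n (lex_exps n ! (i - 1)) = i"
  unfolding idx_def using bij_betw_inv_into_left[OF bij_lex_exps] .

lemma lex_exps_in: "i \<in> {1..(n + 2) choose 2} \<Longrightarrow> lex_exps n ! (i - 1) \<in> exps n"
  using bij_lex_exps[of n] by (auto simp: bij_betw_def)

lemma z_idx: "e \<in> exps n \<Longrightarrow> z n (idx n e) = emono e"
  by (simp only: z_eq lex_exps_idx)

text \<open>The first n box coordinates form a word in the letters 1, 2, 3; its letter counts are
  the exponents of the monomial. Different words may give the same monomial, which is the symmetry
  of the Veronese embedding.\<close>

definition cnt :: "nat list \<Rightarrow> nat \<times> nat \<times> nat" where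
  "cnt xs = (count_list xs 1, count_list xs 2, count_list xs 3)"

lemma cnt_exps:
  assumes "set xs \<subseteq> {1, 2, 3}" shows "cnt xs \<in> exps (length xs)"
  using assms by (induction xs) (auto simp: cnt_def exps_def)

lemma emono_cnt:
  assumes "set xs \<subseteq> {1, 2, 3}"
  shows "emono (cnt xs) = (\<Prod>l<length xs. Var (xs ! l - 1) :: (nat, 'k::comm_ring_1) mpoly)"
  using assms
proof (induction xs)
  case Nil
  then show ?case by (simp add: cnt_def mono3_def)
next
  case (Cons x xs)
  have "emono (cnt (x # xs)) = Var (x - 1) * (emono (cnt xs) :: (nat, 'k) mpoly)"
    using Cons.prems by (auto simp: cnt_def mono3_def algebra_simps numeral_2_eq_2)
  then show ?case
    using Cons by (simp add: prod.lessThan_Suc_shift del: prod.lessThan_Suc)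
qed

lemma cnt_mset: "mset xs = mset ys \<Longrightarrow> cnt xs = cnt ys"
  by (simp add: cnt_def flip: count_mset)

lemma cnt_surj: "e \<in> exps n \<Longrightarrow> \<exists>xs. set xs \<subseteq> {1, 2, 3} \<and> length xs = n \<and> cnt xs = e"
proof -
  assume "e \<in> exps n"
  then obtain a b c where e: "e = (a, b, c)" "a + b + c = n" by (auto simp: exps_def)
  have rep: "count_list (replicate k x) y = (if x = y then k else 0)" for k and x y :: nat
    by (induction k) auto
  show ?thesis
    by (rule exI[of _ "replicate a 1 @ replicate b 2 @ replicate c 3"])
      (use e in \<open>auto simp: cnt_def rep\<close>)
qed

definition boxA :: "nat \<Rightarrow> nat list \<Rightarrow> (nat \<times> nat, 'k::comm_ring_1) mpoly" where
  "boxA n a = Var (idx n (cnt (take n a)), a ! n)"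

definition box :: "nat \<Rightarrow> nat \<Rightarrow> nat list set" where "box n d = box_index (replicate n 3 @ [d + 1])"

lemma box_iff: "a \<in> box n d \<longleftrightarrow> length a = Suc n \<and> (\<forall>l<n. a ! l \<in> {1, 2, 3}) \<and> a ! n \<in> {1..d+1}"
proof -
  have "(\<forall>k<Suc n. 1 \<le> a ! k \<and> a ! k \<le> (replicate n 3 @ [d + 1]) ! k) \<longleftrightarrow>
     (\<forall>l<n. a ! l \<in> {1, 2, 3}) \<and> a ! n \<in> {1..d+1}"
    by (fastforce simp: less_Suc_eq nth_append)
  then show ?thesis by (simp add: box_def box_index_def)
qed

lemma take_box: "a \<in> box n d \<Longrightarrow> set (take n a) \<subseteq> {1, 2, 3} \<and> length (take n a) = n"
  unfolding box_iff by (auto simp: set_conv_nth)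

lemma update_box: "a \<in> box n d \<Longrightarrow> b \<in> box n d \<Longrightarrow> l \<le> n \<Longrightarrow> a[l := b ! l] \<in> box n d"
  unfolding box_iff by (auto simp: nth_list_update)

lemma cnt_take_box: "a \<in> box n d \<Longrightarrow> cnt (take n a) \<in> exps n"
  using cnt_exps[of "take n a"] take_box[of a n d] by simp

text \<open>The ideal is arbitrary above the minors, so that the relations can later be used modulo
  the linear forms as well.\<close>

locale box_ideal =
  fixes n d :: nat and I :: "(nat \<times> nat, 'k::field_char_0) mpoly set"
  assumes n_ge_1: "n \<ge> 1" and ideal: "is_ideal I"
    and minors: "box_minors (replicate n 3 @ [d + 1]) (boxA n) \<subseteq> I"
begin

abbreviation "B \<equiv> box n d"

lemma swap:
  assumes "a \<in> B" "b \<in> B" "l \<le> n"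
  shows "boxA n a * boxA n b - boxA n (a[l := b ! l]) * boxA n (b[l := a ! l]) \<in> I"
proof -
  have "boxA n a * boxA n b - boxA n (a[l := b ! l]) * boxA n (b[l := a ! l])
      \<in> box_minors (replicate n 3 @ [d + 1]) (boxA n)"
    unfolding box_minors_def using assms unfolding box_def by fastforce
  then show ?thesis using minors by blast
qed

text \<open>The entries of the base index are replaced by those of \<open>a\<close> one coordinate
  at a time. Each replacement is one minor and costs one factor \<open>boxA n base\<close>; the
  extra factor on the right is the starting value at k = 0.\<close>

lemma expand_aux:
  assumes base: "base \<in> B" and a: "a \<in> B" and "k \<le> Suc n"
  shows "boxA n base ^ k * boxA n (take k a @ drop k base)
      - boxA n base * (\<Prod>l<k. boxA n (base[l := a ! l])) \<in> I"
  using assms(3)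
proof (induction k)
  case 0
  then show ?case by (simp add: ideal_0[OF ideal])
next
  case (Suc k)
  have len: "length a = Suc n" "length base = Suc n" using a base by (simp_all add: box_iff)
  let ?ak = "take k a @ drop k base" and ?b = "base[k := a ! k]"
  have ak: "?ak \<in> B" using a base Suc.prems by (auto simp: box_iff nth_append)
  have b: "?b \<in> B" using update_box[OF base a, of k] Suc.prems by simp
  have 1: "?ak[k := ?b ! k] = take (Suc k) a @ drop (Suc k) base"
    using len Suc.prems by (intro nth_equalityI) (auto simp: nth_list_update nth_append less_Suc_eq)
  have 2: "?b[k := ?ak ! k] = base"
    using len Suc.prems by (intro nth_equalityI) (auto simp: nth_list_update nth_append)
  have "boxA n ?ak * boxA n ?b - boxA n (take (Suc k) a @ drop (Suc k) base) * boxA n base \<in> I"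
    using swap[OF ak b, of k] Suc.prems unfolding 1 2 by simp
  then have "boxA n base ^ k * (boxA n (take (Suc k) a @ drop (Suc k) base) * boxA n base)
       - boxA n base ^ k * (boxA n ?ak * boxA n ?b) \<in> I"
    by (rule ideal_cong_mult_left[OF ideal ideal_cong_sym[OF ideal]])
  moreover have "(boxA n base ^ k * boxA n ?ak) * boxA n ?b
      - (boxA n base * (\<Prod>l<k. boxA n (base[l := a ! l]))) * boxA n ?b \<in> I"
    using Suc by (intro ideal_cong_mult_right ideal) auto
  ultimately have "boxA n base ^ k * (boxA n (take (Suc k) a @ drop (Suc k) base) * boxA n base)
      - (boxA n base * (\<Prod>l<k. boxA n (base[l := a ! l]))) * boxA n ?b \<in> I"
    unfolding mult.assoc by (rule ideal_cong_trans[OF ideal])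
  then show ?case by (simp add: algebra_simps)
qed

lemma expand:
  assumes "base \<in> B" "a \<in> B"
  shows "boxA n base ^ Suc n * boxA n a - boxA n base * (\<Prod>l<Suc n. boxA n (base[l := a ! l])) \<in> I"
  using expand_aux[OF assms order_refl] assms by (simp add: box_iff)

lemma boxA_perm:
  "mset (take n a) = mset (take n b) \<Longrightarrow> a ! n = b ! n \<Longrightarrow> boxA n a = boxA n b"
  using cnt_mset[of "take n a" "take n b"] by (simp add: boxA_def)

text \<open>An exchange with an entry of equal value makes one more letter equal to the first
  letter, at the cost of one factor \<open>boxA n a\<close>.\<close>

lemma to_constant_aux:
  assumes a: "a \<in> B" and "1 \<le> k" "k \<le> n"
  shows "\<exists>s. boxA n a ^ k - boxA n (replicate k (a ! 0) @ drop k a) * s \<in> I"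
  using assms(2,3)
proof (induction k rule: nat_induct_at_least)
  case base
  have "replicate 1 (a ! 0) @ drop 1 a = a" using a by (cases a) (auto simp: box_iff)
  then show ?case by (intro exI[of _ 1]) (simp add: ideal_0[OF ideal])
next
  case (Suc k)
  have len: "length a = Suc n" using a by (simp add: box_iff)
  \<comment> \<open>\<open>?a'\<close> is \<open>a\<close> with positions 0 and k interchanged. The
    box entry is unchanged by symmetry, but the letter \<open>a ! 0\<close> now stands at position
    k, where the minor can exchange it into \<open>?b\<close>.\<close>
  let ?b = "replicate k (a ! 0) @ drop k a" and ?a' = "a[k := a ! 0, 0 := a ! k]"
  obtain s where s: "boxA n a ^ k - boxA n ?b * s \<in> I" using Suc by auto
  have b: "?b \<in> B" using a Suc.prems n_ge_1 by (auto simp: box_iff nth_append)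
  have a': "?a' \<in> B" using a Suc.prems Suc.hyps n_ge_1 by (auto simp: box_iff nth_list_update)
  have perm: "boxA n ?a' = boxA n a"
  proof (rule boxA_perm)
    have "take n ?a' = (take n a)[k := take n a ! 0, 0 := take n a ! k]"
      using Suc.prems by (simp add: take_update_swap)
    also have "mset \<dots> = mset (take n a)"
      using mset_swap[of 0 "take n a" k] Suc.prems len by simp
    finally show "mset (take n ?a') = mset (take n a)" .
    show "?a' ! n = a ! n" using Suc.prems n_ge_1 by simp
  qed
  have 1: "?b[k := ?a' ! k] = replicate (Suc k) (a ! 0) @ drop (Suc k) a"
    using len Suc.prems Suc.hyps
    by (intro nth_equalityI) (auto simp: nth_list_update nth_append less_Suc_eq simp del: replicate_Suc)
  have "boxA n ?b * boxA n a
     - boxA n (replicate (Suc k) (a ! 0) @ drop (Suc k) a) * boxA n (?a'[k := ?b ! k]) \<in> I"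
    using swap[OF b a', of k] Suc.prems unfolding 1 perm by simp
  then have "(boxA n ?b * boxA n a) * s
     - (boxA n (replicate (Suc k) (a ! 0) @ drop (Suc k) a) * boxA n (?a'[k := ?b ! k])) * s \<in> I"
    by (intro ideal_cong_mult_right ideal)
  moreover have "boxA n a ^ k * boxA n a - (boxA n ?b * s) * boxA n a \<in> I"
    using s by (intro ideal_cong_mult_right ideal)
  then have "boxA n a ^ Suc k - (boxA n ?b * boxA n a) * s \<in> I" by (simp add: algebra_simps)
  ultimately have "boxA n a ^ Suc k
     - (boxA n (replicate (Suc k) (a ! 0) @ drop (Suc k) a) * boxA n (?a'[k := ?b ! k])) * s \<in> I"
    using ideal_cong_trans[OF ideal] by blast
  then show ?case unfolding mult.assoc by blast
qed

lemma to_constant: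
  assumes "a \<in> B"
  shows "\<exists>c s. c \<in> {1, 2, 3} \<and> boxA n a ^ n - boxA n (replicate n c @ [a ! n]) * s \<in> I"
proof -
  have "drop n a = [a ! n]" using assms by (simp add: box_iff Cons_nth_drop_Suc[symmetric])
  moreover have "a ! 0 \<in> {1, 2, 3}" using assms n_ge_1 by (simp add: box_iff)
  ultimately show ?thesis
    using to_constant_aux[OF assms n_ge_1 order_refl] by metis
qed

lemma Var_eq_boxA:
  assumes "v \<in> XV ((n + 2) choose 2) d" shows "\<exists>a\<in>B. Var v = boxA n a"
proof -
  obtain i j where v: "v = (i, j)" "i \<in> {1..(n + 2) choose 2}" "j \<in> {1..d+1}"
    using assms by (auto simp: XV_def)
  obtain xs where xs: "set xs \<subseteq> {1, 2, 3}" "length xs = n" "cnt xs = lex_exps n ! (i - 1)"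
    using cnt_surj[OF lex_exps_in[OF v(2)]] by blast
  have "Var v = boxA n (xs @ [j])"
    using idx_lex_exps[OF v(2)] v(1) xs(2,3) by (auto simp: boxA_def nth_append)
  moreover have "xs ! l \<in> {1, 2, 3}" if "l < n" for l
    using xs(1,2) that by (metis nth_mem subsetD)
  then have "xs @ [j] \<in> B"
    using v(3) xs(2) unfolding box_iff by (auto simp: nth_append)
  ultimately show ?thesis by blast
qed

text \<open>A power of any coordinate is, modulo I, a multiple of a coordinate with constant word.
  The charts of these coordinates therefore suffice.\<close>

lemma saturate_from_constant:
  assumes "\<And>c j. c \<in> {1, 2, 3} \<Longrightarrow> j \<in> {1..d+1} \<Longrightarrow> \<exists>K. boxA n (replicate n c @ [j]) ^ K * f \<in> I"
    and "v \<in> XV ((n + 2) choose 2) d"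
  shows "\<exists>K. Var v ^ K * f \<in> I"
proof -
  obtain a where a: "a \<in> B" "Var v = (boxA n a :: (nat \<times> nat, 'k) mpoly)" using Var_eq_boxA[OF assms(2)] by blast
  obtain c s where cs: "c \<in> {1, 2, 3}" "boxA n a ^ n - boxA n (replicate n c @ [a ! n]) * s \<in> I"
    using to_constant[OF a(1)] by blast
  obtain K where K: "boxA n (replicate n c @ [a ! n]) ^ K * f \<in> I"
    using assms(1)[OF cs(1), of "a ! n"] a(1) by (auto simp: box_iff)
  have "(boxA n a ^ n) ^ K * f - (boxA n (replicate n c @ [a ! n]) * s) ^ K * f \<in> I"
    by (intro ideal_cong_mult_right ideal_cong_power ideal cs)
  moreover have "(boxA n (replicate n c @ [a ! n]) * s) ^ K * f \<in> I"
    using ideal_mult[OF ideal K, of "s ^ K"] by (simp add: power_mult_distrib algebra_simps)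
  ultimately have "(boxA n a ^ n) ^ K * f \<in> I" by (rule ideal_cong_mem[OF ideal])
  then have "Var v ^ (n * K) * f \<in> I" by (simp only: a(2) power_mult)
  then show ?thesis by (rule exI)
qed

end

text \<open>A chart of the Segre-Veronese variety: away from the coordinate indexed by the base point,
  the variables \<open>w v\<close> and \<open>y j\<close> are recovered as the entries adjacent to the base point.\<close>

locale box_chart = box_ideal +
  fixes c j0 :: nat
  assumes c: "c \<in> {1, 2, 3}" and j0: "j0 \<in> {1..d+1}"
begin

definition base :: "nat list" where "base = replicate n c @ [j0]"

definition x0 :: "(nat \<times> nat, 'a) mpoly" where "x0 = boxA n base"

text \<open>Under the parametrization the image of w_v corresponds to
  \<open>w_v * w_c ^ (n - 1) * F j0\<close>, and \<open>Y j\<close> to \<open>w_c ^ n * F j\<close>,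
  where w_c is \<open>Var (c - 1)\<close>. The map is defined on all variables because it is later
  applied to syzygy cofactors that are not confined to k[W].\<close>

definition theta :: "(nat, 'a) mpoly \<Rightarrow> (nat \<times> nat, 'a) mpoly" where
  "theta = subst (\<lambda>v. boxA n (base[0 := Suc v]))"

definition Y :: "nat \<Rightarrow> (nat \<times> nat, 'a) mpoly" where "Y j = boxA n (base[n := j])"

lemma rhom_theta: "rhom theta" by (simp add: theta_def rhom_subst)

lemma base_B: "base \<in> B"
  using c j0 by (auto simp: box_iff base_def nth_append)

lemma theta_Var: "theta (Var v) = boxA n (base[0 := Suc v])"
  by (simp add: theta_def rhom_Const)

lemma theta_Const: "theta (Const s) = Const s"
  by (simp add: theta_def rhom_Const)

lemma theta_x0: "theta (Var (c - 1)) = x0"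
proof -
  have "base[0 := c] = base" unfolding base_def using n_ge_1 by (cases n) simp_all
  moreover have "Suc (c - 1) = c" using c by auto
  ultimately show ?thesis by (simp only: theta_Var x0_def)
qed

lemma boxA_update_base:
  assumes "l < n" shows "boxA n (base[l := x]) = boxA n (base[0 := x])"
proof (rule boxA_perm)
  have "mset ((replicate n c)[k := x]) = mset (replicate n c) - {#c#} + {#x#}" if "k < n" for k
    using that by (subst mset_update) simp_all
  then show "mset (take n (base[l := x])) = mset (take n (base[0 := x]))"
    using assms by (simp add: base_def list_update_append)
  show "base[l := x] ! n = base[0 := x] ! n" using assms by simp
qed

text \<open>On the chart a coordinate is, up to powers of \<open>x0\<close>, the product of a
  monomial in the plane coordinates and one fibre coordinate.\<close>

lemma chart_expand:
  assumes v: "(i, j) \<in> XV ((n + 2) choose 2) d"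
  shows "x0 ^ Suc n * Var (i, j) - x0 * (theta (z n i) * Y j) \<in> I"
proof -
  obtain a where a: "a \<in> B" "Var (i, j) = (boxA n a :: (nat \<times> nat, 'a) mpoly)" using Var_eq_boxA[OF v] by blast
  \<comment> \<open>Only an equality of polynomials is at hand; comparing coefficients recovers the
    index pair.\<close>
  have ij: "i = idx n (cnt (take n a))" "j = a ! n"
  proof -
    have "Poly_Mapping.lookup (Var (i, j) :: (nat \<times> nat, 'a) mpoly) (Poly_Mapping.single (i, j) 1) = 1"
      by (simp add: lookup_Var)
    then have "Poly_Mapping.single (i, j) (1::nat) = Poly_Mapping.single (idx n (cnt (take n a)), a ! n) 1"
      unfolding a(2) boxA_def lookup_Var by (simp split: if_splits)
    then have "(i, j) = (idx n (cnt (take n a)), a ! n)"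
      by (metis lookup_single_eq lookup_single_not_eq one_neq_zero)
    then show "i = idx n (cnt (take n a))" "j = a ! n" by simp_all
  qed
  have tk: "set (take n a) \<subseteq> {1, 2, 3}" "length (take n a) = n" using take_box[OF a(1)] by auto
  have ex: "cnt (take n a) \<in> exps n" using cnt_take_box[OF a(1)] .
  have "theta (z n i) = theta (\<Prod>l<n. Var (a ! l - 1))"
    unfolding ij(1) z_idx[OF ex] emono_cnt[OF tk(1)] tk(2) by simp
  also have "\<dots> = (\<Prod>l<n. boxA n (base[l := a ! l]))"
    unfolding rhom_prod[OF rhom_theta]
  proof (rule prod.cong[OF refl])
    fix l assume "l \<in> {..<n}"
    then have l: "l < n" by simp
    then have "Suc (a ! l - 1) = a ! l" using a(1) by (auto simp: box_iff)
    then show "theta (Var (a ! l - 1)) = boxA n (base[l := a ! l])"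
      by (simp only: theta_Var boxA_update_base[OF l])
  qed
  finally have "theta (z n i) * Y j = (\<Prod>l<Suc n. boxA n (base[l := a ! l]))"
    by (simp add: Y_def ij(2))
  then show ?thesis using expand[OF base_B a(1)] by (simp add: a(2) x0_def)
qed

text \<open>This is the minor that exchanges the last coordinate of the two neighbours of the base
  point.\<close>

lemma chart_linear:
  assumes "v \<in> W" "j \<in> {1..d+1}"
  shows "theta (Var v) * Y j - x0 * Var (idx n (cnt (Suc v # replicate (n - 1) c)), j) \<in> I"
proof -
  have v: "Suc v \<in> {1, 2, 3}" using assms(1) by (auto simp: W_def)
  have len: "length base = Suc n" by (simp add: base_def)
  have a: "base[0 := Suc v] \<in> B" "base[n := j] \<in> B"
    using base_B v assms(2) n_ge_1 by (auto simp: box_iff nth_list_update)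
  have 1: "(base[0 := Suc v])[n := (base[n := j]) ! n] = (Suc v # replicate (n - 1) c) @ [j]"
    unfolding base_def using n_ge_1 by (cases n) (simp_all add: list_update_append nth_append)
  have 2: "(base[n := j])[n := (base[0 := Suc v]) ! n] = base"
    using n_ge_1 by (simp add: base_def nth_append list_update_append)
  have "boxA n ((Suc v # replicate (n - 1) c) @ [j])
      = (Var (idx n (cnt (Suc v # replicate (n - 1) c)), j) :: (nat \<times> nat, 'a) mpoly)"
    using n_ge_1 by (cases n) (simp_all add: boxA_def nth_append)
  then show ?thesis
    using swap[OF a, of n] unfolding 1 2 by (simp add: theta_Var Y_def x0_def mult.commute)
qed

end

section \<open>The blowup\<close>

lemma lookup_Const_mult: "Poly_Mapping.lookup (Const c * p) m = c * Poly_Mapping.lookup p m"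
  for p :: "('v, 'k::comm_ring_1) mpoly"
proof (induction p rule: single_induct)
  case (single m' x)
  show ?case by (simp add: Const_def mult_single lookup_single when_def)
qed (simp_all add: distrib_left lookup_add)

text \<open>The linear extension in p of the assignment of x_ij to z_i: the linear form that the
  parametrization sends to \<open>p * F j\<close> when p has degree n.\<close>

definition lin :: "nat \<Rightarrow> (nat, 'k::comm_ring_1) mpoly \<Rightarrow> nat \<Rightarrow> (nat \<times> nat, 'k) mpoly" where
  "lin n p j = (\<Sum>e\<in>exps n. Const (Poly_Mapping.lookup p (emon e)) * Var (idx n e, j))"

lemma lin_sum: "lin n (\<Sum>i\<in>I. Const (c i) * p i) j = (\<Sum>i\<in>I. Const (c i) * lin n (p i) j)"
proof -
  have "lin n (\<Sum>i\<in>I. Const (c i) * p i) j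
      = (\<Sum>e\<in>exps n. \<Sum>i\<in>I. Const (c i) * (Const (Poly_Mapping.lookup (p i) (emon e)) * Var (idx n e, j)))"
    unfolding lin_def lookup_sum lookup_Const_mult rhom_sum[OF rhom_Const] Const_mult sum_distrib_right mult.assoc ..
  also have "\<dots> = (\<Sum>i\<in>I. Const (c i) * lin n (p i) j)"
    unfolding lin_def sum_distrib_left by (rule sum.swap)
  finally show ?thesis .
qed

lemma lin_emono:
  assumes "e \<in> exps n" shows "lin n (emono e) j = (Var (idx n e, j) :: (nat \<times> nat, 'k::comm_ring_1) mpoly)"
proof -
  have "lin n (emono e) j = (\<Sum>e'\<in>exps n. if e' = e then Var (idx n e', j) else 0 :: (nat \<times> nat, 'k) mpoly)"
    unfolding lin_def emono_eq_mon_eval mon_eval_Var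
    by (intro sum.cong refl) (auto simp: lookup_single when_def inj_eq[OF inj_emon] Const_0 Const_1)
  then show ?thesis using assms finite_exps by simp
qed

lemma lin_in: "j \<in> {1..d+1} \<Longrightarrow> lin n p j \<in> polys_in (XV ((n + 2) choose 2) d)"
  unfolding lin_def using idx_in by (intro polys_in_sum polys_in_mult polys_in_Const polys_in_Var) (auto simp: XV_def)

lemma lin_homog: "homog 1 (lin n p j)"
  unfolding lin_def
proof (rule homog_sum)
  fix e
  show "homog 1 (Const (Poly_Mapping.lookup p (emon e)) * Var (idx n e, j))"
    using homog_mult[OF homog_Const homog_Var] by (metis add_0)
qed

lemma subst_lin:
  assumes "p \<in> polys_in W" "homog n p"
  shows "subst (\<lambda>(i, j). z n i * G j) (lin n p j) = p * G j"
proof -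
  have "subst (\<lambda>(i, j). z n i * G j) (lin n p j)
      = (\<Sum>e\<in>exps n. Const (Poly_Mapping.lookup p (emon e)) * (z n (idx n e) * G j))"
    by (simp add: lin_def rhom_sum[OF rhom_subst] rhom_mult[OF rhom_subst] rhom_Const)
  also have "\<dots> = (\<Sum>e\<in>exps n. smul (Poly_Mapping.lookup p (emon e)) (emono e) * G j)"
    by (intro sum.cong refl) (simp only: z_idx smul_def mult.assoc)
  also have "\<dots> = p * G j"
    unfolding sum_distrib_right[symmetric] homog_expand[OF assms, symmetric] ..
  finally show ?thesis .
qed

section \<open>Polynomials evaluated on a pencil, as binary forms\<close>

lemma binary_form_step:
  fixes x y :: "'a::comm_ring_1"
  shows "(\<Sum>r\<le>k. G r * S ^ (k - r) * T ^ r) * (x * S + y * T)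
    = (\<Sum>r\<le>Suc k. ((if r \<le> k then G r * x else 0) + (if r = 0 then 0 else G (r - 1) * y)) * S ^ (Suc k - r) * T ^ r)"
proof -
  have "(\<Sum>r\<le>Suc k. (if r \<le> k then G r * x else 0) * S ^ (Suc k - r) * T ^ r)
      = (\<Sum>r\<le>k. G r * S ^ (k - r) * T ^ r) * (x * S)"
    unfolding sum_distrib_right by (simp, intro sum.cong refl) (simp add: Suc_diff_le algebra_simps)
  moreover have "(\<Sum>r\<le>Suc k. (if r = 0 then 0 else G (r - 1) * y) * S ^ (Suc k - r) * T ^ r)
      = (\<Sum>r\<le>k. G r * S ^ (k - r) * T ^ r) * (y * T)"
    unfolding sum_distrib_right sum.atMost_Suc_shift by (simp add: algebra_simps)
  ultimately show ?thesis
    by (simp only: distrib_right distrib_left sum.distrib)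
qed

lemma mdeg_Suc_split:
  assumes "mdeg m = Suc k"
  shows "\<exists>v m'. m = m' + Poly_Mapping.single v 1 \<and> mdeg m' = k"
proof -
  have "Poly_Mapping.keys m \<noteq> {}" using assms by (auto simp: mdeg_def)
  then obtain v where v: "v \<in> Poly_Mapping.keys m" by blast
  define m' where "m' = m - Poly_Mapping.single v 1"
  have m: "m = m' + Poly_Mapping.single v 1"
    using v by (intro poly_mapping_eqI)
      (auto simp: m'_def lookup_add lookup_minus lookup_single when_def in_keys_iff)
  moreover have "mdeg m' = k" using arg_cong[OF m, of mdeg] assms by (simp add: mdeg_add)
  ultimately show ?thesis by blast
qed

text \<open>The point is that the coefficients do not depend on S and T and that the same ones,
  pushed through \<open>th\<close>, serve in the target ring. Induction on the degree multiplies by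
  one linear factor at a time.\<close>

lemma mon_eval_binary_form:
  fixes th :: "'r::comm_ring_1 \<Rightarrow> 's::comm_ring_1"
  assumes "rhom th"
  shows "\<exists>G. (\<forall>S T. mon_eval (\<lambda>v. a v * S + b v * T) m = (\<Sum>r\<le>mdeg m. G r * S ^ (mdeg m - r) * T ^ r))
    \<and> (\<forall>S T. mon_eval (\<lambda>v. th (a v) * S + th (b v) * T) m = (\<Sum>r\<le>mdeg m. th (G r) * S ^ (mdeg m - r) * T ^ r))"
proof (induction "mdeg m" arbitrary: m)
  case 0
  then have "Poly_Mapping.lookup m v = 0" for v
    by (cases "v \<in> Poly_Mapping.keys m") (auto simp: mdeg_def in_keys_iff)
  then have "m = 0" by (intro poly_mapping_eqI) simp
  then show ?case by (intro exI[of _ "\<lambda>_. 1"]) (simp add: rhom_one[OF assms])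
next
  case (Suc k)
  obtain v m' where m: "m = m' + Poly_Mapping.single v 1" "mdeg m' = k"
    using mdeg_Suc_split[of m k] Suc.hyps by auto
  have mdeg_m: "mdeg m = Suc k" using Suc.hyps by simp
  obtain G where G: "\<And>S T. mon_eval (\<lambda>v. a v * S + b v * T) m' = (\<Sum>r\<le>k. G r * S ^ (k - r) * T ^ r)"
    "\<And>S T. mon_eval (\<lambda>v. th (a v) * S + th (b v) * T) m' = (\<Sum>r\<le>k. th (G r) * S ^ (k - r) * T ^ r)"
    using Suc.hyps(1)[of m'] m(2) by blast
  let ?G = "\<lambda>r. (if r \<le> k then G r * a v else 0) + (if r = 0 then 0 else G (r - 1) * b v)"
  have th: "th (?G r) = (if r \<le> k then th (G r) * th (a v) else 0) + (if r = 0 then 0 else th (G (r - 1)) * th (b v))" for r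
    by (simp add: rhom_add[OF assms] rhom_mult[OF assms] rhom_zero[OF assms])
  show ?case
    unfolding mdeg_m
    by (rule exI[of _ ?G]) (simp only: m(1) mon_eval_add G mon_eval_single power_one_right binary_form_step th simp_thms)
qed

lemma subst_binary_form:
  fixes a b :: "'v \<Rightarrow> ('u, 'k::comm_ring_1) mpoly" and th :: "('u, 'k) mpoly \<Rightarrow> ('w, 'k) mpoly"
  assumes th: "rhom th" "\<And>c. th (Const c) = Const c" and f: "homog k f"
  shows "\<exists>G. (\<forall>S T. subst (\<lambda>v. a v * S + b v * T) f = (\<Sum>r\<le>k. G r * S ^ (k - r) * T ^ r))
    \<and> (\<forall>S T. subst (\<lambda>v. th (a v) * S + th (b v) * T) f = (\<Sum>r\<le>k. th (G r) * S ^ (k - r) * T ^ r))"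
proof -
  obtain G where G: "\<And>m S T. mon_eval (\<lambda>v. a v * S + b v * T) m = (\<Sum>r\<le>mdeg m. G m r * S ^ (mdeg m - r) * T ^ r)"
    "\<And>m S T. mon_eval (\<lambda>v. th (a v) * S + th (b v) * T) m = (\<Sum>r\<le>mdeg m. th (G m r) * S ^ (mdeg m - r) * T ^ r)"
    using choice[of "\<lambda>m G. (\<forall>S T. mon_eval (\<lambda>v. a v * S + b v * T) m = (\<Sum>r\<le>mdeg m. G r * S ^ (mdeg m - r) * T ^ r))
      \<and> (\<forall>S T. mon_eval (\<lambda>v. th (a v) * S + th (b v) * T) m = (\<Sum>r\<le>mdeg m. th (G r) * S ^ (mdeg m - r) * T ^ r))"]
      mon_eval_binary_form[OF th(1), of a b] by blast
  define H where "H r = (\<Sum>m\<in>Poly_Mapping.keys f. Const (Poly_Mapping.lookup f m) * G m r)" for r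
  have swap: "(\<Sum>m\<in>Poly_Mapping.keys f. Const (Poly_Mapping.lookup f m) * (\<Sum>r\<le>mdeg m. g m r * S ^ (mdeg m - r) * T ^ r))
      = (\<Sum>r\<le>k. (\<Sum>m\<in>Poly_Mapping.keys f. Const (Poly_Mapping.lookup f m) * g m r) * S ^ (k - r) * T ^ r)"
    for g :: "_ \<Rightarrow> _ \<Rightarrow> ('x, 'k) mpoly" and S T
  proof -
    have "(\<Sum>m\<in>Poly_Mapping.keys f. Const (Poly_Mapping.lookup f m) * (\<Sum>r\<le>mdeg m. g m r * S ^ (mdeg m - r) * T ^ r))
        = (\<Sum>m\<in>Poly_Mapping.keys f. \<Sum>r\<le>k. Const (Poly_Mapping.lookup f m) * g m r * S ^ (k - r) * T ^ r)"
      using f by (intro sum.cong refl) (simp add: homog_def sum_distrib_left mult.assoc)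
    also have "\<dots> = (\<Sum>r\<le>k. (\<Sum>m\<in>Poly_Mapping.keys f. Const (Poly_Mapping.lookup f m) * g m r) * S ^ (k - r) * T ^ r)"
      unfolding sum_distrib_right by (rule sum.swap)
    finally show ?thesis .
  qed
  have thH: "th (H r) = (\<Sum>m\<in>Poly_Mapping.keys f. Const (Poly_Mapping.lookup f m) * th (G m r))" for r
    by (simp add: H_def rhom_sum[OF th(1)] rhom_mult[OF th(1)] th(2))
  have 1: "subst (\<lambda>v. a v * S + b v * T) f = (\<Sum>r\<le>k. H r * S ^ (k - r) * T ^ r)" for S T
    unfolding ev_def G swap H_def ..
  have 2: "subst (\<lambda>v. th (a v) * S + th (b v) * T) f = (\<Sum>r\<le>k. th (H r) * S ^ (k - r) * T ^ r)" for S T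
    unfolding ev_def G swap thH ..
  show ?thesis using 1 2 by blast
qed

lemma linear_expand:
  fixes p :: "(nat, 'k::comm_ring_1) mpoly"
  assumes "p \<in> polys_in W" "homog 1 p"
  shows "\<exists>c. p = (\<Sum>v\<in>W. Const (c v) * Var v)"
proof -
  have "exps 1 = {(1, 0, 0), (0, 1, 0), (0, 0, 1)}"
    by (auto simp: exps_def add_is_1)
  then have "p = smul (Poly_Mapping.lookup p (emon (1, 0, 0))) (Var 0) + (smul (Poly_Mapping.lookup p (emon (0, 1, 0))) (Var 1)
     + smul (Poly_Mapping.lookup p (emon (0, 0, 1))) (Var 2))"
    using homog_expand[OF assms] by (simp add: mono3_def)
  then have "p = (\<Sum>v\<in>W. Const ((\<lambda>v. if v = 0 then Poly_Mapping.lookup p (emon (1, 0, 0))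
     else if v = 1 then Poly_Mapping.lookup p (emon (0, 1, 0)) else Poly_Mapping.lookup p (emon (0, 0, 1))) v) * Var v)"
    by (simp add: W_def smul_def)
  then show ?thesis by (rule exI[of "\<lambda>c. p = (\<Sum>v\<in>W. Const (c v) * Var v)"])
qed

text \<open>Vanishing at (al, be) writes the coefficients as consecutive differences. After
  \<open>th\<close> the sum telescopes into multiples of the single relation
  \<open>th be * S - th al * T\<close>, so vanishing in one ring becomes membership in the
  other.\<close>

lemma binary_form_in_ideal:
  fixes al be :: "'r::idom" and th :: "'r \<Rightarrow> 's::comm_ring_1"
  assumes th: "rhom th" and I: "is_ideal I" and "al \<noteq> 0" and cop: "\<And>x. al dvd be * x \<Longrightarrow> al dvd x"
    and G: "(\<Sum>r\<le>k. G r * al ^ (k - r) * be ^ r) = 0"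
    and mem: "th be * S - th al * T \<in> I"
  shows "(\<Sum>r\<le>k. th (G r) * S ^ (k - r) * T ^ r) \<in> I"
proof -
  obtain q where q: "q 0 = 0" "q (Suc k) = 0" "\<forall>r\<le>k. G r = be * q (Suc r) - al * q r"
    using syzygy_of_powers[OF assms(3) cop G] by blast
  have q0: "th (q 0) = 0" "th (q (Suc k)) = 0" by (simp_all add: q rhom_zero[OF th])
  have "(\<Sum>r\<le>k. th (G r) * S ^ (k - r) * T ^ r)
      = (\<Sum>r\<le>k. th (q (Suc r)) * th be * S ^ (k - r) * T ^ r - th (q r) * th al * S ^ (k - r) * T ^ r)"
  proof (intro sum.cong refl)
    fix r assume "r \<in> {..k}"
    then have eq: "th (G r) = th be * th (q (Suc r)) - th al * th (q r)"
      using q(3) by (simp add: rhom_minus[OF th] rhom_mult[OF th])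
    show "th (G r) * S ^ (k - r) * T ^ r
        = th (q (Suc r)) * th be * S ^ (k - r) * T ^ r - th (q r) * th al * S ^ (k - r) * T ^ r"
      unfolding eq by (simp add: algebra_simps)
  qed
  also have "\<dots> = (\<Sum>r<k. th (q (Suc r)) * th be * S ^ (k - r) * T ^ r)
      - (\<Sum>r<k. th (q (Suc r)) * th al * S ^ (k - Suc r) * T ^ Suc r)"
  proof -
    have "(\<Sum>r\<le>k. th (q (Suc r)) * th be * S ^ (k - r) * T ^ r) = (\<Sum>r<k. th (q (Suc r)) * th be * S ^ (k - r) * T ^ r)"
      by (simp add: lessThan_Suc_atMost[symmetric] q0)
    moreover have "(\<Sum>r\<le>k. th (q r) * th al * S ^ (k - r) * T ^ r) = (\<Sum>r<k. th (q (Suc r)) * th al * S ^ (k - Suc r) * T ^ Suc r)"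
      unfolding lessThan_Suc_atMost[symmetric] sum.lessThan_Suc_shift by (simp add: q0)
    ultimately show ?thesis by (simp only: sum_subtractf)
  qed
  also have "\<dots> = (\<Sum>r<k. (th (q (Suc r)) * S ^ (k - Suc r) * T ^ r) * (th be * S - th al * T))"
    unfolding sum_subtractf[symmetric]
  proof (intro sum.cong refl)
    fix r assume "r \<in> {..<k}"
    then have "k - r = Suc (k - Suc r)" by auto
    then show "th (q (Suc r)) * th be * S ^ (k - r) * T ^ r - th (q (Suc r)) * th al * S ^ (k - Suc r) * T ^ Suc r
       = (th (q (Suc r)) * S ^ (k - Suc r) * T ^ r) * (th be * S - th al * T)"
      by (simp add: algebra_simps)
  qed
  also have "\<dots> \<in> I" by (intro ideal_sum ideal_mult I mem)
  finally show ?thesis .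
qed

locale blowup = plane_points d X F J
  for d :: nat and X :: "(nat \<Rightarrow> 'k::field_char_0) set" and F :: "nat \<Rightarrow> (nat, 'k) mpoly" and J :: "nat set" +
  fixes n :: nat and M :: "nat \<Rightarrow> nat \<Rightarrow> (nat, 'k) mpoly"
  assumes n_pos: "n \<ge> 1" and J_eq: "J = {1..d+1}"
    and M_in: "M k j \<in> polys_in W" and M_homog: "homog 1 (M k j)"
    and M_syz: "k < d \<Longrightarrow> (\<Sum>j\<in>J. M k j * F j) = 0"
    and M_gen: "(\<Sum>j\<in>J. s j * F j) = 0 \<Longrightarrow> \<exists>q. \<forall>j\<in>J. s j = (\<Sum>k<d. q k * M k j)"
    and M_indep: "\<forall>j\<in>J. (\<Sum>k<d. q k * M k j) = 0 \<Longrightarrow> \<forall>k<d. q k = 0"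
begin

abbreviation "V \<equiv> XV ((n + 2) choose 2) d"

text \<open>Row k of M times a monomial of degree n - 1, read as a linear form in the x_ij.\<close>

definition Lf :: "(nat \<times> nat \<times> nat) \<times> nat \<Rightarrow> (nat \<times> nat, 'k) mpoly" where
  "Lf = (\<lambda>(e, k). \<Sum>j\<in>J. lin n (emono e * M k j) j)"

lemma Lf_in: "Lf b \<in> polys_in V"
proof (cases b)
  case (Pair e k)
  have "lin n (emono e * M k j) j \<in> polys_in V" if "j \<in> J" for j
    using that by (intro lin_in) (simp add: J_eq)
  then show ?thesis unfolding Lf_def Pair prod.case by (rule polys_in_sum)
qed

lemma Lf_homog: "homog 1 (Lf b)"
  unfolding Lf_def by (cases b) (simp add: homog_sum lin_homog del: One_nat_def)

lemma emono_M: "e \<in> exps (n - 1) \<Longrightarrow> emono e * M k j \<in> polys_in W \<and> homog n (emono e * M k j)"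
  using homog_mult[OF emono_homog M_homog, of e "n - 1" k j] n_pos
  by (simp add: polys_in_mult emono_in M_in del: One_nat_def)

text \<open>The vector G is arbitrary: G = F gives the vanishing on the image, while a unit vector
  isolates one column of M for the proof of independence.\<close>

lemma subst_Lf:
  assumes "e \<in> exps (n - 1)"
  shows "subst (\<lambda>(i, j). z n i * G j) (Lf (e, k)) = emono e * (\<Sum>j\<in>J. M k j * G j)"
  using emono_M[OF assms] by (simp add: Lf_def rhom_sum[OF rhom_subst] subst_lin sum_distrib_left mult.assoc)

lemma Lf_indep:
  assumes "(\<Sum>b\<in>exps (n - 1) \<times> {..<d}. smul (c b) (Lf b)) = 0" "b \<in> exps (n - 1) \<times> {..<d}"
  shows "c b = 0"
proof -
  obtain e0 k0 where b: "b = (e0, k0)" "e0 \<in> exps (n - 1)" "k0 < d" using assms(2) by auto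
  define q where "q k = (\<Sum>e\<in>exps (n - 1). smul (c (e, k)) (emono e))" for k
  have "(\<Sum>k<d. q k * M k j) = 0" if j: "j \<in> J" for j
  proof -
    let ?G = "\<lambda>j'. if j' = j then 1 else 0 :: (nat, 'k) mpoly"
    have G: "(\<Sum>j'\<in>J. M k j' * ?G j') = M k j" for k
    proof -
      have "(\<Sum>j'\<in>J. M k j' * ?G j') = (\<Sum>j'\<in>J. if j' = j then M k j' else 0)"
        by (intro sum.cong refl) simp
      then show ?thesis using j finJ by simp
    qed
    have "0 = subst (\<lambda>(i, j). z n i * ?G j) (\<Sum>b\<in>exps (n - 1) \<times> {..<d}. smul (c b) (Lf b))"
      unfolding assms(1) by simp
    also have "\<dots> = (\<Sum>b\<in>exps (n - 1) \<times> {..<d}. smul (c b) (emono (fst b) * M (snd b) j))"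
      unfolding rhom_sum[OF rhom_subst] subst_smul
      by (intro sum.cong refl) (auto simp: subst_Lf G simp del: split_paired_All)
    also have "\<dots> = (\<Sum>e\<in>exps (n - 1). \<Sum>k<d. smul (c (e, k)) (emono e * M k j))"
      by (simp add: sum.cartesian_product split_def)
    also have "\<dots> = (\<Sum>k<d. \<Sum>e\<in>exps (n - 1). smul (c (e, k)) (emono e * M k j))"
      by (rule sum.swap)
    also have "\<dots> = (\<Sum>k<d. q k * M k j)"
      by (simp only: q_def sum_distrib_right smul_def mult.assoc)
    finally show ?thesis by simp
  qed
  then have "q k0 = 0" using M_indep b(3) by blast
  then show ?thesis unfolding q_def b(1) by (rule emono_sum_eq_0[OF _ b(2)])
qed

section \<open>The parametrization and the easy inclusion\<close>

definition phi :: "(nat \<times> nat, 'k) mpoly \<Rightarrow> (nat, 'k) mpoly" where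
  "phi = subst (\<lambda>(i, j). z n i * F j)"

lemma rhom_phi: "rhom phi" by (simp add: phi_def rhom_subst)

lemma phi_Lf: "e \<in> exps (n - 1) \<Longrightarrow> k < d \<Longrightarrow> phi (Lf (e, k)) = 0"
  by (simp add: phi_def subst_Lf M_syz)

lemma F_W: "j \<in> J \<Longrightarrow> F j \<in> polys_in W" and F_homog: "j \<in> J \<Longrightarrow> homog d (F j)"
  using F_in by (auto simp: I_comp_def)

lemma z_in: "z n i \<in> polys_in W"
  unfolding z_eq by (rule emono_in)

lemma z_homog: "i \<in> {1..(n + 2) choose 2} \<Longrightarrow> homog n (z n i)"
  unfolding z_eq by (rule emono_homog[OF lex_exps_in])

lemma phi_in: "f \<in> polys_in V \<Longrightarrow> phi f \<in> polys_in W"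
  unfolding phi_def by (erule polys_in_subst) (auto simp: XV_def J_eq intro!: polys_in_mult z_in F_W)

lemma phi_homog:
  assumes "f \<in> polys_in V" "homog k f" shows "homog (k * (n + d)) (phi f)"
  unfolding phi_def
proof (rule homog_subst[OF assms(2,1)])
  fix v assume "v \<in> V"
  then obtain i j where "v = (i, j)" "i \<in> {1..(n + 2) choose 2}" "j \<in> J" by (auto simp: XV_def J_eq)
  then show "homog (n + d) (case v of (i, j) \<Rightarrow> z n i * F j)"
    using homog_mult[OF z_homog F_homog] by simp
qed

lemma image_ideal_eq: "image_ideal n d F = {f \<in> polys_in V. phi f = 0}"
proof -
  have "(\<forall>w. peval (\<lambda>(i, j). peval w (z n i * F j)) f = 0) \<longleftrightarrow> phi f = 0" if "f \<in> polys_in V" for f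
  proof -
    have "peval (\<lambda>(i, j). peval w (z n i * F j)) f = peval w (phi f)" for w
      unfolding phi_def peval_subst by (simp add: split_def)
    then show ?thesis
      using mpoly_eq_0_if_peval_eq_0[OF phi_in[OF that]] rhom_zero[OF rhom_peval] by auto
  qed
  then show ?thesis by (auto simp: image_ideal_def)
qed

text \<open>One factor for each of the n + 1 box coordinates. Exchanging one coordinate between two
  indices only exchanges factors, so every minor maps to zero.\<close>

lemma phi_boxA:
  assumes "a \<in> box n d"
  shows "phi (boxA n a) = (\<Prod>l<Suc n. if l < n then Var (a ! l - 1) else F (a ! l))"
proof -
  have tk: "set (take n a) \<subseteq> {1, 2, 3}" "length (take n a) = n" using take_box[OF assms] by auto
  have "phi (boxA n a) = emono (cnt (take n a)) * F (a ! n)"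
    unfolding z_idx[OF cnt_take_box[OF assms], symmetric] by (simp add: phi_def boxA_def rhom_Const)
  also have "\<dots> = (\<Prod>l<n. Var (a ! l - 1)) * F (a ! n)"
    unfolding emono_cnt[OF tk(1)] tk(2) by simp
  finally show ?thesis by simp
qed

lemma minorE:
  assumes "g \<in> box_minors (replicate n 3 @ [d + 1]) (boxA n)"
  obtains a b l where "g = boxA n a * boxA n b - boxA n (a[l := b ! l]) * boxA n (b[l := a ! l])"
    "a \<in> box n d" "b \<in> box n d" "l \<le> n"
  using assms unfolding box_minors_def box_def by (auto simp: less_Suc_eq_le)

lemma phi_minor:
  assumes "g \<in> box_minors (replicate n 3 @ [d + 1]) (boxA n)" shows "phi g = 0"
  using assms
proof (rule minorE)
  fix a b l
  assume g: "g = boxA n a * boxA n b - boxA n (a[l := b ! l]) * boxA n (b[l := a ! l])"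
    and ab: "a \<in> box n d" "b \<in> box n d" and l: "l \<le> n"
  have len: "length a = Suc n" "length b = Suc n" using ab by (simp_all add: box_iff)
  show ?thesis
    unfolding g rhom_minus[OF rhom_phi] rhom_mult[OF rhom_phi] phi_boxA[OF ab(1)] phi_boxA[OF ab(2)]
      phi_boxA[OF update_box[OF ab l]] phi_boxA[OF update_box[OF ab(2,1) l]] prod.distrib[symmetric] right_minus_eq
    using len l by (intro prod.cong refl) (auto simp: nth_list_update mult.commute)
qed

definition gens :: "(nat \<times> nat, 'k) mpoly set" where
  "gens = Lf ` (exps (n - 1) \<times> {..<d}) \<union> box_minors (replicate n 3 @ [d + 1]) (boxA n)"

lemma boxA_in: "a \<in> box n d \<Longrightarrow> boxA n a \<in> polys_in V"
  unfolding boxA_def using idx_in[OF cnt_take_box] by (intro polys_in_Var) (auto simp: XV_def box_iff)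

lemma gens_in: "gens \<subseteq> polys_in V"
proof -
  have "g \<in> polys_in V" if "g \<in> box_minors (replicate n 3 @ [d + 1]) (boxA n)" for g :: "(nat \<times> nat, 'k) mpoly"
    using that
  proof (rule minorE)
    fix a b l
    assume g: "g = boxA n a * boxA n b - boxA n (a[l := b ! l]) * boxA n (b[l := a ! l])"
      and ab: "a \<in> box n d" "b \<in> box n d" "l \<le> n"
    show "g \<in> polys_in V"
      unfolding g using ab by (intro polys_in_minus polys_in_mult boxA_in update_box)
  qed
  then show ?thesis using Lf_in by (auto simp: gens_def)
qed

lemma phi_ideal_gen: "f \<in> ideal_gen U gens \<Longrightarrow> phi f = 0"
proof -
  have "is_ideal {f. phi f = 0}"
    by (simp add: is_ideal_def rhom_zero[OF rhom_phi] rhom_add[OF rhom_phi] rhom_mult[OF rhom_phi])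
  moreover have "gens \<subseteq> {f. phi f = 0}" by (auto simp: gens_def phi_Lf phi_minor)
  ultimately show "f \<in> ideal_gen U gens \<Longrightarrow> phi f = 0" using ideal_gen_least by blast
qed

lemma F_neq_0: "j \<in> J \<Longrightarrow> F j \<noteq> 0"
proof
  assume j: "j \<in> J" and "F j = 0"
  then have "(\<Sum>i\<in>J. Const (if i = j then 1 else 0) * F i) = 0"
    by (intro sum.neutral) (simp add: Const_0)
  from F_indep[OF this j] show False by simp
qed

text \<open>One variable suffices: the image z_1 F_1 of x_11 is nonzero in a domain and can be
  cancelled.\<close>

lemma saturation_subset: "saturation V (ideal_gen V gens) \<subseteq> image_ideal n d F"
proof
  fix f assume f: "f \<in> saturation V (ideal_gen V gens)"
  then obtain k where fV: "f \<in> polys_in V" and k: "\<forall>v\<in>V. Var v ^ k * f \<in> ideal_gen V gens"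
    by (auto simp: saturation_def)
  have "(1::nat) \<le> (n + 2) choose 2" using zero_less_binomial[of 2 "n + 2"] by linarith
  then have v: "(1, 1) \<in> V" "1 \<in> J" by (auto simp: XV_def J_eq)
  have "phi (Var (1, 1) ^ k * f) = 0" using k v(1) phi_ideal_gen by blast
  then have "(z n 1 * F 1) ^ k * phi f = 0"
    by (simp add: rhom_mult[OF rhom_phi] rhom_power[OF rhom_phi]) (simp add: phi_def rhom_Const)
  moreover have "z n 1 \<noteq> (0 :: (nat, 'k) mpoly)"
    unfolding z_eq emono_eq_mon_eval mon_eval_Var by (metis lookup_single_eq lookup_zero zero_neq_one)
  ultimately have "phi f = 0" using F_neq_0[OF v(2)] by simp
  then show "f \<in> image_ideal n d F" using fV by (simp add: image_ideal_eq)
qed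

end

locale blowup_chart = blowup d X F J n M + box_chart n d "ideal_gen UNIV gens" c j0
  for d X F J n M c j0
begin

abbreviation "I \<equiv> ideal_gen UNIV gens"

text \<open>Linear extension of \<open>chart_linear\<close>; the word of n - 1 letters c stands for
  the monomial w_c^(n - 1).\<close>

lemma chart_linear_form:
  assumes p: "p \<in> polys_in W" "homog 1 p" and j: "j \<in> J"
  shows "theta p * Y j - x0 * lin n (emono (cnt (replicate (n - 1) c)) * p) j \<in> I"
proof -
  obtain u where u: "p = (\<Sum>v\<in>W. Const (u v) * Var v)" using linear_expand[OF p] by blast
  have lin_v: "lin n (emono (cnt (replicate (n - 1) c)) * Var v) j
      = (Var (idx n (cnt (Suc v # replicate (n - 1) c)), j) :: (nat \<times> nat, 'a) mpoly)" if "v \<in> W" for v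
  proof -
    let ?xs = "replicate (n - 1) c"
    have xs: "set ?xs \<subseteq> {1, 2, 3}" "set (Suc v # ?xs) \<subseteq> {1, 2, 3}"
      using c that by (auto simp: W_def)
    have eq: "emono (cnt ?xs) * Var v = (emono (cnt (Suc v # ?xs)) :: (nat, 'a) mpoly)"
      unfolding emono_cnt[OF xs(1)] emono_cnt[OF xs(2)]
      by (simp add: prod.lessThan_Suc_shift mult.commute del: prod.lessThan_Suc)
    have "cnt (Suc v # ?xs) \<in> exps n" using cnt_exps[OF xs(2)] n_pos by simp
    then show ?thesis unfolding eq by (rule lin_emono)
  qed
  have "theta p * Y j = (\<Sum>v\<in>W. Const (u v) * (theta (Var v) * Y j))"
    unfolding u rhom_sum[OF rhom_theta] rhom_mult[OF rhom_theta] theta_Const sum_distrib_right mult.assoc ..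
  moreover have "x0 * lin n (emono (cnt (replicate (n - 1) c)) * p) j
      = (\<Sum>v\<in>W. Const (u v) * (x0 * Var (idx n (cnt (Suc v # replicate (n - 1) c)), j)))"
  proof -
    have "emono (cnt (replicate (n - 1) c)) * p
        = (\<Sum>v\<in>W. Const (u v) * (emono (cnt (replicate (n - 1) c)) * Var v))"
      unfolding u sum_distrib_left by (intro sum.cong refl) (simp only: mult.left_commute)
    then have "lin n (emono (cnt (replicate (n - 1) c)) * p) j
        = (\<Sum>v\<in>W. Const (u v) * Var (idx n (cnt (Suc v # replicate (n - 1) c)), j))"
      by (simp only: lin_sum) (intro sum.cong refl, simp only: lin_v)
    then show ?thesis by (simp only: sum_distrib_left mult.left_commute)
  qed
  moreover have "(\<Sum>v\<in>W. Const (u v) * (theta (Var v) * Y j))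
      - (\<Sum>v\<in>W. Const (u v) * (x0 * Var (idx n (cnt (Suc v # replicate (n - 1) c)), j))) \<in> I"
    using j by (intro ideal_cong_sum ideal_cong_mult_left ideal chart_linear) (simp_all add: J_eq)
  ultimately show ?thesis by simp
qed

lemma M_chart:
  assumes "k < d" shows "(\<Sum>j\<in>J. theta (M k j) * Y j) \<in> I"
proof -
  let ?e = "cnt (replicate (n - 1) c)"
  have "set (replicate (n - 1) c) \<subseteq> {1, 2, 3}" using c by auto
  from cnt_exps[OF this] have e: "?e \<in> exps (n - 1)" by simp
  have "(\<Sum>j\<in>J. theta (M k j) * Y j) - (\<Sum>j\<in>J. x0 * lin n (emono ?e * M k j) j) \<in> I"
    by (intro ideal_cong_sum ideal chart_linear_form M_in M_homog)
  moreover have "(\<Sum>j\<in>J. x0 * lin n (emono ?e * M k j) j) = x0 * Lf (?e, k)"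
    by (simp add: Lf_def sum_distrib_left)
  moreover have "x0 * Lf (?e, k) \<in> I"
    using e assms by (intro ideal_mult[OF ideal] ideal_gen_incl) (auto simp: gens_def)
  ultimately show ?thesis using ideal_cong_mem[OF ideal] by simp
qed

text \<open>Every syzygy of the F_j becomes a relation of the fibre coordinates \<open>Y j\<close>
  modulo I. Completeness of M is what makes this available for the syzygies chosen near each
  point.\<close>

lemma syzygy_chart:
  assumes "(\<Sum>j\<in>J. s j * F j) = 0" shows "(\<Sum>j\<in>J. theta (s j) * Y j) \<in> I"
proof -
  obtain q where q: "\<forall>j\<in>J. s j = (\<Sum>k<d. q k * M k j)" using M_gen[OF assms] by blast
  have "(\<Sum>j\<in>J. theta (s j) * Y j) = (\<Sum>j\<in>J. \<Sum>k<d. theta (q k) * (theta (M k j) * Y j))"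
    using q by (intro sum.cong refl)
      (simp add: rhom_sum[OF rhom_theta] rhom_mult[OF rhom_theta] sum_distrib_right mult.assoc)
  also have "\<dots> = (\<Sum>k<d. theta (q k) * (\<Sum>j\<in>J. theta (M k j) * Y j))"
    unfolding sum_distrib_left by (rule sum.swap)
  also have "\<dots> \<in> I" by (intro ideal_sum ideal_mult ideal M_chart) simp
  finally show ?thesis .
qed

text \<open>The pullback of f along the chart, using \<open>theta\<close> for the plane coordinates
  and \<open>Y\<close> in place of the F_j.\<close>

definition Xi :: "(nat \<times> nat, 'a) mpoly \<Rightarrow> (nat \<times> nat, 'a) mpoly" where
  "Xi = subst (\<lambda>(i, j). theta (z n i) * Y j)"

text \<open>Multiplication by s plays the part of localization at P: it reduces the d + 1 fibre
  coordinates to \<open>Y1\<close> and \<open>Y2\<close>, the counterparts of \<open>al * s\<close>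
  and \<open>be * s\<close>, and turns f into a binary form in them.\<close>

lemma Xi_separator:
  assumes P: "P \<in> X" and s: "s \<in> polys_in W" "homog (d - 1) s" "\<forall>Q\<in>X. peval Q s = (if P = Q then 1 else 0)"
    and f: "f \<in> polys_in V" "homog k f" "phi f = 0"
  shows "theta s ^ k * Xi f \<in> I"
proof -
  obtain i where i: "i \<in> W" "P i \<noteq> 0" using proj P by (auto simp: proj_points_def)
  obtain j' k' where W: "W = {i, j', k'}" "j' \<noteq> i" "k' \<noteq> i" "j' \<noteq> k'"
  proof -
    consider "i = 0" | "i = 1" | "i = 2" using i(1) by (auto simp: W_def)
    then show ?thesis
    proof cases
      case 1 then show ?thesis using that[of 1 2] by (auto simp: W_def)
    next
      case 2 then show ?thesis using that[of 0 2] by (auto simp: W_def)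
    next
      case 3 then show ?thesis using that[of 0 1] by (auto simp: W_def)
    qed
  qed
  \<comment> \<open>This substitution restricts to the line in k^3 through the representative of P,
    parametrized by its nonzero coordinate i; \<open>al\<close> and \<open>be\<close> are the two
    remaining linear equations of P.\<close>
  define g where "g v = Const (P v / P i) * Var i" for v
  define al where "al = Var j' - g j'"
  define be where "be = Var k' - g k'"
  have lin_form: "Var v - g v \<in> polys_in W" "homog 1 (Var v - g v)" "peval P (Var v - g v) = 0" if "v \<in> W" for v
  proof -
    show "Var v - g v \<in> polys_in W" unfolding g_def using that i(1) by (intro polys_in_intros)
    show "homog 1 (Var v - g v)"
      unfolding g_def using homog_mult[OF homog_Const homog_Var, of "P v / P i" i]
      by (intro homog_minus homog_Var) simp
    show "peval P (Var v - g v) = 0"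
      using i(2) by (simp add: g_def rhom_minus[OF rhom_peval] rhom_mult[OF rhom_peval])
  qed
  \<comment> \<open>The linear factor vanishes at P, the factor s at the other points, and the
    degrees add up to d.\<close>
  have mult_s: "(Var v - g v) * s \<in> I_comp X d" if "v \<in> W" for v
    using lin_form[OF that] s homog_mult[OF lin_form(2)[OF that] s(2)] d_ge_1
    by (auto simp: I_comp_def polys_in_mult rhom_mult[OF rhom_peval])
  obtain p q where p: "al * s = (\<Sum>j\<in>J. Const (p j) * F j)" and q: "be * s = (\<Sum>j\<in>J. Const (q j) * F j)"
    using F_span[OF mult_s, of j'] F_span[OF mult_s, of k'] W(1) unfolding al_def be_def by auto

  have "\<exists>A B. F j = A * al + B * be" if j: "j \<in> J" for j
  proof -
    \<comment> \<open>By homogeneity the restriction of F j to the line is its value at P times a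
      scalar and a power of w_i.\<close>
    have zero: "subst g (F j) = 0"
    proof -
      have "subst g (F j) = subst (\<lambda>v. Var i * Const (P v / P i)) (F j)"
        by (simp add: g_def[abs_def] mult.commute)
      also have "\<dots> = Var i ^ d * subst (\<lambda>v. Const (P v / P i)) (F j)"
        by (rule ev_scale_homog[OF F_homog[OF j]])
      also have "subst (\<lambda>v. Const (P v / P i)) (F j) = Const (peval (\<lambda>v. (1 / P i) * P v) (F j))"
        unfolding peval_eq_ev rhom_comp_ev[OF rhom_Const] by simp
      also have "peval (\<lambda>v. (1 / P i) * P v) (F j) = (1 / P i) ^ d * peval P (F j)"
        unfolding peval_eq_ev by (rule ev_scale_homog[OF F_homog[OF j]])
      also have "\<dots> = 0" using F_in[OF j] P by (simp add: I_comp_def)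
      finally show ?thesis by (simp add: Const_0)
    qed
    have "subst Var (F j) - subst g (F j) \<in> {al * x + be * y | x y. True}"
    proof (rule ideal_cong_ev[OF is_ideal_pair F_W[OF j]])
      fix v assume "v \<in> W"
      then consider "v = i" | "v = j'" | "v = k'" using W(1) by auto
      then show "Var v - g v \<in> {al * x + be * y | x y. True}"
      proof cases
        case 1
        then have "Var v - g v = 0" using i(2) by (simp add: g_def Const_1)
        then show ?thesis by (auto intro!: exI[of _ 0])
      next
        case 2
        then have "Var v - g v = al * 1 + be * 0" by (simp add: al_def)
        then show ?thesis by blast
      next
        case 3
        then have "Var v - g v = al * 0 + be * 1" by (simp add: be_def)
        then show ?thesis by blast
      qed
    qed
    then obtain x y where "F j = al * x + be * y" unfolding zero by auto
    then have "F j = x * al + y * be" by (simp only: mult.commute)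
    then show ?thesis by blast
  qed
  then obtain A B where AB: "\<And>j. j \<in> J \<Longrightarrow> F j = A j * al + B j * be" by metis

  define Y1 where "Y1 = (\<Sum>j\<in>J. Const (p j) * Y j)"
  define Y2 where "Y2 = (\<Sum>j\<in>J. Const (q j) * Y j)"
  \<comment> \<open>The syzygy behind this is \<open>be * (al * s) = al * (be * s)\<close>, expanded
    in the F_j.\<close>
  have comm: "theta be * Y1 - theta al * Y2 \<in> I"
  proof -
    have "(\<Sum>j\<in>J. (be * Const (p j) - al * Const (q j)) * F j) = be * (al * s) - al * (be * s)"
      unfolding p q sum_distrib_left sum_subtractf[symmetric]
      by (intro sum.cong refl) (simp add: algebra_simps)
    also have "\<dots> = 0" by (simp add: algebra_simps)
    finally have "(\<Sum>j\<in>J. theta (be * Const (p j) - al * Const (q j)) * Y j) \<in> I" by (rule syzygy_chart)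
    moreover have "(\<Sum>j\<in>J. theta (be * Const (p j) - al * Const (q j)) * Y j) = theta be * Y1 - theta al * Y2"
      unfolding Y1_def Y2_def sum_distrib_left sum_subtractf[symmetric]
      by (intro sum.cong refl)
        (simp add: rhom_minus[OF rhom_theta] rhom_mult[OF rhom_theta] theta_Const algebra_simps)
    ultimately show ?thesis by simp
  qed
  \<comment> \<open>The syzygy behind this is
    \<open>s * F j = A j * (al * s) + B j * (be * s)\<close>, expanded in the F_j.\<close>
  have local: "theta s * Y j - (theta (A j) * Y1 + theta (B j) * Y2) \<in> I" if j: "j \<in> J" for j
  proof -
    let ?d = "\<lambda>i. if i = j then 1 else 0 :: 'a"
    have delta: "(\<Sum>i\<in>J. Const (?d i) * h i) = h j" for h :: "nat \<Rightarrow> ('x, 'a) mpoly"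
    proof -
      have "(\<Sum>i\<in>J. Const (?d i) * h i) = (\<Sum>i\<in>J. if i = j then h i else 0)"
        by (intro sum.cong refl) (simp add: Const_0 Const_1)
      then show ?thesis using j finJ by simp
    qed
    have "(\<Sum>i\<in>J. (s * Const (?d i) - (A j * Const (p i) + B j * Const (q i))) * F i)
        = s * (\<Sum>i\<in>J. Const (?d i) * F i) - (A j * (al * s) + B j * (be * s))"
      unfolding p q sum_distrib_left sum_subtractf[symmetric] sum.distrib[symmetric]
      by (intro sum.cong refl) (simp add: algebra_simps)
    also have "\<dots> = 0" unfolding delta AB[OF j] by (simp add: algebra_simps)
    finally have "(\<Sum>i\<in>J. theta (s * Const (?d i) - (A j * Const (p i) + B j * Const (q i))) * Y i) \<in> I"
      by (rule syzygy_chart)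
    moreover have "(\<Sum>i\<in>J. theta (s * Const (?d i) - (A j * Const (p i) + B j * Const (q i))) * Y i)
        = theta s * (\<Sum>i\<in>J. Const (?d i) * Y i) - (theta (A j) * Y1 + theta (B j) * Y2)"
      unfolding Y1_def Y2_def sum_distrib_left sum_subtractf[symmetric] sum.distrib[symmetric]
      by (intro sum.cong refl)
        (simp add: rhom_minus[OF rhom_theta] rhom_add[OF rhom_theta] rhom_mult[OF rhom_theta] theta_Const algebra_simps)
    ultimately show ?thesis unfolding delta by simp
  qed

  let ?a = "\<lambda>(i, j). z n i * A j" and ?b = "\<lambda>(i, j). z n i * B j"
  obtain G where G: "\<And>S T. subst (\<lambda>v. ?a v * S + ?b v * T) f = (\<Sum>r\<le>k. G r * S ^ (k - r) * T ^ r)"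
    "\<And>S T. subst (\<lambda>v. theta (?a v) * S + theta (?b v) * T) f = (\<Sum>r\<le>k. theta (G r) * S ^ (k - r) * T ^ r)"
    using subst_binary_form[OF rhom_theta theta_Const f(2), of ?a ?b] by blast
  have "phi f = subst (\<lambda>v. ?a v * al + ?b v * be) f"
    unfolding phi_def
  proof (rule ev_cong[OF f(1)])
    fix v assume "v \<in> V"
    then obtain i j where v: "v = (i, j)" "j \<in> J" by (auto simp: XV_def J_eq)
    show "(case v of (i, j) \<Rightarrow> z n i * F j) = ?a v * al + ?b v * be"
      unfolding v(1) prod.case AB[OF v(2)] by (simp add: algebra_simps)
  qed
  then have G0: "(\<Sum>r\<le>k. G r * al ^ (k - r) * be ^ r) = 0" using f(3) G(1) by simp

  have subst_g: "subst (Var(j' := g j')) (g v) = g v" for v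
    using W by (simp add: g_def rhom_mult[OF rhom_subst] rhom_Const)
  have nz: "Var v - g v \<noteq> 0" if "v \<noteq> i" for v
  proof
    assume "Var v - g v = 0"
    then have "peval (\<lambda>w. if w = v then 1 else 0 :: 'a) (Var v - g v) = 0" by (simp add: rhom_zero[OF rhom_peval])
    then show False using that by (simp add: g_def rhom_minus[OF rhom_peval] rhom_mult[OF rhom_peval])
  qed
  have "subst (Var(j' := g j')) be = be"
    using W(4) unfolding be_def rhom_minus[OF rhom_subst] subst_g by (simp add: rhom_Const)
  \<comment> \<open>Substituting for w_j' kills \<open>al\<close> but fixes the nonzero form
    \<open>be\<close>, since \<open>be\<close> involves only w_i and w_k'.\<close>
  then have cop: "al dvd x" if "al dvd be * x" for x
    using Var_minus_dvd_cancel[OF subst_g, of be x] that nz[OF W(3)] unfolding al_def be_def by simp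
  have "(\<Sum>r\<le>k. theta (G r) * Y1 ^ (k - r) * Y2 ^ r) \<in> I"
    using binary_form_in_ideal[OF rhom_theta ideal _ cop G0 comm] nz[OF W(2)] unfolding al_def by blast
  then have mem: "subst (\<lambda>v. theta (?a v) * Y1 + theta (?b v) * Y2) f \<in> I" unfolding G(2) .
  \<comment> \<open>As f is homogeneous of degree k, the power of \<open>theta s\<close> distributes
    as one factor to each variable, where \<open>local\<close> applies.\<close>
  have "theta s ^ k * Xi f = subst (\<lambda>v. theta s * (case v of (i, j) \<Rightarrow> theta (z n i) * Y j)) f"
    unfolding Xi_def by (rule ev_scale_homog[OF f(2), symmetric])
  moreover have "subst (\<lambda>v. theta s * (case v of (i, j) \<Rightarrow> theta (z n i) * Y j)) f
      - subst (\<lambda>v. theta (?a v) * Y1 + theta (?b v) * Y2) f \<in> I"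
  proof (rule ideal_cong_ev[OF ideal f(1)])
    fix v assume "v \<in> V"
    then obtain i j where v: "v = (i, j)" "j \<in> J" by (auto simp: XV_def J_eq)
    have "theta s * (theta (z n i) * Y j) - (theta (z n i * A j) * Y1 + theta (z n i * B j) * Y2)
        = theta (z n i) * (theta s * Y j - (theta (A j) * Y1 + theta (B j) * Y2))"
      by (simp add: rhom_mult[OF rhom_theta] algebra_simps)
    then show "theta s * (case v of (i, j) \<Rightarrow> theta (z n i) * Y j) - (theta (?a v) * Y1 + theta (?b v) * Y2) \<in> I"
      using ideal_mult[OF ideal local[OF v(2)]] by (simp add: v(1))
  qed
  ultimately show ?thesis using ideal_cong_mem[OF ideal _ mem] by simp
qed

text \<open>The colon ideal of \<open>Xi f\<close> contains a power of each separator, hence one of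
  every combination of them. The power w_c^(d - 1) is such a combination and maps to a power of
  \<open>x0\<close>.\<close>

lemma x0_saturates:
  assumes f: "f \<in> polys_in V" "homog k f" "phi f = 0"
  shows "\<exists>K. x0 ^ K * f \<in> I"
proof -
  obtain s where s: "\<And>P. P \<in> X \<Longrightarrow> s P \<in> polys_in W" "\<And>P. P \<in> X \<Longrightarrow> homog (d - 1) (s P)"
    "\<And>P. P \<in> X \<Longrightarrow> \<forall>Q\<in>X. peval Q (s P) = (if P = Q then 1 else 0)"
    using exists_separators by metis
  define w :: "(nat, 'a) mpoly" where "w = Var (c - 1) ^ (d - 1)"
  have cW: "c - 1 \<in> W" using c by (auto simp: W_def)
  let ?u = "\<Sum>P\<in>X. Const (peval P w) * s P"
  \<comment> \<open>Interpolation: both forms have degree d - 1 and agree on X.\<close>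
  have "w - ?u = 0"
  proof (rule I_0)
    have "homog (d - 1) (Const (peval P w) * s P)" if "P \<in> X" for P
      using homog_mult[OF homog_Const s(2)[OF that]] by simp
    moreover have "homog (d - 1) w" using homog_power[OF homog_Var, of "d - 1" "c - 1"] by (simp add: w_def)
    moreover have "peval Q ?u = peval Q w" if "Q \<in> X" for Q
    proof -
      have "peval Q ?u = (\<Sum>P\<in>X. if P = Q then peval P w else 0)"
        unfolding rhom_sum[OF rhom_peval] rhom_mult[OF rhom_peval]
        using s(3) that by (intro sum.cong refl) simp
      then show ?thesis using that finite_X by simp
    qed
    ultimately show "w - ?u \<in> I_comp X (d - 1)"
      unfolding I_comp_def using s(1) cW
      by (auto simp: rhom_minus[OF rhom_peval] intro!: homog_minus homog_sum polys_in_minus polys_in_sum polys_in_mult polys_in_Const)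
         (simp add: w_def polys_in_power polys_in_Var)
  qed
  then have "theta w = theta ?u" by (intro arg_cong[of _ _ theta]) simp
  then have w: "theta w = (\<Sum>P\<in>X. Const (peval P w) * theta (s P))"
    unfolding rhom_sum[OF rhom_theta] rhom_mult[OF rhom_theta] theta_Const .
  let ?Q = "{t. t * Xi f \<in> I}"
  have Q: "is_ideal ?Q" by (rule is_ideal_colon[OF ideal])
  have "(Const (peval P w) * theta (s P)) ^ k \<in> ?Q" if "P \<in> X" for P
    unfolding power_mult_distrib using Xi_separator[OF that s(1)[OF that] s(2)[OF that] s(3)[OF that] f]
    by (intro ideal_mult[OF Q]) simp
  then obtain K where "theta w ^ K \<in> ?Q"
    using ideal_power_sum[OF Q finite_X, of "\<lambda>P. Const (peval P w) * theta (s P)" k] unfolding w by blast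
  then have K: "x0 ^ ((d - 1) * K) * Xi f \<in> I"
    unfolding w_def rhom_power[OF rhom_theta] theta_x0 mem_Collect_eq power_mult .
  \<comment> \<open>Homogeneity pulls the powers of \<open>x0\<close> out of f, so the statement
    about the pullback returns to f itself.\<close>
  have "subst (\<lambda>v. x0 ^ Suc n * Var v) f - subst (\<lambda>v. x0 * (case v of (i, j) \<Rightarrow> theta (z n i) * Y j)) f \<in> I"
    by (rule ideal_cong_ev[OF ideal f(1)]) (use chart_expand in \<open>auto split: prod.split\<close>)
  then have "(x0 ^ Suc n) ^ k * f - x0 ^ k * Xi f \<in> I"
    unfolding ev_scale_homog[OF f(2)] Xi_def by simp
  then have "x0 ^ ((d - 1) * K) * ((x0 ^ Suc n) ^ k * f) - x0 ^ ((d - 1) * K) * (x0 ^ k * Xi f) \<in> I"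
    by (rule ideal_cong_mult_left[OF ideal])
  moreover have "x0 ^ ((d - 1) * K) * (x0 ^ k * Xi f) \<in> I"
    using ideal_mult[OF ideal K, of "x0 ^ k"] by (simp only: mult.left_commute)
  ultimately have "x0 ^ ((d - 1) * K) * ((x0 ^ Suc n) ^ k * f) \<in> I"
    by (rule ideal_cong_mem[OF ideal])
  then have "x0 ^ ((d - 1) * K + Suc n * k) * f \<in> I"
    by (simp only: power_add power_mult mult.assoc)
  then show ?thesis by blast
qed

end

section \<open>Gluing the charts and the homogeneous components\<close>

context blowup
begin

lemma homogeneous_saturated:
  assumes f: "f \<in> polys_in V" "homog k f" "phi f = 0" and v: "v \<in> V"
  shows "\<exists>K. Var v ^ K * f \<in> ideal_gen UNIV gens"
proof -
  interpret box_ideal n d "ideal_gen UNIV gens"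
  proof
    show "box_minors (replicate n 3 @ [d + 1]) (boxA n) \<subseteq> ideal_gen UNIV gens"
      unfolding gens_def by (intro subsetI ideal_gen_incl UnI2)
  qed (fact n_pos is_ideal_ideal_gen_UNIV)+
  show ?thesis
  proof (rule saturate_from_constant[OF _ v])
    fix c j :: nat assume cj: "c \<in> {1, 2, 3}" "j \<in> {1..d+1}"
    interpret blowup_chart d X F J n M c j by unfold_locales (fact cj)+
    show "\<exists>K. boxA n (replicate n c @ [j]) ^ K * f \<in> ideal_gen UNIV gens"
      using x0_saturates[OF f] by (simp add: x0_def base_def)
  qed
qed

lemma image_ideal_subset: "image_ideal n d F \<subseteq> saturation V (ideal_gen V gens)"
proof
  fix f assume "f \<in> image_ideal n d F"
  then have f: "f \<in> polys_in V" "phi f = 0" by (auto simp: image_ideal_eq)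
  let ?I = "ideal_gen UNIV gens" and ?c = "\<lambda>k. filt (\<lambda>j. j = k) f"
  note I = is_ideal_ideal_gen_UNIV[of gens]
  obtain D where "filt (\<lambda>j. j < D) f = f" using filt_less_exists[of f] by blast
  then have sum: "f = (\<Sum>k<D. ?c k)" by (rule sum_filt_eq)
  \<comment> \<open>On forms \<open>phi\<close> multiplies the degree by n + d, which is positive,
    so images of different components have different degrees and cannot cancel.\<close>
  have comp: "phi (?c k) = 0" if "k < D" for k
  proof -
    have hom: "homog (i * (n + d)) (phi (?c i))" for i
      by (intro phi_homog polys_in_filt f(1) homog_filt_eq)
    have inj: "i * (n + d) = k * (n + d) \<longleftrightarrow> i = k" for i using n_pos by simp
    have "0 = filt (\<lambda>j. j = k * (n + d)) (phi f)" by (simp add: f(2))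
    also have "\<dots> = (\<Sum>i<D. filt (\<lambda>j. j = k * (n + d)) (phi (?c i)))"
      by (subst sum) (simp only: rhom_sum[OF rhom_phi] filt_sum)
    also have "\<dots> = (\<Sum>i<D. if i = k then phi (?c i) else 0)"
      by (intro sum.cong refl) (simp only: filt_homog[OF hom] inj)
    finally show ?thesis using that by simp
  qed
  have "\<exists>K. \<forall>v\<in>V. \<forall>k<D. Var v ^ K * ?c k \<in> ?I"
  proof -
    have "\<forall>p\<in>V \<times> {..<D}. \<exists>K. Var (fst p) ^ K * ?c (snd p) \<in> ?I"
      using homogeneous_saturated[OF polys_in_filt[OF f(1)] homog_filt_eq comp] by auto
    then obtain K where K: "\<And>p. p \<in> V \<times> {..<D} \<Longrightarrow> Var (fst p) ^ K p * ?c (snd p) \<in> ?I"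
      by metis
    have fin: "finite (V \<times> {..<D})" by (simp add: XV_def)
    \<comment> \<open>Saturation asks for one exponent valid for all variables; the sum over the
      finitely many pairs of variable and degree dominates each of them.\<close>
    have "Var v ^ sum K (V \<times> {..<D}) * ?c k \<in> ?I" if "v \<in> V" "k < D" for v k
    proof -
      have p: "(v, k) \<in> V \<times> {..<D}" using that by simp
      then have "K (v, k) \<le> sum K (V \<times> {..<D})" using fin by (intro member_le_sum) auto
      then have "Var v ^ sum K (V \<times> {..<D}) * ?c k
          = Var v ^ (sum K (V \<times> {..<D}) - K (v, k)) * (Var v ^ K (v, k) * ?c k)"
        by (simp add: power_add[symmetric] mult.assoc[symmetric])
      also have "\<dots> \<in> ?I" using ideal_mult[OF I K[OF p]] by (simp only: fst_conv snd_conv)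
      finally show ?thesis .
    qed
    then show ?thesis by blast
  qed
  then obtain K where K: "\<And>v k. v \<in> V \<Longrightarrow> k < D \<Longrightarrow> Var v ^ K * ?c k \<in> ?I" by blast
  have "Var v ^ K * f \<in> ideal_gen V gens" if "v \<in> V" for v
  proof (rule ideal_gen_UNIV_Int_polys_in[OF _ _ gens_in])
    show "Var v ^ K * f \<in> polys_in V" using that f(1) by (intro polys_in_intros)
    have "Var v ^ K * f = (\<Sum>k<D. Var v ^ K * ?c k)" by (subst sum) (rule sum_distrib_left)
    also have "\<dots> \<in> ?I" using K[OF that] by (intro ideal_sum[OF I]) simp
    finally show "Var v ^ K * f \<in> ?I" .
  qed
  then show "f \<in> saturation V (ideal_gen V gens)" 
    unfolding saturation_def using f(1) by (intro CollectI conjI exI[of _ K] ballI)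
qed

lemma saturation_eq: "saturation V (ideal_gen V gens) = image_ideal n d F"
  using saturation_subset image_ideal_subset by blast

end

theorem theorem2p6:
  fixes d n :: nat
    and X :: "(nat \<Rightarrow> 'k::field_char_0) set"
    and F :: "nat \<Rightarrow> (nat, 'k) mpoly"
  assumes "alg_closed TYPE('k)"
    and "d \<ge> 1" and "n \<ge> 1"
    and "proj_points X" and "card X = (d+1) choose 2"
    and "generic_position X"
    and "\<forall>j\<in>{1..d+1}. F j \<in> I_comp X d"
    and "\<forall>f\<in>I_comp X d. \<exists>c. f = (\<Sum>j=1..d+1. smul (c j) (F j))"
    and "inj_on F {1..d+1}" and "\<not> module.dependent smul (F ` {1..d+1})"
  shows "\<exists>(L :: nat \<Rightarrow> (nat \<times> nat, 'k) mpoly) (r :: nat list) (A :: nat list \<Rightarrow> (nat \<times> nat, 'k) mpoly).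
     let V = XV ((n+2) choose 2) d; N = ((n+1) choose 2) * d in
       (\<forall>i<N. L i \<in> polys_in V \<and> homog 1 (L i)) \<and>
       inj_on L {..<N} \<and> \<not> module.dependent smul (L ` {..<N}) \<and>
       (\<forall>k<length r. r ! k \<ge> 1) \<and>
       (\<forall>a\<in>box_index r. A a \<in> polys_in V \<and> homog 1 (A a)) \<and>
       saturation V (ideal_gen V (L ` {..<N} \<union> box_minors r A)) = image_ideal n d F"
proof -
  interpret plane_points d X F "{1..d+1}"
  proof
    show "card X = (d + 1) choose 2" by fact
    show "f = 0" if "f \<in> I_comp X (d - 1)" for f
      using assms(6,5,2) that by (rule generic_position_imp_I_comp_eq_0)
    show "F j \<in> I_comp X d" if "j \<in> {1..d+1}" for j using assms(7) that by blast
    show "\<exists>c. f = (\<Sum>j\<in>{1..d+1}. Const (c j) * F j)" if "f \<in> I_comp X d" for f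
      using assms(8) that unfolding smul_def by blast
    show "c j = 0" if "(\<Sum>j\<in>{1..d+1}. Const (c j) * F j) = 0" "j \<in> {1..d+1}" for c j
      using independent_family_iff[of "{1..d+1}" F] assms(9,10) that unfolding smul_def by blast
  qed (use assms in simp_all)
  obtain M where M: "\<And>k j. M k j \<in> polys_in W" "\<And>k j. homog 1 (M k j)"
    "\<And>k. k < d \<Longrightarrow> (\<Sum>j\<in>{1..d+1}. M k j * F j) = 0"
    "\<And>s. (\<Sum>j\<in>{1..d+1}. s j * F j) = 0 \<Longrightarrow> \<exists>q. \<forall>j\<in>{1..d+1}. s j = (\<Sum>k<d. q k * M k j)"
    "\<And>q. \<forall>j\<in>{1..d+1}. (\<Sum>k<d. q k * M k j) = 0 \<Longrightarrow> \<forall>k<d. q k = 0"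
    using hilbert_burch_matrix by blast
  interpret blowup d X F "{1..d+1}" n M
    by unfold_locales (fact assms(3) refl M)+
  let ?S = "exps (n - 1) \<times> {..<d}" and ?N = "((n + 1) choose 2) * d"
  have fin: "finite ?S" using finite_exps by simp
  have "n - 1 + 2 = n + 1" using assms(3) by simp
  then have "card ?S = ?N" by (simp only: card_cartesian_product card_exps card_lessThan)
  \<comment> \<open>The forms are indexed by pairs of a monomial of degree n - 1 and a row; the
    statement asks for an enumeration by numbers.\<close>
  then obtain g where g: "bij_betw g {..<?N} ?S"
    using ex_bij_betw_nat_finite[OF fin] by (auto simp: atLeast0LessThan)
  have "inj_on Lf ?S \<and> \<not> module.dependent smul (Lf ` ?S)"
    using independent_family_iff[OF fin, of Lf] Lf_indep by blast
  moreover have img: "(Lf \<circ> g) ` {..<?N} = Lf ` ?S"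
    unfolding image_comp[symmetric] bij_betw_imp_surj_on[OF g] ..
  ultimately have indep: "inj_on (Lf \<circ> g) {..<?N}" "\<not> module.dependent smul ((Lf \<circ> g) ` {..<?N})"
    using g by (auto simp: bij_betw_def intro!: comp_inj_on)
  have "\<forall>k<length (replicate n 3 @ [d + 1]). (replicate n 3 @ [d + 1]) ! k \<ge> (1::nat)"
    by (auto simp: nth_append)
  moreover have "\<forall>a\<in>box_index (replicate n 3 @ [d + 1]). boxA n a \<in> polys_in V \<and> homog 1 (boxA n a :: (nat \<times> nat, 'k) mpoly)"
  proof (intro ballI conjI)
    fix a assume "a \<in> box_index (replicate n 3 @ [d + 1])"
    then show "boxA n a \<in> polys_in V" by (intro boxA_in) (simp only: box_def)
    show "homog 1 (boxA n a :: (nat \<times> nat, 'k) mpoly)" unfolding boxA_def by (rule homog_Var)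
  qed
  moreover have "saturation V (ideal_gen V ((Lf \<circ> g) ` {..<?N} \<union> box_minors (replicate n 3 @ [d + 1]) (boxA n)))
      = image_ideal n d F"
    unfolding img gens_def[symmetric] by (rule saturation_eq)
  moreover have "\<forall>i<?N. (Lf \<circ> g) i \<in> polys_in V \<and> homog 1 ((Lf \<circ> g) i)"
    using Lf_in Lf_homog by simp
  ultimately show ?thesis
    unfolding Let_def using indep
    by (intro exI[of _ "Lf \<circ> g"] exI[of _ "replicate n 3 @ [d + 1]"] exI[of _ "boxA n"] conjI)
qed

end
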